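(* Let $A$ be a nonnegative selfadjoint operator in a real Hilbert space $H$. Let $m\in\mathbb{N}\cup\{0\}$ and assume $(u_0,u_1)\in D(A^{m+1/2})\times D(A^{m+1/2})$. Let $u$ be the unique solution of $$u''(t)+Au(t)+u'(t)=0\quad (t>0),\qquad (u,u')(0)=(u_0,u_1).$$ Put $v_0=u_0+u_1$, $\overline{u}_0(t)=e^{-tA}v_0$, and for $\ell\in\mathbb{N}$ $$\overline{u}_\ell(t)=A^\ell\left(\sum_{j=0}^{\ell}\binom{2\ell-1}{\ell+j-1}\frac{(-tA)^j}{j!}e^{-tA}v_0+\sum_{k=0}^{\ell-1}\binom{2\ell-1}{\ell+k}\frac{(-tA)^k}{k!}e^{-tA}u_1\right).$$ Then there exists a positive constant $C$ such that for every $t\ge 0$, $$\left\|u(t)-\sum_{\ell=0}^{m}\overline{u}_\ell(t)\right\|\le C(1+t)^{-m-1/2}.$$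
   Context: $H$ is a real Hilbert space with inner product $(\cdot,\cdot)$ and norm $\|\cdot\|$; $\mathbb{N}=\{1,2,\dots\}$. $D(T)$ denotes the domain of an operator $T$; fractional powers $A^{s}$, $s\ge 0$, are defined by the functional calculus and their domains carry the graph norm. $e^{-tA}$, $t\ge0$, is the $C_0$-semigroup on $H$ generated by $-A$. The operators $(-tA)^j e^{-tA}$ are understood as bounded operators on $H$ via the functional calculus (so for $t=0$ they equal the identity if $j=0$ and $0$ if $j\ge1$). Notion of solution: let $\mathcal{H}=D(A^{1/2})\times H$ and let $\mathcal{A}(u,v)=(-v,\,Au+v)$ with domain $D(\mathcal{A})=D(A)\times D(A^{1/2})$; $-\mathcal{A}$ generates a $C_0$-semigroup $e^{-t\mathcal{A}}$ on $\mathcal{H}$. For $(u_0,u_1)\in\mathcal{H}$ the solution $u$ is given by $(u(t),u'(t))=e^{-t\mathcal{A}}(u_0,u_1)$; it belongs to $C^1([0,\infty);H)\cap C([0,\infty);D(A^{1/2}))$, and the equation holds in the dual space of $D(A^{1/2})$. *)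

theory Defs
  imports "HOL-Analysis.Analysis"
begin

text \<open>A (possibly unbounded) operator is represented by its graph, so that equality of operators
  includes equality of their domains and \<^const>\<open>Domain\<close> is the usual domain.\<close>

type_synonym 'a operator = "('a \<times> 'a) set"

definition linear_operator :: "'a::real_vector operator \<Rightarrow> bool" where
  "linear_operator A \<longleftrightarrow> subspace A \<and> single_valued A"

definition op_app :: "'a operator \<Rightarrow> 'a \<Rightarrow> 'a" where
  "op_app A x = (THE y. (x, y) \<in> A)"

definition op_neg :: "'a::real_vector operator \<Rightarrow> 'a operator" where
  "op_neg A = {(x, - y) | x y. (x, y) \<in> A}"

definition op_adjoint :: "'a::real_inner operator \<Rightarrow> 'a operator" where
  "op_adjoint A = {(y, z). \<forall>(x, w) \<in> A. inner w y = inner x z}"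

definition selfadjoint :: "'a::real_inner operator \<Rightarrow> bool" where
  "selfadjoint A \<longleftrightarrow> linear_operator A \<and> closure (Domain A) = UNIV \<and> op_adjoint A = A"

definition nonneg_operator :: "'a::real_inner operator \<Rightarrow> bool" where
  "nonneg_operator A \<longleftrightarrow> (\<forall>(x, y) \<in> A. 0 \<le> inner y x)"


section \<open>Functional calculus\<close>

text \<open>Projection-valued measures on the Borel sets of the real line. The values of \<open>E\<close> on
  non-Borel sets are irrelevant.\<close>

definition spectral_measure :: "(real set \<Rightarrow> 'a::real_inner \<Rightarrow> 'a) \<Rightarrow> bool" where
  "spectral_measure E \<longleftrightarrow>
     (\<forall>B \<in> sets borel. bounded_linear (E B) \<and> (\<forall>x y. inner (E B x) y = inner x (E B y))) \<and>
     (\<forall>B \<in> sets borel. \<forall>C \<in> sets borel. \<forall>x. E (B \<inter> C) x = E B (E C x)) \<and>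
     (\<forall>x. E {} x = 0) \<and> (\<forall>x. E UNIV x = x) \<and>
     (\<forall>F :: nat \<Rightarrow> real set. range F \<subseteq> sets borel \<longrightarrow> disjoint_family F \<longrightarrow>
        (\<forall>x. (\<lambda>n. E (F n) x) sums E (\<Union>n. F n) x))"

definition scalar_measure :: "(real set \<Rightarrow> 'a::real_inner \<Rightarrow> 'a) \<Rightarrow> 'a \<Rightarrow> real measure" where
  "scalar_measure E x = measure_of UNIV (sets borel) (\<lambda>B. ennreal (inner (E B x) x))"

definition spectral_domain :: "(real set \<Rightarrow> 'a::real_inner \<Rightarrow> 'a) \<Rightarrow> (real \<Rightarrow> real) \<Rightarrow> 'a set" where
  "spectral_domain E f = {x. integrable (scalar_measure E x) (\<lambda>r. (f r)\<^sup>2)}"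

text \<open>The operator \<open>\<integral> f dE\<close> for Borel \<open>f\<close>, given by \<open>(y, z) = \<integral> f(r) d(E(r)x, z)\<close>. The integral
  against the signed measure is expressed by polarization; for this \<open>z\<close> is restricted to the
  domain, which is a dense subspace, so that \<open>f\<close> is integrable for the two measures involved.\<close>

definition spectral_integral ::
    "(real set \<Rightarrow> 'a::real_inner \<Rightarrow> 'a) \<Rightarrow> (real \<Rightarrow> real) \<Rightarrow> 'a operator" where
  "spectral_integral E f = {(x, y). x \<in> spectral_domain E f \<and>
     (\<forall>z \<in> spectral_domain E f. inner y z =
        ((\<integral>r. f r \<partial>scalar_measure E (x + z)) - (\<integral>r. f r \<partial>scalar_measure E (x - z))) / 4)}"

definition is_spectral_measure_of ::
    "(real set \<Rightarrow> 'a::real_inner \<Rightarrow> 'a) \<Rightarrow> 'a operator \<Rightarrow> bool" where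
  "is_spectral_measure_of E A \<longleftrightarrow> spectral_measure E \<and> spectral_integral E (\<lambda>r. r) = A"

text \<open>The operator \<open>f(A)\<close>. By the spectral theorem a selfadjoint \<open>A\<close> has a spectral measure, and it
  is unique on Borel sets, so that the existential quantifier does not introduce any choice.
  If \<open>A\<close> is nonnegative, the spectral measure vanishes on the negative half-line and only the
  values of \<open>f\<close> on \<open>[0, \<infinity>)\<close> matter.\<close>

definition op_fun :: "'a::real_inner operator \<Rightarrow> (real \<Rightarrow> real) \<Rightarrow> 'a operator" where
  "op_fun A f = {(x, y). \<exists>E. is_spectral_measure_of E A \<and> (x, y) \<in> spectral_integral E f}"

text \<open>The case \<open>s = 0\<close> is separate because \<open>0 powr 0 = 0\<close>.\<close>

definition op_power :: "'a::real_inner operator \<Rightarrow> real \<Rightarrow> 'a operator" where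
  "op_power A s = op_fun A (\<lambda>r. if s = 0 then 1 else r powr s)"


section \<open>Strongly continuous semigroups\<close>

text \<open>Semigroups on a linear subspace \<open>X\<close> of the ambient type, with its own norm \<open>N\<close>; this is
  needed because the energy space below is not a type. Values of \<open>T\<close> outside \<open>X\<close> or at negative
  times are irrelevant.\<close>

definition c0_semigroup ::
    "'b::real_vector set \<Rightarrow> ('b \<Rightarrow> real) \<Rightarrow> (real \<Rightarrow> 'b \<Rightarrow> 'b) \<Rightarrow> bool" where
  "c0_semigroup X N T \<longleftrightarrow>
     (\<forall>t\<ge>0. T t ` X \<subseteq> X \<and>
        (\<forall>x\<in>X. \<forall>y\<in>X. \<forall>a b. T t (a *\<^sub>R x + b *\<^sub>R y) = a *\<^sub>R T t x + b *\<^sub>R T t y) \<and>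
        (\<exists>M. \<forall>x\<in>X. N (T t x) \<le> M * N x)) \<and>
     (\<forall>x\<in>X. T 0 x = x) \<and>
     (\<forall>s\<ge>0. \<forall>t\<ge>0. \<forall>x\<in>X. T (s + t) x = T s (T t x)) \<and>
     (\<forall>x\<in>X. \<forall>t\<ge>0. ((\<lambda>s. N (T s x - T t x)) \<longlongrightarrow> 0) (at t within {0..}))"

definition generator ::
    "'b::real_vector set \<Rightarrow> ('b \<Rightarrow> real) \<Rightarrow> (real \<Rightarrow> 'b \<Rightarrow> 'b) \<Rightarrow> 'b operator" where
  "generator X N T = {(x, y). x \<in> X \<and> y \<in> X \<and>
     ((\<lambda>h. N ((T h x - x) /\<^sub>R h - y)) \<longlongrightarrow> 0) (at_right 0)}"

definition generates_semigroup ::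
    "'b::real_vector set \<Rightarrow> ('b \<Rightarrow> real) \<Rightarrow> 'b operator \<Rightarrow> (real \<Rightarrow> 'b \<Rightarrow> 'b) \<Rightarrow> bool" where
  "generates_semigroup X N B T \<longleftrightarrow> c0_semigroup X N T \<and> generator X N T = B"

text \<open>\<open>e\<^sup>-\<^sup>t\<^sup>A x\<close>, where \<open>e\<^sup>-\<^sup>t\<^sup>A\<close> is the semigroup generated by \<open>-A\<close>.\<close>

definition exp_semigroup :: "'a::real_normed_vector operator \<Rightarrow> real \<Rightarrow> 'a \<Rightarrow> 'a" where
  "exp_semigroup A t x =
     (THE y. \<exists>T. generates_semigroup UNIV norm (op_neg A) T \<and> y = T t x)"


section \<open>The damped wave equation\<close>

definition energy_space :: "'a::real_inner operator \<Rightarrow> ('a \<times> 'a) set" where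
  "energy_space A = Domain (op_power A (1/2)) \<times> UNIV"

definition energy_norm :: "'a::real_inner operator \<Rightarrow> 'a \<times> 'a \<Rightarrow> real" where
  "energy_norm A = (\<lambda>(u, v).
     sqrt ((norm u)\<^sup>2 + (norm (op_app (op_power A (1/2)) u))\<^sup>2 + (norm v)\<^sup>2))"

definition wave_operator :: "'a::real_inner operator \<Rightarrow> ('a \<times> 'a) operator" where
  "wave_operator A =
     {((u, v), (- v, w + v)) | u v w. (u, w) \<in> A \<and> v \<in> Domain (op_power A (1/2))}"

text \<open>Solution of \<open>u'' + A u + u' = 0\<close>, \<open>(u, u')(0) = (u0, u1)\<close>: the pair \<open>(u(t), u'(t))\<close> is
  the orbit of \<open>(u0, u1)\<close> under the semigroup on the energy space.\<close>

definition wave_solution ::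
    "'a::real_inner operator \<Rightarrow> 'a \<Rightarrow> 'a \<Rightarrow> (real \<Rightarrow> 'a) \<Rightarrow> bool" where
  "wave_solution A u0 u1 u \<longleftrightarrow>
     (\<exists>T. generates_semigroup (energy_space A) (energy_norm A) (op_neg (wave_operator A)) T \<and>
       (\<forall>t\<ge>0. u t = fst (T t (u0, u1)) \<and>
         (u has_vector_derivative snd (T t (u0, u1))) (at t within {0..})))"


section \<open>The asymptotic profiles\<close>

text \<open>\<open>(-tA)\<^sup>j e\<^sup>-\<^sup>t\<^sup>A\<close> as a single bounded operator.\<close>

definition power_exp :: "'a::real_inner operator \<Rightarrow> nat \<Rightarrow> real \<Rightarrow> 'a \<Rightarrow> 'a" where
  "power_exp A j t = op_app (op_fun A (\<lambda>r. (- (t * r)) ^ j * exp (- (t * r))))"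

definition profile :: "'a::real_inner operator \<Rightarrow> 'a \<Rightarrow> 'a \<Rightarrow> nat \<Rightarrow> real \<Rightarrow> 'a" where
  "profile A u0 u1 l t =
     (if l = 0 then exp_semigroup A t (u0 + u1)
      else op_app (op_power A (real l))
        ((\<Sum>j=0..l. (real ((2 * l - 1) choose (l + j - 1)) / fact j) *\<^sub>R power_exp A j t (u0 + u1)) +
         (\<Sum>k=0..l - 1. (real ((2 * l - 1) choose (l + k)) / fact k) *\<^sub>R power_exp A k t u1)))"

end

theory Submission
  imports Defs
begin

text \<open>
  Let \<open>v\<^sub>0 = u\<^sub>0 + u\<^sub>1\<close>. By the functional calculus the solution and the profiles have the form
  \<open>f(A) v\<^sub>0 + g(A) u\<^sub>1\<close>, and \<open>|f(A) x|\<^sup>2\<close> is the integral of \<open>f\<^sup>2\<close> with respect to the scalar spectral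
  measure of \<open>x\<close>, which lives on \<open>[0, \<infinity>)\<close>. Hence the theorem follows from a pointwise bound for
  the two multipliers of the remainder by \<open>C (1 + t)\<^sup>-\<^sup>m\<^sup>-\<^sup>1 (1 + r\<^sup>m\<^sup>+\<^sup>1\<^sup>/\<^sup>2)\<close> for \<open>r, t \<ge> 0\<close>
  (\<open>solution_mult_asymptotics\<close>).

  For \<open>r \<ge> 3/16\<close> the multipliers of the solution and of the profiles decay exponentially in \<open>t\<close>, up
  to a factor \<open>r\<^sup>l\<close> with \<open>l \<le> m\<close>, which the weight absorbs. For \<open>r \<le> 3/16\<close> the equation
  \<open>w'' + w' + r w = 0\<close> has the exponents \<open>-\<lambda>\<close> and \<open>-(1 - \<lambda>)\<close>, where \<open>\<lambda> = r c\<close> and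
  \<open>c = 2/(1 + s)\<close>, \<open>s = \<surd>(1 - 4r)\<close>, is the generating function of the Catalan numbers. The second
  exponential is negligible. Since \<open>\<lambda> = r + \<lambda>\<^sup>2\<close>, the first one is \<open>exp(-tr) exp(-t\<lambda>\<^sup>2)\<close>, and expanding the
  last factor gives terms \<open>(-tr)\<^sup>j/j! r\<^sup>j c\<^sup>2\<^sup>j exp(-tr)\<close>, to be multiplied by the coefficients \<open>1/(c s)\<close> of
  \<open>v\<^sub>0\<close> and \<open>r c/s\<close> of \<open>u\<^sub>1\<close>. The power series of \<open>c\<^sup>k/s\<close> has the coefficients
  \<open>(2n + k) choose n\<close>; these are the binomial coefficients of the profiles, and collecting the terms
  with \<open>r\<^sup>l\<close> for \<open>l \<le> m\<close> gives the profiles exactly. What remains is bounded by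
  \<open>C r\<^sup>m\<^sup>+\<^sup>1 (1 + tr)\<^sup>m\<^sup>+\<^sup>1 exp(-tr)\<close>, hence by a constant times \<open>(1 + t)\<^sup>-\<^sup>m\<^sup>-\<^sup>1\<close>.

  The other half of the proof shows that the objects of the statement are the expected functions of
  \<open>A\<close>. The functional calculus \<open>fun_op\<close> is the isometric extension to \<open>L\<^sup>2\<close> of the obvious operation
  on simple functions. The operators \<open>exp(-tA)\<close> that it yields form a semigroup with generator \<open>-A\<close>,
  and the multipliers of \<open>w'' + w' + r w = 0\<close> yield the orbits of the damped wave equation. Both are
  the only ones: the difference of two orbits has a right derivative everywhere, and an energy estimate
  forces it to vanish (\<open>right_derivative_energy_zero\<close>). Uniqueness of \<open>exp(-tA)\<close> also shows
  that all spectral measures of \<open>A\<close> have the same scalar measures, because these have the same Laplace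
  transforms; so \<open>op_fun\<close>, which quantifies over the spectral measures, is single-valued
  (\<open>op_fun_eq\<close>).
\<close>

section \<open>The scalar measures of a spectral measure and its simple functions\<close>

locale spectral_calculus =
  fixes E :: "real set \<Rightarrow> 'a::{real_inner,complete_space} \<Rightarrow> 'a"
  assumes spectral_measure: "spectral_measure E"
begin

lemma bounded_linear_E: "B \<in> sets borel \<Longrightarrow> bounded_linear (E B)"
  and E_symmetric: "B \<in> sets borel \<Longrightarrow> inner (E B x) y = inner x (E B y)"
  using spectral_measure[unfolded spectral_measure_def, THEN conjunct1] by simp_all

lemma E_E: "B \<in> sets borel \<Longrightarrow> C \<in> sets borel \<Longrightarrow> E B (E C x) = E (B \<inter> C) x"
  using spectral_measure[unfolded spectral_measure_def, THEN conjunct2, THEN conjunct1] by simp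

lemma E_empty [simp]: "E {} x = 0" and E_UNIV [simp]: "E UNIV x = x"
  using spectral_measure[unfolded spectral_measure_def, THEN conjunct2, THEN conjunct2]
  by simp_all

lemma E_sums:
  "range F \<subseteq> sets borel \<Longrightarrow> disjoint_family F \<Longrightarrow> (\<lambda>n::nat. E (F n) x) sums E (\<Union>n. F n) x"
  using spectral_measure[unfolded spectral_measure_def, THEN conjunct2, THEN conjunct2,
      THEN conjunct2, THEN conjunct2] by simp

lemma E_inner_E:
  assumes "B \<in> sets borel" "C \<in> sets borel"
  shows "inner (E B x) (E C y) = inner (E (B \<inter> C) x) y"
  by (metis E_E E_symmetric assms inner_commute Int_commute)

lemma E_quadratic: "B \<in> sets borel \<Longrightarrow> inner (E B x) x = (norm (E B x))\<^sup>2"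
  using E_inner_E[of B B x x] by (simp add: power2_norm_eq_inner)

lemma E_linear_simps:
  assumes "B \<in> sets borel"
  shows "E B (x + y) = E B x + E B y" "E B (x - y) = E B x - E B y" "E B (c *\<^sub>R x) = c *\<^sub>R E B x"
    "E B 0 = 0" "E B (- x) = - E B x" "E B (sum f S) = (\<Sum>i\<in>S. E B (f i))"
  using bounded_linear.linear[OF bounded_linear_E[OF assms]]
  by (simp_all add: linear_add linear_diff linear_scale linear_0 linear_neg linear_sum)

abbreviation \<mu> :: "'a \<Rightarrow> real measure" where
  "\<mu> x \<equiv> scalar_measure E x"

lemma space_\<mu> [simp]: "space (\<mu> x) = UNIV"
  and sets_\<mu> [simp, measurable_cong]: "sets (\<mu> x) = sets borel"
proof -
  have "sets borel \<subseteq> Pow (UNIV :: real set)" by auto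
  then show "space (\<mu> x) = UNIV" "sets (\<mu> x) = sets borel"
    unfolding scalar_measure_def
    using sigma_algebra.sigma_sets_eq[OF sets.sigma_algebra_axioms[of "borel :: real measure"]]
    by (simp_all add: space_measure_of sets_measure_of)
qed

lemma borel_measurable_\<mu> [simp]: "borel_measurable (\<mu> x) = borel_measurable borel"
  by (rule measurable_cong_sets) auto

lemma emeasure_\<mu>:
  assumes "B \<in> sets borel"
  shows "emeasure (\<mu> x) B = ennreal (inner (E B x) x)"
  unfolding scalar_measure_def
proof (rule emeasure_measure_of_sigma[OF _ _ _ assms])
  show "sigma_algebra UNIV (sets (borel :: real measure))"
    using sets.sigma_algebra_axioms[of "borel :: real measure"] by simp
  show "positive (sets borel) (\<lambda>B. ennreal (inner (E B x) x))"
    by (simp add: positive_def)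
  show "countably_additive (sets borel) (\<lambda>B. ennreal (inner (E B x) x))"
    unfolding countably_additive_def
  proof (intro allI impI)
    fix F :: "nat \<Rightarrow> real set"
    assume F: "range F \<subseteq> sets borel" "disjoint_family F"
    then have "(\<lambda>n. inner (E (F n) x) x) sums inner (E (\<Union>n. F n) x) x"
      using E_sums[OF F, of x]
      by (intro bounded_linear.sums[OF bounded_linear_inner_left])
    moreover have "0 \<le> inner (E (F n) x) x" for n
      using F by (subst E_quadratic) auto
    ultimately show "(\<Sum>n. ennreal (inner (E (F n) x) x)) = ennreal (inner (E (\<Union>n. F n) x) x)"
      by (intro suminf_ennreal_eq)
  qed
qed

lemma finite_measure_\<mu>: "finite_measure (\<mu> x)"
  by (rule finite_measureI) (simp add: emeasure_\<mu>)

lemma measure_\<mu>: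
  assumes "B \<in> sets borel"
  shows "measure (\<mu> x) B = inner (E B x) x"
  using assms emeasure_\<mu>[OF assms] by (simp add: measure_def E_quadratic)

lemma \<mu>_uminus: "\<mu> (- x) = \<mu> x"
  by (rule measure_eqI) (auto simp: emeasure_\<mu> E_linear_simps)

lemma integrable_bounded_\<mu>:
  fixes f :: "real \<Rightarrow> real"
  assumes "f \<in> borel_measurable borel" "AE r in \<mu> x. \<bar>f r\<bar> \<le> b"
  shows "integrable (\<mu> x) f"
proof (rule finite_measure.integrable_const_bound[OF finite_measure_\<mu>])
  show "AE r in \<mu> x. norm (f r) \<le> b" using assms(2) by (simp only: real_norm_def)
  show "f \<in> borel_measurable (\<mu> x)" using assms(1) by simp
qed

lemma integrable_simple_\<mu>:
  fixes g :: "real \<Rightarrow> real"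
  assumes g: "simple_function borel g"
  shows "integrable (\<mu> x) (\<lambda>r. h (g r) :: real)"
proof (rule integrable_bounded_\<mu>)
  have "simple_function borel (\<lambda>r. h (g r))"
    using simple_function_compose[OF g, of h] by (simp add: o_def)
  then show "(\<lambda>r. h (g r)) \<in> borel_measurable borel"
    by (rule borel_measurable_simple_function)
  have "finite ((\<lambda>v. \<bar>h v\<bar>) ` range g)" using g by (simp add: simple_function_def)
  then have "\<bar>h (g r)\<bar> \<le> Max ((\<lambda>v. \<bar>h v\<bar>) ` range g)" for r
    by (rule Max_ge) (intro image_eqI[of _ _ "g r"] rangeI refl)
  then show "AE r in \<mu> x. \<bar>h (g r)\<bar> \<le> Max ((\<lambda>v. \<bar>h v\<bar>) ` range g)"
    by (intro AE_I2)
qed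

lemma simple_vimage:
  fixes g :: "real \<Rightarrow> real"
  assumes "simple_function borel g"
  shows "g -` {v} \<in> sets borel"
  using measurable_sets[OF borel_measurable_simple_function[OF assms], of "{v}"] by simp

lemma integral_simple_\<mu>:
  fixes g h :: "real \<Rightarrow> real"
  assumes g: "simple_function borel g"
  shows "(\<integral>r. h (g r) \<partial>\<mu> x) = (\<Sum>v\<in>range g. h v * measure (\<mu> x) (g -` {v}))"
proof -
  have fin: "finite (range g)" using g by (simp add: simple_function_def)
  have "h (g r) = (\<Sum>v\<in>range g. h v * indicator (g -` {v}) r)" for r
  proof -
    have "(\<Sum>v\<in>range g. h v * indicator (g -` {v}) r) = (\<Sum>v\<in>range g. if v = g r then h v else 0)"
      by (intro sum.cong) (auto simp: indicator_def)
    then show ?thesis using fin by simp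
  qed
  then have "(\<integral>r. h (g r) \<partial>\<mu> x) = (\<integral>r. (\<Sum>v\<in>range g. h v * indicator (g -` {v}) r) \<partial>\<mu> x)"
    by simp
  also have "\<dots> = (\<Sum>v\<in>range g. (\<integral>r. h v * indicator (g -` {v}) r \<partial>\<mu> x))"
    by (intro Bochner_Integration.integral_sum integrable_mult_right)
       (use finite_measure_\<mu> simple_vimage[OF g] in
         \<open>auto intro!: integrable_real_indicator simp: emeasure_\<mu>\<close>)
  also have "\<dots> = (\<Sum>v\<in>range g. h v * measure (\<mu> x) (g -` {v}))"
    using simple_vimage[OF g] by simp
  finally show ?thesis .
qed

text \<open>By polarization this is the integral of \<open>f\<close> with respect to the signed measure
  \<open>B \<mapsto> (E(B) x, z)\<close>. It is linear in \<open>f\<close>, so that linearity of the calculus can be tested against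
  all \<open>z\<close>, without common refinements of partitions.\<close>

definition form :: "(real \<Rightarrow> real) \<Rightarrow> 'a \<Rightarrow> 'a \<Rightarrow> real" where
  "form f x z = ((\<integral>r. f r \<partial>\<mu> (x + z)) - (\<integral>r. f r \<partial>\<mu> (x - z))) / 4"

lemma form_commute: "form f x z = form f z x"
  using \<mu>_uminus[of "x - z"] by (simp add: form_def add.commute)

definition simple_fun_op :: "(real \<Rightarrow> real) \<Rightarrow> 'a \<Rightarrow> 'a" where
  "simple_fun_op g x = (\<Sum>v\<in>range g. v *\<^sub>R E (g -` {v}) x)"

text \<open>The sum may run over any finite set that contains the nonzero values: this allows to compare
  functions with different ranges.\<close>

lemma simple_fun_op_eq:
  assumes "finite S" "range g - {0} \<subseteq> S"
  shows "simple_fun_op g x = (\<Sum>v\<in>S. v *\<^sub>R E (g -` {v}) x)"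
proof -
  have *: "g -` {v} = {}" if "v \<notin> range g" for v
    using that by auto
  have "finite (range g)"
    using finite_subset[OF assms(2,1)] by simp
  then have "simple_fun_op g x = (\<Sum>v\<in>range g - {0}. v *\<^sub>R E (g -` {v}) x)"
    unfolding simple_fun_op_def by (intro sum.mono_neutral_right) auto
  also have "\<dots> = (\<Sum>v\<in>S. v *\<^sub>R E (g -` {v}) x)"
    using assms by (intro sum.mono_neutral_left) (auto, metis * DiffI E_empty empty_iff insert_iff)
  finally show ?thesis .
qed

lemma inner_simple_fun_op:
  assumes g: "simple_function borel g"
  shows "inner (simple_fun_op g x) z = form g x z"
proof -
  have "inner (E (g -` {v}) x) z = (measure (\<mu> (x + z)) (g -` {v}) - measure (\<mu> (x - z)) (g -` {v})) / 4"
    for v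
    using simple_vimage[OF g, of v] E_symmetric[OF simple_vimage[OF g, of v], of z x]
    by (simp add: measure_\<mu> E_linear_simps inner_simps inner_commute)
  then have "inner (simple_fun_op g x) z = (\<Sum>v\<in>range g. v *
      ((measure (\<mu> (x + z)) (g -` {v}) - measure (\<mu> (x - z)) (g -` {v})) / 4))"
    by (simp only: simple_fun_op_def inner_sum_left inner_scaleR_left)
  also have "\<dots> = form g x z"
    using integral_simple_\<mu>[OF g, where h = "\<lambda>v. v"]
    by (simp add: form_def sum_subtractf[symmetric] sum_divide_distrib right_diff_distrib)
  finally show ?thesis .
qed

text \<open>The vectors \<open>E(g = v) x\<close> for different \<open>v\<close> are orthogonal.\<close>

lemma norm_simple_fun_op:
  assumes g: "simple_function borel g"
  shows "(norm (simple_fun_op g x))\<^sup>2 = (\<integral>r. (g r)\<^sup>2 \<partial>\<mu> x)"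
proof -
  have fin: "finite (range g)" using g by (simp add: simple_function_def)
  have "(norm (simple_fun_op g x))\<^sup>2 =
      (\<Sum>v\<in>range g. \<Sum>w\<in>range g. v * w * inner (E (g -` {w}) x) (E (g -` {v}) x))"
    by (simp only: power2_norm_eq_inner simple_fun_op_def inner_sum_left inner_sum_right
        sum_distrib_left mult.assoc inner_scaleR_left inner_scaleR_right)
  also have "\<dots> = (\<Sum>v\<in>range g. \<Sum>w\<in>range g. if w = v then v\<^sup>2 * measure (\<mu> x) (g -` {v}) else 0)"
  proof (intro sum.cong refl)
    fix v w
    have "g -` {w} \<inter> g -` {v} = (if w = v then g -` {v} else {})" by auto
    then show "v * w * inner (E (g -` {w}) x) (E (g -` {v}) x)
        = (if w = v then v\<^sup>2 * measure (\<mu> x) (g -` {v}) else 0)"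
      using simple_vimage[OF g] by (simp add: E_inner_E measure_\<mu> power2_eq_square)
  qed
  also have "\<dots> = (\<Sum>v\<in>range g. v\<^sup>2 * measure (\<mu> x) (g -` {v}))"
    using fin by simp
  also have "\<dots> = (\<integral>r. (g r)\<^sup>2 \<partial>\<mu> x)"
    using integral_simple_\<mu>[OF g, where h = "\<lambda>v. v\<^sup>2"] by simp
  finally show ?thesis .
qed

lemma simple_fun_op_add:
  assumes g: "simple_function borel g" and h: "simple_function borel h"
  shows "simple_fun_op (\<lambda>r. a * g r + b * h r) x = a *\<^sub>R simple_fun_op g x + b *\<^sub>R simple_fun_op h x"
proof -
  have s: "simple_function borel (\<lambda>r. a * g r + b * h r)"
    by (intro simple_function_add simple_function_mult simple_function_const g h)
  have "inner (simple_fun_op (\<lambda>r. a * g r + b * h r) x) z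
      = inner (a *\<^sub>R simple_fun_op g x + b *\<^sub>R simple_fun_op h x) z" for z
    using integrable_simple_\<mu>[OF g, where h = "\<lambda>v. v"] integrable_simple_\<mu>[OF h, where h = "\<lambda>v. v"]
    by (simp add: inner_add_left inner_simple_fun_op g h s form_def algebra_simps
        add_divide_distrib diff_divide_distrib)
  from this[of "simple_fun_op (\<lambda>r. a * g r + b * h r) x
      - (a *\<^sub>R simple_fun_op g x + b *\<^sub>R simple_fun_op h x)"]
  have "norm (simple_fun_op (\<lambda>r. a * g r + b * h r) x
      - (a *\<^sub>R simple_fun_op g x + b *\<^sub>R simple_fun_op h x)) ^ 2 = 0"
    by (simp only: power2_norm_eq_inner inner_diff_left)
  then show ?thesis by simp
qed

lemma simple_fun_op_linear:
  assumes g: "simple_function borel g"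
  shows "simple_fun_op g (a *\<^sub>R x + b *\<^sub>R z) = a *\<^sub>R simple_fun_op g x + b *\<^sub>R simple_fun_op g z"
proof -
  have "v *\<^sub>R E (g -` {v}) (a *\<^sub>R x + b *\<^sub>R z)
      = a *\<^sub>R v *\<^sub>R E (g -` {v}) x + b *\<^sub>R v *\<^sub>R E (g -` {v}) z" for v
    by (simp add: E_linear_simps[OF simple_vimage[OF g]] scaleR_add_right mult.commute)
  then show ?thesis
    by (simp only: simple_fun_op_def sum.distrib scaleR_sum_right)
qed

lemma simple_fun_op_E:
  assumes g: "simple_function borel g" and B: "B \<in> sets borel"
  shows "E B (simple_fun_op g x) = simple_fun_op (\<lambda>r. indicator B r * g r) x"
proof -
  have fin: "finite (range g)" using g by (simp add: simple_function_def)
  have *: "v *\<^sub>R E (B \<inter> g -` {v}) x = v *\<^sub>R E ((\<lambda>r. indicator B r * g r) -` {v}) x" for v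
  proof (cases "v = 0")
    case False
    then have "(\<lambda>r. indicator B r * g r) -` {v} = B \<inter> g -` {v}"
      by (auto simp: indicator_def)
    then show ?thesis by simp
  qed simp
  have "E B (simple_fun_op g x) = (\<Sum>v\<in>range g. v *\<^sub>R E (B \<inter> g -` {v}) x)"
    using B simple_vimage[OF g] by (simp add: simple_fun_op_def E_linear_simps E_E)
  also have "\<dots> = simple_fun_op (\<lambda>r. indicator B r * g r) x"
  proof -
    have "range (\<lambda>r. indicator B r * g r) - {0} \<subseteq> range g"
      by (auto simp: indicator_def)
    from simple_fun_op_eq[OF fin this] show ?thesis
      by (simp only: *)
  qed
  finally show ?thesis .
qed

section \<open>The functional calculus\<close>

abbreviation dom :: "(real \<Rightarrow> real) \<Rightarrow> 'a set" where
  "dom f \<equiv> spectral_domain E f"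

lemma in_dom_bound:
  assumes "x \<in> dom g" "f \<in> borel_measurable borel" "AE r in \<mu> x. \<bar>f r\<bar> \<le> \<bar>g r\<bar>"
  shows "x \<in> dom f"
  unfolding spectral_domain_def mem_Collect_eq
proof (rule Bochner_Integration.integrable_bound)
  show "integrable (\<mu> x) (\<lambda>r. (g r)\<^sup>2)" using assms(1) by (simp add: spectral_domain_def)
  show "(\<lambda>r. (f r)\<^sup>2) \<in> borel_measurable (\<mu> x)" using assms(2) by simp
  show "AE r in \<mu> x. norm ((f r)\<^sup>2) \<le> norm ((g r)\<^sup>2)"
    using assms(3) by eventually_elim (simp add: abs_le_square_iff)
qed

lemma const_in_dom: "x \<in> dom (\<lambda>r. c)"
  unfolding spectral_domain_def using finite_measure.integrable_const[OF finite_measure_\<mu>] by simp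

lemma in_dom_bounded:
  assumes "f \<in> borel_measurable borel" "AE r in \<mu> x. \<bar>f r\<bar> \<le> c"
  shows "x \<in> dom f"
proof (rule in_dom_bound[OF const_in_dom[of x c] assms(1)])
  show "AE r in \<mu> x. \<bar>f r\<bar> \<le> \<bar>c\<bar>"
    using assms(2) by eventually_elim simp
qed

lemma simple_in_dom: "simple_function borel g \<Longrightarrow> x \<in> dom g"
  unfolding spectral_domain_def using integrable_simple_\<mu>[where h = "\<lambda>v. v\<^sup>2"] by simp

lemma integrable_product:
  assumes "f \<in> borel_measurable borel" "g \<in> borel_measurable borel" "x \<in> dom f" "x \<in> dom g"
  shows "integrable (\<mu> x) (\<lambda>r. f r * g r)"
proof (rule Bochner_Integration.integrable_bound)
  show "integrable (\<mu> x) (\<lambda>r. (f r)\<^sup>2 + (g r)\<^sup>2)"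
    using assms by (simp add: spectral_domain_def)
  show "(\<lambda>r. f r * g r) \<in> borel_measurable (\<mu> x)" using assms by simp
  have "\<bar>a * b\<bar> \<le> a\<^sup>2 + b\<^sup>2" for a b :: real
  proof -
    have "0 \<le> (\<bar>a\<bar> - \<bar>b\<bar>)\<^sup>2" by simp
    then have "2 * \<bar>a * b\<bar> \<le> a\<^sup>2 + b\<^sup>2" by (simp add: power2_diff abs_mult)
    then show ?thesis using abs_ge_zero[of "a * b"] by linarith
  qed
  then show "AE r in \<mu> x. norm (f r * g r) \<le> norm ((f r)\<^sup>2 + (g r)\<^sup>2)"
    by (intro AE_I2) simp
qed

lemma integrable_in_dom:
  assumes "f \<in> borel_measurable borel" "x \<in> dom f"
  shows "integrable (\<mu> x) f"
  using integrable_product[OF assms(1) _ assms(2) const_in_dom[of x 1]] by simp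

lemma in_dom_add:
  assumes "f \<in> borel_measurable borel" "g \<in> borel_measurable borel" "x \<in> dom f" "x \<in> dom g"
  shows "x \<in> dom (\<lambda>r. a * f r + b * g r)"
proof -
  have "integrable (\<mu> x) (\<lambda>r. a\<^sup>2 * (f r)\<^sup>2 + 2 * a * b * (f r * g r) + b\<^sup>2 * (g r)\<^sup>2)"
    using integrable_product[OF assms] assms(3,4) by (simp add: spectral_domain_def)
  also have "(\<lambda>r. a\<^sup>2 * (f r)\<^sup>2 + 2 * a * b * (f r * g r) + b\<^sup>2 * (g r)\<^sup>2) =
      (\<lambda>r. (a * f r + b * g r)\<^sup>2)"
    by (auto simp: power2_eq_square algebra_simps)
  finally show ?thesis by (simp add: spectral_domain_def)
qed

lemma in_dom_scale:
  assumes "f \<in> borel_measurable borel" "x \<in> dom f"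
  shows "x \<in> dom (\<lambda>r. c * f r)"
  using in_dom_add[OF assms(1,1,2,2), of c 0] by simp

lemma in_dom_sum:
  assumes "finite S" "\<And>i. i \<in> S \<Longrightarrow> f i \<in> borel_measurable borel" "\<And>i. i \<in> S \<Longrightarrow> x \<in> dom (f i)"
  shows "x \<in> dom (\<lambda>r. \<Sum>i\<in>S. f i r)"
  using assms
proof (induction S rule: finite_induct)
  case empty
  then show ?case using const_in_dom by simp
next
  case (insert i S)
  have "x \<in> dom (\<lambda>r. 1 * f i r + 1 * (\<Sum>i\<in>S. f i r))"
    using insert by (intro in_dom_add) auto
  then show ?case using insert by simp
qed

lemma L2_dominated_convergence:
  assumes F: "\<And>n. F n \<in> borel_measurable borel" and f: "f \<in> borel_measurable borel"
    and h: "x \<in> dom h"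
    and lim: "AE r in \<mu> x. (\<lambda>n. F n r) \<longlonglongrightarrow> f r"
    and bd: "\<And>n. AE r in \<mu> x. \<bar>F n r\<bar> \<le> \<bar>h r\<bar>"
  shows "(\<lambda>n. \<integral>r. (F n r - f r)\<^sup>2 \<partial>\<mu> x) \<longlonglongrightarrow> 0" "x \<in> dom f" "\<And>n. x \<in> dom (F n)"
proof -
  have bd': "AE r in \<mu> x. \<forall>n. \<bar>F n r\<bar> \<le> \<bar>h r\<bar>"
    using bd by (simp add: AE_all_countable)
  have f_bd: "AE r in \<mu> x. \<bar>f r\<bar> \<le> \<bar>h r\<bar>"
    using bd' lim
    by eventually_elim (rule Lim_bounded, rule tendsto_rabs, auto)
  show "x \<in> dom f" by (rule in_dom_bound[OF h f f_bd])
  show "x \<in> dom (F n)" for n by (rule in_dom_bound[OF h F bd])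
  have "(\<lambda>n. \<integral>r. (F n r - f r)\<^sup>2 \<partial>\<mu> x) \<longlonglongrightarrow> (\<integral>r. 0 \<partial>\<mu> x)"
  proof (rule integral_dominated_convergence[where w = "\<lambda>r. 4 * (h r)\<^sup>2"])
    show "integrable (\<mu> x) (\<lambda>r. 4 * (h r)\<^sup>2)" using h by (simp add: spectral_domain_def)
    show "AE r in \<mu> x. (\<lambda>n. (F n r - f r)\<^sup>2) \<longlonglongrightarrow> 0"
      using lim
    proof eventually_elim
      case (elim r)
      have "(\<lambda>n. (F n r - f r)\<^sup>2) \<longlonglongrightarrow> (f r - f r)\<^sup>2"
        by (intro tendsto_intros elim)
      then show ?case by simp
    qed
    show "AE r in \<mu> x. norm ((F n r - f r)\<^sup>2) \<le> 4 * (h r)\<^sup>2" for n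
      using bd[of n] f_bd
    proof eventually_elim
      case (elim r)
      then have "\<bar>F n r - f r\<bar> \<le> \<bar>2 * h r\<bar>" by linarith
      then have "(F n r - f r)\<^sup>2 \<le> (2 * h r)\<^sup>2" by (simp only: abs_le_square_iff)
      then show ?case by (simp add: power_mult_distrib)
    qed
  qed (use F f in auto)
  then show "(\<lambda>n. \<integral>r. (F n r - f r)\<^sup>2 \<partial>\<mu> x) \<longlonglongrightarrow> 0" by simp
qed

text \<open>The approximation does not depend on \<open>x\<close>; this is what makes the limit linear in \<open>x\<close>.\<close>

definition simple_approx :: "(real \<Rightarrow> real) \<Rightarrow> nat \<Rightarrow> real \<Rightarrow> real" where
  "simple_approx f = (SOME F. (\<forall>n. simple_function borel (F n)) \<and>
     (\<forall>r. (\<lambda>n. F n r) \<longlonglongrightarrow> f r) \<and> (\<forall>n r. \<bar>F n r\<bar> \<le> 2 * \<bar>f r\<bar>))"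

lemma simple_approx:
  assumes "f \<in> borel_measurable borel"
  shows "simple_function borel (simple_approx f n)"
    "(\<lambda>n. simple_approx f n r) \<longlonglongrightarrow> f r" "\<bar>simple_approx f n r\<bar> \<le> 2 * \<bar>f r\<bar>"
proof -
  have "\<exists>F. (\<forall>n. simple_function borel (F n)) \<and>
     (\<forall>r. (\<lambda>n. F n r) \<longlonglongrightarrow> f r) \<and> (\<forall>n r. \<bar>F n r\<bar> \<le> 2 * \<bar>f r\<bar>)"
    using borel_measurable_implies_sequence_metric[OF assms, of 0] by simp
  from someI_ex[OF this]
  show "simple_function borel (simple_approx f n)"
    "(\<lambda>n. simple_approx f n r) \<longlonglongrightarrow> f r" "\<bar>simple_approx f n r\<bar> \<le> 2 * \<bar>f r\<bar>"
    unfolding simple_approx_def by blast+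
qed

definition fun_op :: "(real \<Rightarrow> real) \<Rightarrow> 'a \<Rightarrow> 'a" where
  "fun_op f x = lim (\<lambda>n. simple_fun_op (simple_approx f n) x)"

lemma simple_approx_L2:
  assumes "f \<in> borel_measurable borel" "x \<in> dom f"
  shows "(\<lambda>n. \<integral>r. (simple_approx f n r - f r)\<^sup>2 \<partial>\<mu> x) \<longlonglongrightarrow> 0"
proof (rule L2_dominated_convergence(1))
  show "x \<in> dom (\<lambda>r. 2 * f r)" by (rule in_dom_scale[OF assms])
  show "AE r in \<mu> x. \<bar>simple_approx f n r\<bar> \<le> \<bar>2 * f r\<bar>" for n
    using simple_approx(3)[OF assms(1)] by (intro AE_I2) (simp add: abs_mult)
qed (use assms simple_approx in \<open>auto intro: borel_measurable_simple_function\<close>)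

text \<open>The isometry turns \<open>L\<^sup>2\<close> convergence of simple functions into a Cauchy property in \<open>H\<close>; the
  completeness of \<open>H\<close> then gives \<open>f(A) x\<close>, and the limit is the same for all approximations.\<close>

lemma norm_simple_fun_op_diff:
  assumes g: "simple_function borel g" and h: "simple_function borel h"
    and f: "f \<in> borel_measurable borel" "x \<in> dom f"
  shows "(norm (simple_fun_op g x - simple_fun_op h x))\<^sup>2
    \<le> 2 * (\<integral>r. (g r - f r)\<^sup>2 \<partial>\<mu> x) + 2 * (\<integral>r. (h r - f r)\<^sup>2 \<partial>\<mu> x)"
proof -
  have int: "integrable (\<mu> x) (\<lambda>r. (k r - f r)\<^sup>2)" if k: "simple_function borel k" for k
    using in_dom_add[OF borel_measurable_simple_function[OF k] f(1) simple_in_dom[OF k] f(2), of 1 "-1"]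
    by (simp add: spectral_domain_def)
  have s: "simple_function borel (\<lambda>r. 1 * g r + (- 1) * h r)"
    by (intro simple_function_add simple_function_mult simple_function_const g h)
  have "(norm (simple_fun_op g x - simple_fun_op h x))\<^sup>2 = (\<integral>r. (g r - h r)\<^sup>2 \<partial>\<mu> x)"
    using norm_simple_fun_op[OF s, of x] simple_fun_op_add[OF g h, of 1 "-1" x] by simp
  also have "\<dots> \<le> (\<integral>r. 2 * (g r - f r)\<^sup>2 + 2 * (h r - f r)\<^sup>2 \<partial>\<mu> x)"
  proof (rule integral_mono)
    show "integrable (\<mu> x) (\<lambda>r. (g r - h r)\<^sup>2)"
      using simple_in_dom[OF s, of x] by (simp add: spectral_domain_def)
    show "integrable (\<mu> x) (\<lambda>r. 2 * (g r - f r)\<^sup>2 + 2 * (h r - f r)\<^sup>2)"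
      using int g h by simp
    fix r
    have "0 \<le> ((g r - f r) + (h r - f r))\<^sup>2" by simp
    then show "(g r - h r)\<^sup>2 \<le> 2 * (g r - f r)\<^sup>2 + 2 * (h r - f r)\<^sup>2"
      by (simp add: power2_eq_square algebra_simps)
  qed
  also have "\<dots> = 2 * (\<integral>r. (g r - f r)\<^sup>2 \<partial>\<mu> x) + 2 * (\<integral>r. (h r - f r)\<^sup>2 \<partial>\<mu> x)"
    using int g h by simp
  finally show ?thesis .
qed

lemma norm_tendsto_0_squareI: "(\<lambda>n. (norm (f n))\<^sup>2) \<longlonglongrightarrow> 0 \<Longrightarrow> f \<longlonglongrightarrow> 0"
  using tendsto_real_sqrt[of "\<lambda>n. (norm (f n))\<^sup>2" 0] by (simp add: tendsto_norm_zero_iff)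

lemma simple_fun_op_tendsto_fun_op:
  assumes f: "f \<in> borel_measurable borel" "x \<in> dom f"
    and F: "\<And>n. simple_function borel (F n)"
    and lim: "(\<lambda>n. \<integral>r. (F n r - f r)\<^sup>2 \<partial>\<mu> x) \<longlonglongrightarrow> 0"
  shows "(\<lambda>n. simple_fun_op (F n) x) \<longlonglongrightarrow> fun_op f x"
proof -
  let ?G = "simple_approx f"
  let ?d = "\<lambda>n. \<integral>r. (?G n r - f r)\<^sup>2 \<partial>\<mu> x"
  have d: "?d \<longlonglongrightarrow> 0" by (rule simple_approx_L2[OF f])
  have "Cauchy (\<lambda>n. simple_fun_op (?G n) x)"
  proof (rule metric_CauchyI)
    fix e :: real assume e: "0 < e"
    then have "eventually (\<lambda>n. ?d n < e\<^sup>2 / 4) sequentially"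
      using order_tendstoD(2)[OF d, of "e\<^sup>2 / 4"] by simp
    then obtain N where N: "\<And>n. n \<ge> N \<Longrightarrow> ?d n < e\<^sup>2 / 4"
      by (auto simp: eventually_sequentially)
    have "dist (simple_fun_op (?G m) x) (simple_fun_op (?G n) x) < e" if "m \<ge> N" "n \<ge> N" for m n
    proof -
      have "(norm (simple_fun_op (?G m) x - simple_fun_op (?G n) x))\<^sup>2 \<le> 2 * ?d m + 2 * ?d n"
        by (rule norm_simple_fun_op_diff[OF simple_approx(1)[OF f(1)] simple_approx(1)[OF f(1)] f])
      also have "\<dots> < e\<^sup>2" using N[OF that(1)] N[OF that(2)] by simp
      finally show ?thesis using e by (simp add: dist_norm power_less_imp_less_base)
    qed
    then show "\<exists>M. \<forall>m\<ge>M. \<forall>n\<ge>M. dist (simple_fun_op (?G m) x) (simple_fun_op (?G n) x) < e"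
      by blast
  qed
  then have conv: "(\<lambda>n. simple_fun_op (?G n) x) \<longlonglongrightarrow> fun_op f x"
    unfolding fun_op_def by (simp add: Cauchy_convergent_iff convergent_LIMSEQ_iff)
  have "(\<lambda>n. (norm (simple_fun_op (F n) x - simple_fun_op (?G n) x))\<^sup>2) \<longlonglongrightarrow> 0"
  proof (rule tendsto_sandwich[where f = "\<lambda>_. 0"])
    show "(\<lambda>n. 2 * (\<integral>r. (F n r - f r)\<^sup>2 \<partial>\<mu> x) + 2 * ?d n) \<longlonglongrightarrow> 0"
      by (rule tendsto_eq_intros lim d refl)+ simp
    show "\<forall>\<^sub>F n in sequentially. (norm (simple_fun_op (F n) x - simple_fun_op (?G n) x))\<^sup>2
        \<le> 2 * (\<integral>r. (F n r - f r)\<^sup>2 \<partial>\<mu> x) + 2 * ?d n"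
      by (intro always_eventually allI norm_simple_fun_op_diff F f simple_approx(1))
  qed auto
  then have "(\<lambda>n. simple_fun_op (F n) x - simple_fun_op (?G n) x) \<longlonglongrightarrow> 0"
    by (rule norm_tendsto_0_squareI)
  from tendsto_add[OF this conv] show ?thesis by simp
qed

lemma simple_approx_tendsto_fun_op:
  assumes "f \<in> borel_measurable borel" "x \<in> dom f"
  shows "(\<lambda>n. simple_fun_op (simple_approx f n) x) \<longlonglongrightarrow> fun_op f x"
  by (intro simple_fun_op_tendsto_fun_op assms simple_approx(1) simple_approx_L2)

lemma fun_op_simple:
  assumes "simple_function borel g"
  shows "fun_op g x = simple_fun_op g x"
proof -
  have "(\<lambda>n::nat. simple_fun_op g x) \<longlonglongrightarrow> fun_op g x"
    using assms
    by (intro simple_fun_op_tendsto_fun_op) (auto intro: simple_in_dom borel_measurable_simple_function)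
  then show ?thesis by (simp add: LIMSEQ_const_iff)
qed

lemma fun_op_indicator:
  assumes "B \<in> sets borel"
  shows "fun_op (indicator B) x = E B x"
proof -
  have s: "simple_function borel (indicator B :: real \<Rightarrow> real)" using assms by simp
  have "simple_fun_op (indicator B) x = (\<Sum>v\<in>{1}. v *\<^sub>R E (indicator B -` {v}) x)"
    by (rule simple_fun_op_eq) (auto simp: indicator_def)
  moreover have "(indicator B -` {1 :: real}) = B" by (auto simp: indicator_def)
  ultimately show ?thesis using fun_op_simple[OF s] by simp
qed

lemma fun_op_1: "fun_op (\<lambda>r. 1) x = x"
proof -
  have "(indicator UNIV :: real \<Rightarrow> real) = (\<lambda>r. 1)" by auto
  then show ?thesis using fun_op_indicator[of UNIV x] by simp
qed

lemma norm_fun_op: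
  assumes f: "f \<in> borel_measurable borel" "x \<in> dom f"
  shows "(norm (fun_op f x))\<^sup>2 = (\<integral>r. (f r)\<^sup>2 \<partial>\<mu> x)"
proof (rule LIMSEQ_unique)
  show "(\<lambda>n. (norm (simple_fun_op (simple_approx f n) x))\<^sup>2) \<longlonglongrightarrow> (norm (fun_op f x))\<^sup>2"
    by (intro tendsto_intros simple_approx_tendsto_fun_op f)
  have "(\<lambda>n. \<integral>r. (simple_approx f n r)\<^sup>2 \<partial>\<mu> x) \<longlonglongrightarrow> (\<integral>r. (f r)\<^sup>2 \<partial>\<mu> x)"
  proof (rule integral_dominated_convergence[where w = "\<lambda>r. 4 * (f r)\<^sup>2"])
    show "integrable (\<mu> x) (\<lambda>r. 4 * (f r)\<^sup>2)" using f by (simp add: spectral_domain_def)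
    show "AE r in \<mu> x. (\<lambda>n. (simple_approx f n r)\<^sup>2) \<longlonglongrightarrow> (f r)\<^sup>2"
      by (intro AE_I2 tendsto_intros simple_approx(2) f)
    show "AE r in \<mu> x. norm ((simple_approx f n r)\<^sup>2) \<le> 4 * (f r)\<^sup>2" for n
    proof (intro AE_I2)
      fix r
      have "\<bar>simple_approx f n r\<bar> \<le> \<bar>2 * f r\<bar>" using simple_approx(3)[OF f(1)] by (simp add: abs_mult)
      then have "(simple_approx f n r)\<^sup>2 \<le> (2 * f r)\<^sup>2" by (simp only: abs_le_square_iff)
      then show "norm ((simple_approx f n r)\<^sup>2) \<le> 4 * (f r)\<^sup>2" by (simp add: power_mult_distrib)
    qed
  qed (use f borel_measurable_simple_function[OF simple_approx(1)[OF f(1)]] in auto)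
  then show "(\<lambda>n. (norm (simple_fun_op (simple_approx f n) x))\<^sup>2) \<longlonglongrightarrow> (\<integral>r. (f r)\<^sup>2 \<partial>\<mu> x)"
    by (simp add: norm_simple_fun_op simple_approx(1)[OF f(1)])
qed

lemma fun_op_add:
  assumes f: "f \<in> borel_measurable borel" "x \<in> dom f" and g: "g \<in> borel_measurable borel" "x \<in> dom g"
  shows "fun_op (\<lambda>r. a * f r + b * g r) x = a *\<^sub>R fun_op f x + b *\<^sub>R fun_op g x"
proof (rule LIMSEQ_unique)
  let ?F = "\<lambda>n r. a * simple_approx f n r + b * simple_approx g n r"
  have s: "simple_function borel (?F n)" for n
    by (intro simple_function_add simple_function_mult simple_function_const simple_approx(1) f g)
  have "(\<lambda>n. \<integral>r. (?F n r - (a * f r + b * g r))\<^sup>2 \<partial>\<mu> x) \<longlonglongrightarrow> 0"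
  proof (rule L2_dominated_convergence(1))
    show "x \<in> dom (\<lambda>r. 2 * \<bar>a\<bar> * \<bar>f r\<bar> + 2 * \<bar>b\<bar> * \<bar>g r\<bar>)"
      using f g by (intro in_dom_add) (auto simp: spectral_domain_def)
    show "AE r in \<mu> x. (\<lambda>n. ?F n r) \<longlonglongrightarrow> a * f r + b * g r"
      by (intro AE_I2 tendsto_intros simple_approx(2) f g)
    have "\<bar>?F n r\<bar> \<le> \<bar>2 * \<bar>a\<bar> * \<bar>f r\<bar> + 2 * \<bar>b\<bar> * \<bar>g r\<bar>\<bar>" for n r
    proof -
      have "\<bar>c * simple_approx k n r\<bar> \<le> 2 * \<bar>c\<bar> * \<bar>k r\<bar>" if "k \<in> borel_measurable borel" for c k
        using mult_left_mono[OF simple_approx(3)[OF that, of n r], of "\<bar>c\<bar>"] by (simp add: abs_mult)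
      from this[OF f(1), of a] this[OF g(1), of b] show ?thesis by linarith
    qed
    then show "AE r in \<mu> x. \<bar>?F n r\<bar> \<le> \<bar>2 * \<bar>a\<bar> * \<bar>f r\<bar> + 2 * \<bar>b\<bar> * \<bar>g r\<bar>\<bar>" for n
      by (intro AE_I2)
  qed (use f g s in \<open>auto dest: borel_measurable_simple_function\<close>)
  then show "(\<lambda>n. simple_fun_op (?F n) x) \<longlonglongrightarrow> fun_op (\<lambda>r. a * f r + b * g r) x"
    using f g s by (intro simple_fun_op_tendsto_fun_op in_dom_add) auto
  show "(\<lambda>n. simple_fun_op (?F n) x) \<longlonglongrightarrow> a *\<^sub>R fun_op f x + b *\<^sub>R fun_op g x"
    unfolding simple_fun_op_add[OF simple_approx(1)[OF f(1)] simple_approx(1)[OF g(1)]]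
    by (intro tendsto_intros simple_approx_tendsto_fun_op f g)
qed

lemma fun_op_scale:
  assumes "f \<in> borel_measurable borel" "x \<in> dom f"
  shows "fun_op (\<lambda>r. c * f r) x = c *\<^sub>R fun_op f x"
  using fun_op_add[OF assms assms, of c 0] by simp

lemma fun_op_diff:
  assumes "f \<in> borel_measurable borel" "x \<in> dom f" "g \<in> borel_measurable borel" "x \<in> dom g"
  shows "fun_op (\<lambda>r. f r - g r) x = fun_op f x - fun_op g x"
  using fun_op_add[OF assms, of 1 "-1"] by simp

lemma fun_op_sum:
  assumes "finite S" "\<And>i. i \<in> S \<Longrightarrow> f i \<in> borel_measurable borel" "\<And>i. i \<in> S \<Longrightarrow> x \<in> dom (f i)"
  shows "fun_op (\<lambda>r. \<Sum>i\<in>S. f i r) x = (\<Sum>i\<in>S. fun_op (f i) x)"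
  using assms
proof (induction S rule: finite_induct)
  case empty
  show ?case using fun_op_scale[OF _ const_in_dom[of x 1], of 0] by simp
next
  case (insert i S)
  have "fun_op (\<lambda>r. 1 * f i r + 1 * (\<Sum>i\<in>S. f i r)) x
      = 1 *\<^sub>R fun_op (f i) x + 1 *\<^sub>R fun_op (\<lambda>r. \<Sum>i\<in>S. f i r) x"
    using insert by (intro fun_op_add in_dom_sum) auto
  then show ?case using insert by simp
qed

lemma norm_fun_op_le:
  assumes "f \<in> borel_measurable borel" "g \<in> borel_measurable borel" "x \<in> dom g" "0 \<le> c"
    and bd: "AE r in \<mu> x. \<bar>f r\<bar> \<le> c * \<bar>g r\<bar>"
  shows "norm (fun_op f x) \<le> c * norm (fun_op g x)"
proof -
  have cg: "x \<in> dom (\<lambda>r. c * g r)" by (rule in_dom_scale[OF assms(2,3)])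
  have bd': "AE r in \<mu> x. \<bar>f r\<bar> \<le> \<bar>c * g r\<bar>"
    using bd assms(4) by (simp add: abs_mult)
  have f: "x \<in> dom f" by (rule in_dom_bound[OF cg assms(1) bd'])
  have "(norm (fun_op f x))\<^sup>2 \<le> (\<integral>r. (c * g r)\<^sup>2 \<partial>\<mu> x)"
    unfolding norm_fun_op[OF assms(1) f]
    using f cg bd' by (intro integral_mono_AE) (auto simp: spectral_domain_def abs_le_square_iff)
  also have "\<dots> = (norm (c *\<^sub>R fun_op g x))\<^sup>2"
    using norm_fun_op[OF _ cg] fun_op_scale[OF assms(2,3)] assms(2) by simp
  finally show ?thesis using assms(4) by (simp add: abs_le_square_iff[symmetric])
qed

lemma fun_op_cong_AE:
  assumes "f \<in> borel_measurable borel" "g \<in> borel_measurable borel" "x \<in> dom g"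
    and "AE r in \<mu> x. f r = g r"
  shows "fun_op f x = fun_op g x"
proof -
  have f: "x \<in> dom f" using assms by (intro in_dom_bound[OF assms(3,1)]) auto
  have "norm (fun_op (\<lambda>r. f r - g r) x) \<le> 0 * norm (fun_op g x)"
    using assms by (intro norm_fun_op_le) auto
  then show ?thesis using fun_op_diff[OF assms(1) f assms(2,3)] by simp
qed

text \<open>The isometry carries the dominated convergence theorem over to the calculus. All limits and
  derivatives with respect to time below come from this lemma.\<close>

lemma fun_op_tendsto:
  assumes F: "\<And>n. F n \<in> borel_measurable borel" and f: "f \<in> borel_measurable borel"
    and h: "x \<in> dom h"
    and lim: "AE r in \<mu> x. (\<lambda>n. F n r) \<longlonglongrightarrow> f r"
    and bd: "\<And>n. AE r in \<mu> x. \<bar>F n r\<bar> \<le> \<bar>h r\<bar>"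
  shows "(\<lambda>n. fun_op (F n) x) \<longlonglongrightarrow> fun_op f x"
proof -
  note conv = L2_dominated_convergence[OF F f h lim bd]
  have "(norm (fun_op (F n) x - fun_op f x))\<^sup>2 = (\<integral>r. (F n r - f r)\<^sup>2 \<partial>\<mu> x)" for n
    using norm_fun_op[of "\<lambda>r. F n r - f r" x] fun_op_diff[OF F conv(3) f conv(2)] F f
      in_dom_add[OF F f conv(3) conv(2), where a = 1 and b = "-1"] by simp
  then have "(\<lambda>n. (norm (fun_op (F n) x - fun_op f x))\<^sup>2) \<longlonglongrightarrow> 0"
    using conv(1) by simp
  from norm_tendsto_0_squareI[OF this] show ?thesis
    by (simp add: LIM_zero_iff)
qed

text \<open>The domain of \<open>f(A)\<close> is a subspace because
  \<open>|E(B)(ax + bz)|\<^sup>2 \<le> 2a\<^sup>2 |E(B)x|\<^sup>2 + 2b\<^sup>2 |E(B)z|\<^sup>2\<close> for every \<open>B\<close>.\<close>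

lemma nn_integral_\<mu>_linear:
  assumes f: "f \<in> borel_measurable borel"
  shows "(\<integral>\<^sup>+r. f r \<partial>\<mu> (a *\<^sub>R x + b *\<^sub>R z))
    \<le> ennreal (2 * a\<^sup>2) * (\<integral>\<^sup>+r. f r \<partial>\<mu> x) + ennreal (2 * b\<^sup>2) * (\<integral>\<^sup>+r. f r \<partial>\<mu> z)"
proof -
  let ?M = "\<mu> (a *\<^sub>R x + b *\<^sub>R z)"
  have em: "emeasure ?M B \<le> ennreal (2 * a\<^sup>2) * emeasure (\<mu> x) B + ennreal (2 * b\<^sup>2) * emeasure (\<mu> z) B"
    if B: "B \<in> sets borel" for B
  proof -
    have "(norm (p + q))\<^sup>2 \<le> 2 * (norm p)\<^sup>2 + 2 * (norm q)\<^sup>2" for p q :: 'a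
      using zero_le_power2[of "norm (p - q)"]
      by (simp add: power2_norm_eq_inner inner_simps inner_commute)
    from this[of "a *\<^sub>R E B x" "b *\<^sub>R E B z"]
    have "(norm (E B (a *\<^sub>R x + b *\<^sub>R z)))\<^sup>2 \<le> 2 * a\<^sup>2 * (norm (E B x))\<^sup>2 + 2 * b\<^sup>2 * (norm (E B z))\<^sup>2"
      by (simp add: E_linear_simps[OF B] power_mult_distrib)
    then show ?thesis
      by (simp add: emeasure_\<mu>[OF B] E_quadratic[OF B] ennreal_mult'[symmetric]
          ennreal_plus[symmetric] ennreal_leI del: ennreal_plus)
  qed
  show ?thesis
    unfolding nn_integral_def[of ?M]
  proof (rule SUP_least)
    fix g assume "g \<in> {g. simple_function ?M g \<and> g \<le> f}"
    then have g: "simple_function borel g" "g \<le> f"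
      by (auto simp: simple_function_def)
    have sM: "simple_function (\<mu> y) g" for y using g(1) by (simp add: simple_function_def)
    have gv: "g -` {v} \<in> sets borel" for v
      using simple_functionD(2)[OF g(1), of "{v}"] by simp
    have "integral\<^sup>S ?M g \<le> (\<Sum>v\<in>range g. v * (ennreal (2 * a\<^sup>2) * emeasure (\<mu> x) (g -` {v})
        + ennreal (2 * b\<^sup>2) * emeasure (\<mu> z) (g -` {v})))"
      unfolding simple_integral_def by (auto intro!: sum_mono mult_left_mono em gv)
    also have "\<dots> = ennreal (2 * a\<^sup>2) * integral\<^sup>S (\<mu> x) g + ennreal (2 * b\<^sup>2) * integral\<^sup>S (\<mu> z) g"
      by (simp add: simple_integral_def sum_distrib_left sum.distrib distrib_left mult.left_commute)
    also have "\<dots> \<le> ennreal (2 * a\<^sup>2) * (\<integral>\<^sup>+r. f r \<partial>\<mu> x) + ennreal (2 * b\<^sup>2) * (\<integral>\<^sup>+r. f r \<partial>\<mu> z)"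
      using g(2) sM
      by (intro add_mono mult_left_mono; simp add: nn_integral_eq_simple_integral[symmetric])
        (auto intro!: nn_integral_mono simp: le_fun_def)
    finally show "integral\<^sup>S ?M g \<le> ennreal (2 * a\<^sup>2) * (\<integral>\<^sup>+r. f r \<partial>\<mu> x)
        + ennreal (2 * b\<^sup>2) * (\<integral>\<^sup>+r. f r \<partial>\<mu> z)" .
  qed
qed

lemma in_dom_linear:
  assumes "f \<in> borel_measurable borel" "x \<in> dom f" "z \<in> dom f"
  shows "a *\<^sub>R x + b *\<^sub>R z \<in> dom f"
proof -
  have fin: "(\<integral>\<^sup>+r. ennreal ((f r)\<^sup>2) \<partial>\<mu> y) < \<infinity>" if "y \<in> dom f" for y
    using that by (simp add: spectral_domain_def integrable_iff_bounded)
  have "(\<integral>\<^sup>+r. ennreal ((f r)\<^sup>2) \<partial>\<mu> (a *\<^sub>R x + b *\<^sub>R z)) \<le>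
      ennreal (2 * a\<^sup>2) * (\<integral>\<^sup>+r. ennreal ((f r)\<^sup>2) \<partial>\<mu> x)
      + ennreal (2 * b\<^sup>2) * (\<integral>\<^sup>+r. ennreal ((f r)\<^sup>2) \<partial>\<mu> z)"
    using assms(1) by (intro nn_integral_\<mu>_linear) simp
  also have "\<dots> < \<infinity>"
    using fin[OF assms(2)] fin[OF assms(3)] by (simp add: ennreal_mult_less_top)
  finally show ?thesis
    using assms(1) by (simp add: spectral_domain_def integrable_iff_bounded)
qed

lemma in_dom_0:
  assumes "f \<in> borel_measurable borel"
  shows "0 \<in> dom f"
proof -
  have "AE r in \<mu> 0. \<bar>f r\<bar> \<le> 0"
    by (rule AE_I[where N = UNIV]) (simp_all add: emeasure_\<mu>)
  then show ?thesis by (rule in_dom_bounded[OF assms])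
qed

lemma fun_op_linear:
  assumes f: "f \<in> borel_measurable borel" "x \<in> dom f" "z \<in> dom f"
  shows "fun_op f (a *\<^sub>R x + b *\<^sub>R z) = a *\<^sub>R fun_op f x + b *\<^sub>R fun_op f z"
proof (rule LIMSEQ_unique)
  show "(\<lambda>n. simple_fun_op (simple_approx f n) (a *\<^sub>R x + b *\<^sub>R z)) \<longlonglongrightarrow> fun_op f (a *\<^sub>R x + b *\<^sub>R z)"
    by (intro simple_approx_tendsto_fun_op in_dom_linear f)
  show "(\<lambda>n. simple_fun_op (simple_approx f n) (a *\<^sub>R x + b *\<^sub>R z)) \<longlonglongrightarrow> a *\<^sub>R fun_op f x + b *\<^sub>R fun_op f z"
    unfolding simple_fun_op_linear[OF simple_approx(1)[OF f(1)]]
    by (intro tendsto_intros simple_approx_tendsto_fun_op f)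
qed

lemma E_fun_op:
  assumes B: "B \<in> sets borel" and f: "f \<in> borel_measurable borel" "x \<in> dom f"
  shows "E B (fun_op f x) = fun_op (\<lambda>r. indicator B r * f r) x"
proof (rule LIMSEQ_unique)
  let ?F = "\<lambda>n r. indicator B r * simple_approx f n r"
  have s: "simple_function borel (?F n)" for n
    by (intro simple_function_mult simple_approx(1) f) (use B in simp)
  have ind: "\<bar>indicator B r * v\<bar> \<le> \<bar>v\<bar>" for r v :: real
    by (simp add: indicator_def)
  have bd: "\<bar>?F n r\<bar> \<le> \<bar>2 * f r\<bar>" for n r
    using simple_approx(3)[OF f(1), of n r] ind[of r "simple_approx f n r"] by (simp add: abs_mult)
  have "(\<lambda>n. fun_op (?F n) x) \<longlonglongrightarrow> fun_op (\<lambda>r. indicator B r * f r) x"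
  proof (rule fun_op_tendsto)
    show "x \<in> dom (\<lambda>r. 2 * f r)" by (rule in_dom_scale[OF f])
    show "AE r in \<mu> x. (\<lambda>n. ?F n r) \<longlonglongrightarrow> indicator B r * f r"
      by (intro AE_I2 tendsto_intros simple_approx(2) f)
    show "AE r in \<mu> x. \<bar>?F n r\<bar> \<le> \<bar>2 * f r\<bar>" for n
      by (intro AE_I2 bd)
  qed (use s f B in \<open>auto dest: borel_measurable_simple_function\<close>)
  then show "(\<lambda>n. E B (simple_fun_op (simple_approx f n) x)) \<longlonglongrightarrow> fun_op (\<lambda>r. indicator B r * f r) x"
    by (simp add: fun_op_simple s simple_fun_op_E[OF simple_approx(1)[OF f(1)] B])
  show "(\<lambda>n. E B (simple_fun_op (simple_approx f n) x)) \<longlonglongrightarrow> E B (fun_op f x)"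
    by (intro bounded_linear.tendsto[OF bounded_linear_E[OF B]] simple_approx_tendsto_fun_op f)
qed

text \<open>This density is the source of the product rule: it decides when \<open>f(A) x\<close> is in the domain of
  \<open>g(A)\<close>.\<close>

lemma \<mu>_fun_op:
  assumes f: "f \<in> borel_measurable borel" "x \<in> dom f"
  shows "\<mu> (fun_op f x) = density (\<mu> x) (\<lambda>r. ennreal ((f r)\<^sup>2))"
proof (rule measure_eqI)
  fix B assume "B \<in> sets (\<mu> (fun_op f x))"
  then have B: "B \<in> sets borel" by simp
  let ?g = "\<lambda>r. indicator B r * f r"
  have g: "?g \<in> borel_measurable borel" "x \<in> dom ?g"
    using B f by (auto intro!: in_dom_bound[OF f(2)] simp: indicator_def)
  have "emeasure (\<mu> (fun_op f x)) B = ennreal ((norm (fun_op ?g x))\<^sup>2)"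
    unfolding emeasure_\<mu>[OF B] E_quadratic[OF B] by (simp only: E_fun_op[OF B f])
  also have "\<dots> = ennreal (\<integral>r. (?g r)\<^sup>2 \<partial>\<mu> x)"
    by (simp only: norm_fun_op[OF g])
  also have "\<dots> = (\<integral>\<^sup>+r. ennreal ((?g r)\<^sup>2) \<partial>\<mu> x)"
    using g by (intro nn_integral_eq_integral[symmetric]) (auto simp: spectral_domain_def)
  also have "\<dots> = (\<integral>\<^sup>+r. ennreal ((f r)\<^sup>2) * indicator B r \<partial>\<mu> x)"
    by (intro nn_integral_cong) (simp add: indicator_def)
  also have "\<dots> = emeasure (density (\<mu> x) (\<lambda>r. ennreal ((f r)\<^sup>2))) B"
    using f B by (subst emeasure_density) auto
  finally show "emeasure (\<mu> (fun_op f x)) B = emeasure (density (\<mu> x) (\<lambda>r. ennreal ((f r)\<^sup>2))) B" .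
qed simp

lemma fun_op_in_dom_iff:
  assumes f: "f \<in> borel_measurable borel" "x \<in> dom f" and g: "g \<in> borel_measurable borel"
  shows "fun_op f x \<in> dom g \<longleftrightarrow> x \<in> dom (\<lambda>r. g r * f r)"
  unfolding spectral_domain_def mem_Collect_eq \<mu>_fun_op[OF f]
  using f g by (subst integrable_density) (auto simp: power_mult_distrib mult.commute)

text \<open>For simple \<open>g\<close> this is linearity and \<open>E(B) f(A) x = (1\<^sub>B f)(A) x\<close>; the general case
  follows by dominated convergence.\<close>

lemma fun_op_fun_op:
  assumes f: "f \<in> borel_measurable borel" "x \<in> dom f"
    and g: "g \<in> borel_measurable borel" "x \<in> dom (\<lambda>r. g r * f r)"
  shows "fun_op g (fun_op f x) = fun_op (\<lambda>r. g r * f r) x"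
proof -
  have simple: "simple_fun_op s (fun_op f x) = fun_op (\<lambda>r. s r * f r) x"
    if s: "simple_function borel s" for s
  proof -
    have fin: "finite (range s)" using s by (simp add: simple_function_def)
    have sB: "s -` {v} \<in> sets borel" for v by (rule simple_vimage[OF s])
    have m: "(\<lambda>r. indicator (s -` {v}) r * f r) \<in> borel_measurable borel" for v
      using sB[of v] f by simp
    have dom: "x \<in> dom (\<lambda>r. indicator (s -` {v}) r * f r)" for v
      by (intro in_dom_bound[OF f(2)] m AE_I2) (simp add: indicator_def)
    have "s r * f r = (\<Sum>v\<in>range s. v * (indicator (s -` {v}) r * f r))" for r
    proof -
      have "(\<Sum>v\<in>range s. v * (indicator (s -` {v}) r * f r)) = (\<Sum>v\<in>range s. if v = s r then s r * f r else 0)"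
        by (intro sum.cong) (auto simp: indicator_def)
      then show ?thesis using fin by simp
    qed
    then have "fun_op (\<lambda>r. s r * f r) x
        = fun_op (\<lambda>r. \<Sum>v\<in>range s. v * (indicator (s -` {v}) r * f r)) x" by simp
    also have "\<dots> = (\<Sum>v\<in>range s. fun_op (\<lambda>r. v * (indicator (s -` {v}) r * f r)) x)"
      by (intro fun_op_sum[OF fin] in_dom_scale dom m borel_measurable_times borel_measurable_const)
    also have "\<dots> = (\<Sum>v\<in>range s. v *\<^sub>R E (s -` {v}) (fun_op f x))"
    proof (intro sum.cong refl)
      fix v
      from fun_op_scale[OF m dom, of v]
      show "fun_op (\<lambda>r. v * (indicator (s -` {v}) r * f r)) x = v *\<^sub>R E (s -` {v}) (fun_op f x)"
        by (simp only: E_fun_op[OF sB f])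
    qed
    finally show ?thesis by (simp add: simple_fun_op_def)
  qed
  have fd: "fun_op f x \<in> dom g" using fun_op_in_dom_iff[OF f g(1)] g(2) by simp
  have "(\<lambda>n. fun_op (\<lambda>r. simple_approx g n r * f r) x) \<longlonglongrightarrow> fun_op (\<lambda>r. g r * f r) x"
  proof (rule fun_op_tendsto)
    show "x \<in> dom (\<lambda>r. 2 * (g r * f r))" using f g by (intro in_dom_scale) auto
    show "AE r in \<mu> x. (\<lambda>n. simple_approx g n r * f r) \<longlonglongrightarrow> g r * f r"
      by (intro AE_I2 tendsto_intros simple_approx(2) g)
    have "\<bar>simple_approx g n r * f r\<bar> \<le> \<bar>2 * (g r * f r)\<bar>" for n r
      using mult_right_mono[OF simple_approx(3)[OF g(1), of n r], of "\<bar>f r\<bar>"]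
      by (simp add: abs_mult)
    then show "AE r in \<mu> x. \<bar>simple_approx g n r * f r\<bar> \<le> \<bar>2 * (g r * f r)\<bar>" for n
      by (intro AE_I2)
  qed (use f g borel_measurable_simple_function[OF simple_approx(1)[OF g(1)]] in auto)
  moreover have "(\<lambda>n. fun_op (\<lambda>r. simple_approx g n r * f r) x) \<longlonglongrightarrow> fun_op g (fun_op f x)"
    using simple_approx_tendsto_fun_op[OF g(1) fd] by (simp add: simple simple_approx(1)[OF g(1)])
  ultimately show ?thesis by (rule LIMSEQ_unique[symmetric])
qed

lemma fun_op_diff_arg:
  assumes "f \<in> borel_measurable borel" "x \<in> dom f" "z \<in> dom f"
  shows "x - z \<in> dom f" "fun_op f (x - z) = fun_op f x - fun_op f z"
  using in_dom_linear[OF assms, of 1 "-1"] fun_op_linear[OF assms, of 1 "-1"] by simp_all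

lemma fun_op_add_arg:
  assumes "f \<in> borel_measurable borel" "x \<in> dom f" "z \<in> dom f"
  shows "x + z \<in> dom f" "fun_op f (x + z) = fun_op f x + fun_op f z"
  using in_dom_linear[OF assms, of 1 1] fun_op_linear[OF assms, of 1 1] by simp_all

lemma fun_op_compose:
  assumes "f \<in> borel_measurable borel" "x \<in> dom f" "g \<in> borel_measurable borel" "x \<in> dom (\<lambda>r. g r * f r)"
  shows "fun_op f x \<in> dom g" "fun_op g (fun_op f x) = fun_op (\<lambda>r. g r * f r) x"
  using fun_op_in_dom_iff[OF assms(1-3)] fun_op_fun_op[OF assms] assms(4) by simp_all

lemma inner_fun_op:
  assumes f: "f \<in> borel_measurable borel" "x \<in> dom f" "z \<in> dom f"
  shows "inner (fun_op f x) z = form f x z"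
proof (rule LIMSEQ_unique)
  have int: "(\<lambda>n. \<integral>r. simple_approx f n r \<partial>\<mu> y) \<longlonglongrightarrow> (\<integral>r. f r \<partial>\<mu> y)" if y: "y \<in> dom f" for y
  proof (rule integral_dominated_convergence[where w = "\<lambda>r. 2 * \<bar>f r\<bar>"])
    show "integrable (\<mu> y) (\<lambda>r. 2 * \<bar>f r\<bar>)" using integrable_in_dom[OF f(1) y] by simp
    show "AE r in \<mu> y. (\<lambda>n. simple_approx f n r) \<longlonglongrightarrow> f r"
      by (intro AE_I2 simple_approx(2) f)
    show "AE r in \<mu> y. norm (simple_approx f n r) \<le> 2 * \<bar>f r\<bar>" for n
      using simple_approx(3)[OF f(1)] by (intro AE_I2) simp
  qed (use f borel_measurable_simple_function[OF simple_approx(1)[OF f(1)]] in auto)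
  have "x + z \<in> dom f" "x - z \<in> dom f"
    using in_dom_linear[OF f, of 1 1] in_dom_linear[OF f, of 1 "-1"] by simp_all
  then have "(\<lambda>n. form (simple_approx f n) x z) \<longlonglongrightarrow> form f x z"
    unfolding form_def by (intro tendsto_intros int) auto
  then show "(\<lambda>n. inner (simple_fun_op (simple_approx f n) x) z) \<longlonglongrightarrow> form f x z"
    by (simp add: inner_simple_fun_op simple_approx(1)[OF f(1)])
  show "(\<lambda>n. inner (simple_fun_op (simple_approx f n) x) z) \<longlonglongrightarrow> inner (fun_op f x) z"
    by (intro tendsto_intros simple_approx_tendsto_fun_op f)
qed

lemma fun_op_symmetric:
  assumes "f \<in> borel_measurable borel" "x \<in> dom f" "z \<in> dom f"
  shows "inner (fun_op f x) z = inner x (fun_op f z)"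
  using inner_fun_op[OF assms] inner_fun_op[OF assms(1,3,2)] form_commute
  by (simp add: inner_commute)

lemma inner_fun_op_integral:
  assumes "f \<in> borel_measurable borel" "x \<in> dom f"
  shows "inner (fun_op f x) x = (\<integral>r. f r \<partial>\<mu> x)"
proof -
  have "\<mu> (x + x) = density (\<mu> x) (\<lambda>r. ennreal (2\<^sup>2))"
    using \<mu>_fun_op[of "\<lambda>r. 2" x] fun_op_scale[of "\<lambda>r. 1" x 2] const_in_dom fun_op_1
    by (simp add: scaleR_2)
  moreover have "integral\<^sup>L (\<mu> 0) f = 0"
  proof -
    have "AE r in \<mu> 0. f r = 0"
      by (rule AE_I[where N = UNIV]) (simp_all add: emeasure_\<mu>)
    then show ?thesis by (rule integral_eq_zero_AE)
  qed
  moreover have "integral\<^sup>L (density (\<mu> x) (\<lambda>r. ennreal (2\<^sup>2))) f = 4 * (\<integral>r. f r \<partial>\<mu> x)"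
    using assms(1) by (subst integral_density) auto
  ultimately show ?thesis
    using inner_fun_op[OF assms assms(2)] by (simp only: form_def) simp
qed

lemma E_in_dom:
  assumes B: "B \<in> sets borel" and f: "f \<in> borel_measurable borel"
    and bd: "\<And>r. r \<in> B \<Longrightarrow> \<bar>f r\<bar> \<le> c" "0 \<le> c"
  shows "E B x \<in> dom f"
proof -
  have i: "indicator B \<in> borel_measurable (borel :: real measure)" "x \<in> dom (indicator B)"
    using B by (auto intro!: in_dom_bounded[where c = 1] simp: indicator_def)
  have "x \<in> dom (\<lambda>r. f r * indicator B r)"
    using B f bd by (intro in_dom_bounded[where c = c]) (auto simp: indicator_def)
  then show ?thesis
    using fun_op_in_dom_iff[OF i f] fun_op_indicator[OF B] by simp
qed

lemma E_tendsto:
  assumes B: "\<And>n. B n \<in> sets borel" and ex: "AE r in \<mu> x. eventually (\<lambda>n. r \<in> B n) sequentially"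
  shows "(\<lambda>n. E (B n) x) \<longlonglongrightarrow> x"
proof -
  have "(\<lambda>n. fun_op (indicator (B n)) x) \<longlonglongrightarrow> fun_op (\<lambda>r. 1) x"
  proof (rule fun_op_tendsto[OF _ _ const_in_dom[of x 1]])
    show "AE r in \<mu> x. (\<lambda>n. indicator (B n) r) \<longlonglongrightarrow> (1 :: real)"
      using ex
    proof eventually_elim
      case (elim r)
      then show ?case
        by (rule tendsto_eventually[OF eventually_mono]) (simp add: indicator_def)
    qed
  qed (use B in \<open>auto simp: indicator_def\<close>)
  then show ?thesis by (simp add: fun_op_indicator[OF B] fun_op_1)
qed

text \<open>The weak characterization determines \<open>f(A) x\<close> since the domain of \<open>f(A)\<close> is dense: the
  projections onto the sets \<open>|f| \<le> n\<close> map into the domain and converge strongly to the identity.\<close>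

theorem spectral_integral_eq:
  assumes f: "f \<in> borel_measurable borel"
  shows "spectral_integral E f = {(x, fun_op f x) | x. x \<in> dom f}"
proof -
  have eq: "spectral_integral E f = {(x, y). x \<in> dom f \<and> (\<forall>z\<in>dom f. inner y z = form f x z)}"
    by (simp only: spectral_integral_def form_def)
  have "y = fun_op f x" if x: "x \<in> dom f" and y: "\<forall>z\<in>dom f. inner y z = form f x z" for x y
  proof -
    let ?d = "y - fun_op f x" and ?B = "\<lambda>n::nat. {r. \<bar>f r\<bar> \<le> real n}"
    have B: "?B n \<in> sets borel" for n using f by measurable
    have "E (?B n) ?d = 0" for n
    proof -
      have "E (?B n) ?d \<in> dom f" by (rule E_in_dom[OF B f, where c = n]) auto
      then have "inner ?d (E (?B n) ?d) = 0"
        using y inner_fun_op[OF f x] by (simp add: inner_diff_left)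
      then show ?thesis using E_quadratic[OF B, of n ?d] by (simp add: inner_commute)
  qed
    moreover have "(\<lambda>n. E (?B n) ?d) \<longlonglongrightarrow> ?d"
    proof (rule E_tendsto[OF B], intro AE_I2)
      fix r
      obtain N where "\<bar>f r\<bar> \<le> real N" using real_arch_simple by blast
      then show "\<forall>\<^sub>F n in sequentially. r \<in> ?B n"
        by (intro eventually_sequentiallyI[of N]) auto
  qed
    ultimately have "?d = 0" by (simp add: LIMSEQ_const_iff)
    then show ?thesis by simp
  qed
  then show ?thesis unfolding eq using inner_fun_op[OF f] by auto
qed

end

lemma spectral_integral_cong:
  assumes "\<And>x. scalar_measure E x = scalar_measure E' x"
  shows "spectral_integral E = spectral_integral E'"
  using assms by (simp add: spectral_integral_def spectral_domain_def fun_eq_iff)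

section \<open>Two uniqueness principles\<close>

text \<open>A generator only provides right derivatives of orbits, so the usual monotonicity test is needed
  in a one-sided form. Otherwise \<open>f - f(0) - e t\<close> would be positive at \<open>T\<close> for some \<open>e > 0\<close>; after
  the last time \<open>c\<close> at which it is nonpositive it would have to decrease.\<close>

lemma has_real_derivative_right_nonincreasing:
  fixes f :: "real \<Rightarrow> real"
  assumes cont: "continuous_on {0..} f"
    and der: "\<And>t. t \<ge> 0 \<Longrightarrow> \<exists>l\<le>0. (f has_real_derivative l) (at t within {t..})"
    and T: "T \<ge> 0"
  shows "f T \<le> f 0"
proof -
  have "f T \<le> f 0 + e * T" if e: "e > 0" for e
  proof (rule ccontr)
    assume gT: "\<not> f T \<le> f 0 + e * T"
    define g where "g t = f t - f 0 - e * t" for t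
    define c where "c = Sup {t\<in>{0..T}. g t \<le> 0}"
    have cg: "continuous_on {0..T} g"
      unfolding g_def by (intro continuous_intros continuous_on_subset[OF cont]) auto
    have cl: "closed {t\<in>{0..T}. g t \<le> 0}"
      by (rule continuous_on_closed_Collect_le[OF cg]) auto
    have ne: "{t\<in>{0..T}. g t \<le> 0} \<noteq> {}" using T by (auto simp: g_def)
    have bdd: "bdd_above {t\<in>{0..T}. g t \<le> 0}" by (rule bdd_aboveI[of _ T]) auto
    have "c \<in> {t\<in>{0..T}. g t \<le> 0}"
      unfolding c_def by (rule closed_contains_Sup[OF ne bdd cl])
    then have c: "0 \<le> c" "c \<le> T" "g c \<le> 0" by auto
    have "c \<noteq> T" using c gT by (auto simp: g_def)
    with c have cT: "c < T" by simp
    obtain l where l: "l \<le> 0" "(f has_real_derivative l) (at c within {c..})"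
      using der[OF c(1)] by blast
    have "(g has_real_derivative (l - e)) (at c within {c..})"
      unfolding g_def by (auto intro!: derivative_eq_intros l)
    from has_real_derivative_neg_dec_right[OF this] l e
    obtain d where d: "d > 0" "\<And>h. h > 0 \<Longrightarrow> h < d \<Longrightarrow> g (c + h) < g c" by force
    define h where "h = min (d / 2) (T - c)"
    have h: "h > 0" "h < d" "c + h \<le> T" using d(1) cT by (auto simp: h_def)
    have "c + h \<in> {t\<in>{0..T}. g t \<le> 0}" using d(2)[OF h(1,2)] h c by auto
    then have "c + h \<le> c" unfolding c_def by (rule cSup_upper[OF _ bdd])
    then show False using h by simp
  qed
  note le = this
  have "f T \<le> f 0 + e" if "e > 0" for e
  proof (cases "T = 0")
    case False
    then show ?thesis using le[of "e / T"] that T by simp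
  qed (use that in simp)
  then show ?thesis by (rule field_le_epsilon)
qed

text \<open>\<open>exp(-2ct) |D(t)|\<^sup>2\<close> is nonincreasing. Applied to the difference of two orbits this
  gives all uniqueness statements about semigroups.\<close>

lemma right_derivative_energy_zero:
  fixes D :: "real \<Rightarrow> 'b::real_inner"
  assumes cont: "continuous_on {0..} D"
    and der: "\<And>t. t \<ge> 0 \<Longrightarrow> (D has_vector_derivative G t) (at t within {t..})"
    and le: "\<And>t. t \<ge> 0 \<Longrightarrow> inner (D t) (G t) \<le> c * (norm (D t))\<^sup>2"
    and 0: "D 0 = 0" and t: "t \<ge> 0"
  shows "D t = 0"
proof -
  define f where "f t = exp (- (2 * c * t)) * inner (D t) (D t)" for t
  have "f t \<le> f 0"
  proof (rule has_real_derivative_right_nonincreasing[OF _ _ t])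
    show "continuous_on {0..} f" unfolding f_def by (intro continuous_intros cont)
    fix t :: real assume t: "t \<ge> 0"
    have "((\<lambda>t. inner (D t) (D t)) has_vector_derivative inner (D t) (G t) + inner (G t) (D t))
        (at t within {t..})"
      by (rule bounded_bilinear.has_vector_derivative[OF bounded_bilinear_inner der[OF t] der[OF t]])
    then have i: "((\<lambda>t. inner (D t) (D t)) has_real_derivative 2 * inner (D t) (G t)) (at t within {t..})"
      by (simp add: has_real_derivative_iff_has_vector_derivative inner_commute)
    have "(f has_real_derivative (exp (- (2 * c * t)) * (- (2 * c)) * inner (D t) (D t)
        + exp (- (2 * c * t)) * (2 * inner (D t) (G t)))) (at t within {t..})"
      unfolding f_def by (rule derivative_eq_intros i refl | simp)+
    moreover have "exp (- (2 * c * t)) * (- (2 * c)) * inner (D t) (D t)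
        + exp (- (2 * c * t)) * (2 * inner (D t) (G t))
        = 2 * exp (- (2 * c * t)) * (inner (D t) (G t) - c * (norm (D t))\<^sup>2)"
      by (simp add: algebra_simps power2_norm_eq_inner)
    moreover have "\<dots> \<le> 0" using le[OF t] by (intro mult_nonneg_nonpos) auto
    ultimately show "\<exists>l\<le>0. (f has_real_derivative l) (at t within {t..})" by metis
  qed
  then have "inner (D t) (D t) \<le> 0" by (simp add: f_def 0 mult_le_0_iff)
  then show ?thesis by (simp add: inner_gt_zero_iff flip: not_less)
qed

lemma has_right_derivative_iff:
  fixes f :: "real \<Rightarrow> 'b::real_normed_vector"
  shows "(f has_vector_derivative y) (at t within {t..}) \<longleftrightarrow>
    ((\<lambda>h. norm ((f (h + t) - f t) /\<^sub>R h - y)) \<longlongrightarrow> 0) (at_right 0)"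
proof -
  have "at t within {t..} = at_right t"
    by (rule at_within_nhd[of _ UNIV]) auto
  moreover have "((\<lambda>s. norm (f s - f t - (s - t) *\<^sub>R y) / norm (s - t)) \<longlongrightarrow> 0) (at_right t)
    \<longleftrightarrow> ((\<lambda>h. norm (f (h + t) - f t - h *\<^sub>R y) / norm h) \<longlongrightarrow> 0) (at_right 0)"
    by (subst at_right_to_0) (simp add: filterlim_filtermap)
  moreover have "\<dots> \<longleftrightarrow> ((\<lambda>h. norm ((f (h + t) - f t) /\<^sub>R h - y)) \<longlongrightarrow> 0) (at_right 0)"
  proof (rule tendsto_cong)
    show "\<forall>\<^sub>F h in at_right 0. norm (f (h + t) - f t - h *\<^sub>R y) / norm h = norm ((f (h + t) - f t) /\<^sub>R h - y)"
      using eventually_at_right_less[of "0::real"]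
    proof eventually_elim
      case (elim h)
      then have "(f (h + t) - f t) /\<^sub>R h - y = (f (h + t) - f t - h *\<^sub>R y) /\<^sub>R h"
        by (simp add: scaleR_diff_right)
      then show ?case using elim by (simp add: divide_inverse mult.commute)
    qed
  qed
  ultimately show ?thesis
    by (simp add: has_vector_derivative_def has_derivative_iff_norm bounded_linear_scaleR_left)
qed

lemma c0_semigroupD:
  assumes "c0_semigroup X N T"
  shows "t \<ge> 0 \<Longrightarrow> x \<in> X \<Longrightarrow> T t x \<in> X"
    and "t \<ge> 0 \<Longrightarrow> x \<in> X \<Longrightarrow> y \<in> X \<Longrightarrow> T t (a *\<^sub>R x + b *\<^sub>R y) = a *\<^sub>R T t x + b *\<^sub>R T t y"
    and "t \<ge> 0 \<Longrightarrow> \<exists>M. \<forall>x\<in>X. N (T t x) \<le> M * N x"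
    and "x \<in> X \<Longrightarrow> T 0 x = x"
    and "s \<ge> 0 \<Longrightarrow> t \<ge> 0 \<Longrightarrow> x \<in> X \<Longrightarrow> T (s + t) x = T s (T t x)"
    and "x \<in> X \<Longrightarrow> t \<ge> 0 \<Longrightarrow> ((\<lambda>s. N (T s x - T t x)) \<longlongrightarrow> 0) (at t within {0..})"
  using assms[unfolded c0_semigroup_def] by (simp_all add: image_subset_iff)

lemma generator_orbit:
  assumes T: "c0_semigroup X N T" and X: "subspace X" and N: "\<And>x. 0 \<le> N x"
    and xy: "(x, y) \<in> generator X N T" and t: "t \<ge> 0"
  shows "(T t x, T t y) \<in> generator X N T"
proof -
  have x: "x \<in> X" "y \<in> X" and lim: "((\<lambda>h. N ((T h x - x) /\<^sub>R h - y)) \<longlongrightarrow> 0) (at_right 0)"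
    using xy by (auto simp: generator_def)
  note T_X = c0_semigroupD(1)[OF T]
  note T_lin = c0_semigroupD(2)[OF T t]
  obtain M where M: "\<And>z. z \<in> X \<Longrightarrow> N (T t z) \<le> M * N z"
    using c0_semigroupD(3)[OF T t] by blast
  have comm: "T h (T t x) = T t (T h x)" if "h \<ge> 0" for h
    using c0_semigroupD(5)[OF T that t x(1)] c0_semigroupD(5)[OF T t that x(1)]
    by (simp add: add.commute)
  have "((\<lambda>h. N ((T h (T t x) - T t x) /\<^sub>R h - T t y)) \<longlongrightarrow> 0) (at_right 0)"
  proof (rule tendsto_sandwich[where f = "\<lambda>_. 0"])
    show "((\<lambda>h. M * N ((T h x - x) /\<^sub>R h - y)) \<longlongrightarrow> 0) (at_right 0)"
      by (rule tendsto_mult_right_zero[OF lim])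
    show "\<forall>\<^sub>F h in at_right 0. N ((T h (T t x) - T t x) /\<^sub>R h - T t y) \<le> M * N ((T h x - x) /\<^sub>R h - y)"
      using eventually_at_right_less[of "0::real"]
    proof eventually_elim
      case (elim h)
      have Th: "T h x \<in> X" using elim x by (intro T_X) auto
      have "T t ((T h x - x) /\<^sub>R h - y) = (T h (T t x) - T t x) /\<^sub>R h - T t y"
      proof -
        have d: "(T h x - x) /\<^sub>R h \<in> X"
          using Th x X by (simp add: subspace_diff subspace_scale)
        have "T t (T h x - x) = T t (T h x) - T t x" using T_lin[OF Th x(1), of 1 "-1"] by simp
        moreover have "T t ((T h x - x) /\<^sub>R h) = T t (T h x - x) /\<^sub>R h"
          using T_lin[of "T h x - x" x "inverse h" 0] Th x X by (simp add: subspace_diff)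
        moreover have "T t ((T h x - x) /\<^sub>R h - y) = T t ((T h x - x) /\<^sub>R h) - T t y"
          using T_lin[OF d x(2), of 1 "-1"] by simp
        ultimately show ?thesis using comm[of h] elim by simp
      qed
      moreover have "(T h x - x) /\<^sub>R h - y \<in> X"
        using Th x X by (simp add: subspace_diff subspace_scale)
      ultimately show ?case using M by metis
    qed
  qed (simp_all add: N)
  then show ?thesis using x T_X[OF t] by (simp add: generator_def)
qed

lemma semigroup_orbit:
  fixes X :: "'b::real_normed_vector set"
  assumes T: "c0_semigroup X N T" and X: "subspace X" and N: "\<And>x. norm x \<le> N x"
    and xy: "(x, y) \<in> generator X N T"
  shows "continuous_on {0..} (\<lambda>s. T s x)"
    and "t \<ge> 0 \<Longrightarrow> ((\<lambda>s. T s x) has_vector_derivative T t y) (at t within {t..})"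
proof -
  have x: "x \<in> X" using xy by (simp add: generator_def)
  show "continuous_on {0..} (\<lambda>s. T s x)"
    unfolding continuous_on_def
  proof (intro ballI)
    fix t :: real assume "t \<in> {0..}"
    then have "((\<lambda>s. N (T s x - T t x)) \<longlongrightarrow> 0) (at t within {0..})"
      by (intro c0_semigroupD(6)[OF T x]) simp
    moreover have "\<forall>\<^sub>F s in at t within {0..}. norm (T s x - T t x) \<le> N (T s x - T t x)"
      by (intro always_eventually allI N)
    ultimately have "((\<lambda>s. T s x - T t x) \<longlongrightarrow> 0) (at t within {0..})"
      by (rule Lim_null_comparison[rotated])
    then show "((\<lambda>s. T s x) \<longlongrightarrow> T t x) (at t within {0..})" by (rule LIM_zero_cancel)
  qed
  assume t: "t \<ge> 0"
  have "0 \<le> N z" for z by (rule order_trans[OF norm_ge_zero N])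
  from generator_orbit[OF T X this xy t]
  have "((\<lambda>h. N ((T h (T t x) - T t x) /\<^sub>R h - T t y)) \<longlongrightarrow> 0) (at_right 0)"
    by (simp add: generator_def)
  moreover have "\<forall>\<^sub>F h in at_right 0. norm (norm ((T (h + t) x - T t x) /\<^sub>R h - T t y) :: real)
      \<le> N ((T h (T t x) - T t x) /\<^sub>R h - T t y)"
    using eventually_at_right_less[of "0::real"]
  proof eventually_elim
    case (elim h)
    then have "T (h + t) x = T h (T t x)" by (intro c0_semigroupD(5)[OF T _ t x]) simp
    then show ?case by (simp add: N)
  qed
  ultimately show "((\<lambda>s. T s x) has_vector_derivative T t y) (at t within {t..})"
    unfolding has_right_derivative_iff by (rule Lim_null_comparison[rotated])
qed

text \<open>For \<open>r \<ge> 0\<close> the function \<open>exp(-c e\<^sup>-\<^sup>n\<^sup>r)\<close> is a bounded limit of linear combinations of the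
  \<open>e\<^sup>-\<^sup>k\<^sup>n\<^sup>r\<close>, so its integrals with respect to the two measures agree. With \<open>c = n e\<^sup>n\<^sup>a\<close> and
  \<open>n \<rightarrow> \<infinity>\<close> it converges to the indicator function of \<open>(a, \<infinity>)\<close>, also at the point \<open>a\<close>, thanks to the
  factor \<open>n\<close>.\<close>

lemma finite_measure_eqI_laplace:
  fixes M N :: "real measure"
  assumes M: "finite_measure M" "sets M = sets borel" "AE r in M. 0 \<le> r"
    and N: "finite_measure N" "sets N = sets borel" "AE r in N. 0 \<le> r"
    and eq: "\<And>t. t \<ge> 0 \<Longrightarrow> (\<integral>r. exp (- (t * r)) \<partial>M) = (\<integral>r. exp (- (t * r)) \<partial>N)"
  shows "M = N"
proof -
  define s where "s c n K r = (\<Sum>k<K. (- c) ^ k / fact k * exp (- (real (k * n) * r)))"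
    for c :: real and n K :: nat and r :: real
  define e where "e c n r = exp (- c * exp (- (real n * r)))" for c :: real and n :: nat and r :: real
  have lim_s: "(\<lambda>K. \<integral>r. s c n K r \<partial>L) \<longlonglongrightarrow> (\<integral>r. e c n r \<partial>L)"
    and int_s: "(\<integral>r. s c n K r \<partial>L) = (\<Sum>k<K. (- c) ^ k / fact k * (\<integral>r. exp (- (real (k * n) * r)) \<partial>L))"
    if L: "finite_measure L" "sets L = sets borel" "AE r in L. 0 \<le> r" for c n K and L :: "real measure"
  proof -
    have meas: "borel_measurable L = borel_measurable borel"
      by (rule measurable_cong_sets) (auto simp: L)
    have integ: "integrable L (\<lambda>r. exp (- (real k * r)))" for k
    proof (rule finite_measure.integrable_const_bound[OF L(1)])
      show "AE r in L. norm (exp (- (real k * r))) \<le> 1" using L(3) by eventually_elim simp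
    qed (simp add: meas)
    show "(\<integral>r. s c n K r \<partial>L) = (\<Sum>k<K. (- c) ^ k / fact k * (\<integral>r. exp (- (real (k * n) * r)) \<partial>L))"
      unfolding s_def using integ by (subst Bochner_Integration.integral_sum) (auto simp del: of_nat_mult)
    show "(\<lambda>K. \<integral>r. s c n K r \<partial>L) \<longlonglongrightarrow> (\<integral>r. e c n r \<partial>L)"
    proof (rule integral_dominated_convergence[where w = "\<lambda>_. exp \<bar>c\<bar>"])
      show "integrable L (\<lambda>_. exp \<bar>c\<bar>)" by (rule finite_measure.integrable_const[OF L(1)])
      have pow: "exp (- (real (k * n) * r)) = exp (- (real n * r)) ^ k" for k r
        by (simp add: exp_of_nat_mult[symmetric] algebra_simps)
      have sums: "(\<lambda>k. (- c) ^ k / fact k * exp (- (real (k * n) * r))) sums e c n r" for r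
      proof -
        have "(\<lambda>k. (- c * exp (- (real n * r))) ^ k /\<^sub>R fact k) sums e c n r"
          unfolding e_def by (rule exp_converges)
        then show ?thesis by (simp only: pow power_mult_distrib) (simp add: divide_inverse mult_ac)
      qed
      show "AE r in L. (\<lambda>K. s c n K r) \<longlonglongrightarrow> e c n r"
        unfolding s_def using sums by (intro AE_I2) (simp add: sums_def)
      show "AE r in L. norm (s c n K r) \<le> exp \<bar>c\<bar>" for K
        using L(3)
      proof eventually_elim
        case (elim r)
        have "norm (s c n K r) \<le> (\<Sum>k<K. norm ((- c) ^ k / fact k * exp (- (real (k * n) * r))))"
          unfolding s_def by (rule norm_sum)
        also have "\<dots> \<le> (\<Sum>k<K. \<bar>c\<bar> ^ k /\<^sub>R fact k)"
        proof (rule sum_mono)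
          fix k
          have "exp (- (real (k * n) * r)) \<le> 1" using elim by simp
          then show "norm ((- c) ^ k / fact k * exp (- (real (k * n) * r))) \<le> \<bar>c\<bar> ^ k /\<^sub>R fact k"
            using mult_left_le[of "exp (- (real (k * n) * r))" "\<bar>c\<bar> ^ k / fact k"]
            by (simp add: abs_mult power_abs divide_inverse mult_ac)
        qed
        also have "\<dots> \<le> exp \<bar>c\<bar>"
          using sum_le_suminf[of "\<lambda>k. \<bar>c\<bar> ^ k /\<^sub>R fact k" "{..<K}"] summable_exp_generic[of "\<bar>c\<bar>"]
          by (simp add: exp_def)
        finally show ?case .
      qed
    qed (auto simp: s_def e_def meas)
  qed
  have e_eq: "(\<integral>r. e c n r \<partial>M) = (\<integral>r. e c n r \<partial>N)" for c n
  proof -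
    have "(\<integral>r. s c n K r \<partial>M) = (\<integral>r. s c n K r \<partial>N)" for K
      using eq[of "real (_ * n)"] by (simp add: int_s[OF M] int_s[OF N] del: of_nat_mult)
    then show ?thesis using lim_s[OF M, of c n] lim_s[OF N, of c n] LIMSEQ_unique by simp
  qed
  have lim_e: "(\<lambda>n. \<integral>r. e (real n * exp (real n * a)) n r \<partial>L) \<longlonglongrightarrow> measure L {a<..}"
    if L: "finite_measure L" "sets L = sets borel" "AE r in L. 0 \<le> r" for a and L :: "real measure"
  proof -
    have meas: "borel_measurable L = borel_measurable borel"
      by (rule measurable_cong_sets) (auto simp: L)
    have form: "e (real n * exp (real n * a)) n r = exp (- (real n * exp (real n * (a - r))))" for n r
      by (simp add: e_def exp_add[symmetric] right_diff_distrib mult.assoc)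
    have "(\<lambda>n. \<integral>r. e (real n * exp (real n * a)) n r \<partial>L) \<longlonglongrightarrow> (\<integral>r. indicator {a<..} r \<partial>L)"
    proof (rule integral_dominated_convergence[where w = "\<lambda>_. 1"])
      show "integrable L (\<lambda>_. 1::real)" by (rule finite_measure.integrable_const[OF L(1)])
      show "AE r in L. norm (e (real n * exp (real n * a)) n r) \<le> 1" for n
        unfolding form by (intro AE_I2) simp
      show "AE r in L. (\<lambda>n. e (real n * exp (real n * a)) n r) \<longlonglongrightarrow> indicator {a<..} r"
      proof (intro AE_I2)
        fix r
        show "(\<lambda>n. e (real n * exp (real n * a)) n r) \<longlonglongrightarrow> indicator {a<..} r"
        proof (cases "r > a")
          case True
          have "(\<lambda>n. real n * exp (a - r) ^ n) \<longlonglongrightarrow> 0"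
            by (rule powser_times_n_limit_0) (use True in simp)
          then have "(\<lambda>n. exp (- (real n * exp (real n * (a - r))))) \<longlonglongrightarrow> exp (- 0)"
            by (intro tendsto_intros) (simp add: exp_of_nat_mult)
          then show ?thesis using True by (simp add: form)
        next
          case False
          have "(\<lambda>n. exp (- (real n * exp (real n * (a - r))))) \<longlonglongrightarrow> 0"
          proof (rule tendsto_sandwich[where f = "\<lambda>_. 0" and h = "\<lambda>n. exp (-1) ^ n"])
            show "(\<lambda>n. exp (-1 :: real) ^ n) \<longlonglongrightarrow> 0" by (rule LIMSEQ_power_zero) simp
            have "real n \<le> real n * exp (real n * (a - r))" for n
              using False by (simp add: mult_le_cancel_left1)
            then show "\<forall>\<^sub>F n in sequentially. exp (- (real n * exp (real n * (a - r)))) \<le> exp (-1) ^ n"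
              by (simp add: exp_of_nat_mult[symmetric])
          qed auto
          then show ?thesis using False by (simp add: form)
        qed
      qed
    qed (use L in \<open>auto simp: e_def meas\<close>)
    then show ?thesis using L by simp
  qed
  show ?thesis
  proof (rule measure_eqI_lessThan)
    fix a
    have "measure M {a<..} = measure N {a<..}"
      using LIMSEQ_unique[OF lim_e[OF M, of a, unfolded e_eq] lim_e[OF N, of a]] .
    then show "emeasure M {a<..} = emeasure N {a<..}"
      using finite_measure.emeasure_eq_measure[OF M(1)] finite_measure.emeasure_eq_measure[OF N(1)]
      by simp
    show "emeasure M {a<..} < \<infinity>"
      using finite_measure.emeasure_finite[OF M(1)] by (simp add: top.not_eq_extremum)
  qed (use M N in auto)
qed

section \<open>Nonnegative operators and the heat semigroup\<close>

lemma has_vector_derivative_iff_quotient: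
  fixes f :: "real \<Rightarrow> 'b::real_normed_vector"
  shows "(f has_vector_derivative y) (at t within S) \<longleftrightarrow>
    ((\<lambda>s. (f s - f t) /\<^sub>R (s - t)) \<longlongrightarrow> y) (at t within S)"
proof -
  have "((\<lambda>s. norm (f s - f t - (s - t) *\<^sub>R y) / norm (s - t)) \<longlongrightarrow> 0) (at t within S)
    \<longleftrightarrow> ((\<lambda>s. norm ((f s - f t) /\<^sub>R (s - t) - y)) \<longlongrightarrow> 0) (at t within S)"
  proof (rule Lim_cong_within)
    fix s assume "s \<noteq> t"
    then have "(f s - f t) /\<^sub>R (s - t) - y = (f s - f t - (s - t) *\<^sub>R y) /\<^sub>R (s - t)"
      by (simp add: scaleR_diff_right)
    then show "norm (f s - f t - (s - t) *\<^sub>R y) / norm (s - t) = norm ((f s - f t) /\<^sub>R (s - t) - y)"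
      by (simp add: divide_inverse mult.commute)
  qed auto
  then show ?thesis
    by (simp add: has_vector_derivative_def has_derivative_iff_norm bounded_linear_scaleR_left
        tendsto_norm_zero_iff LIM_zero_iff)
qed

locale nonneg_spectral_calculus = spectral_calculus E
  for E :: "real set \<Rightarrow> 'a::{real_inner,complete_space} \<Rightarrow> 'a" +
  fixes A :: "'a operator"
  assumes A_eq: "spectral_integral E (\<lambda>r. r) = A"
    and nonneg: "nonneg_operator A"
begin

lemma A_iff: "(x, y) \<in> A \<longleftrightarrow> x \<in> dom (\<lambda>r. r) \<and> y = fun_op (\<lambda>r. r) x"
  unfolding A_eq[symmetric] by (subst spectral_integral_eq) auto

text \<open>For \<open>z = E(B) x\<close> with \<open>B \<subseteq> [-n, 0)\<close> one has \<open>0 \<le> (Az, z) = \<integral> r d\<mu>\<^sub>z\<close>, while the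
  integrand is negative on the support of \<open>\<mu>\<^sub>z\<close>.\<close>

lemma AE_nonneg: "AE r in \<mu> x. 0 \<le> r"
proof -
  have "AE r in \<mu> x. r \<notin> {- real n..<0}" for n
  proof -
    let ?B = "{- real n..<0} :: real set"
    let ?z = "E ?B x"
    have B: "?B \<in> sets borel" by simp
    have z: "?z \<in> dom (\<lambda>r. r)"
      by (rule E_in_dom[OF B, where c = n]) auto
    \<comment> \<open>\<open>\<mu>\<^sub>z\<close> is concentrated on \<open>B\<close> since \<open>E(-B) z = 0\<close>.\<close>
    have in_B: "AE r in \<mu> ?z. r \<in> ?B"
    proof (rule AE_I[where N = "- ?B"])
      have "E (- ?B) ?z = 0" using E_E[of "- ?B" ?B x] by simp
      then show "emeasure (\<mu> ?z) (- ?B) = 0" by (simp add: emeasure_\<mu>)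
    qed auto
    have "0 \<le> inner (fun_op (\<lambda>r. r) ?z) ?z"
      using nonneg z A_iff by (force simp: nonneg_operator_def)
    also have "\<dots> = (\<integral>r. r \<partial>\<mu> ?z)" using z by (intro inner_fun_op_integral) auto
    finally have "(\<integral>r. - r \<partial>\<mu> ?z) \<le> 0" by simp
    moreover have nn: "AE r in \<mu> ?z. 0 \<le> - r" using in_B by eventually_elim auto
    ultimately have eq: "(\<integral>r. - r \<partial>\<mu> ?z) = 0"
      using integral_nonneg_AE[OF nn] by linarith
    have id: "(\<lambda>r::real. r) \<in> borel_measurable borel" by simp
    have "integrable (\<mu> ?z) (\<lambda>r. - r)"
      by (rule Bochner_Integration.integrable_minus[OF integrable_in_dom[OF id z]])
    from iffD1[OF integral_nonneg_eq_0_iff_AE[OF this nn] eq]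
    have "AE r in \<mu> ?z. - r = 0" .
    then have "AE r in \<mu> ?z. False" using in_B by eventually_elim auto
    then have "emeasure (\<mu> ?z) UNIV = 0"
      using AE_iff_measurable[of UNIV "\<mu> ?z" "\<lambda>_. False"] by simp
    then have "inner ?z ?z \<le> 0"
      using emeasure_\<mu>[of UNIV ?z] by (simp add: ennreal_eq_0_iff del: inner_eq_zero_iff)
    then have "?z = 0"
      by (metis inner_gt_zero_iff not_less)
    then have "emeasure (\<mu> x) ?B = 0" by (simp add: emeasure_\<mu>[OF B])
    then show ?thesis by (intro AE_not_in) (auto simp: null_sets_def)
  qed
  then have "AE r in \<mu> x. \<forall>n. r \<notin> {- real n..<0}" by (simp only: AE_all_countable simp_thms)
  then show ?thesis
  proof eventually_elim
    case (elim r)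
    obtain n where n: "- r \<le> real n" using real_arch_simple[of "- r"] by (elim exE)
    have "r \<notin> {- real n..<0}" by (rule spec[OF elim])
    then show ?case using n by simp
  qed
qed

lemma AE_I_nonneg: "(\<And>r. 0 \<le> r \<Longrightarrow> P r) \<Longrightarrow> AE r in \<mu> x. P r"
  using AE_nonneg[of x] by eventually_elim

lemma in_dom_bound_nonneg:
  assumes "x \<in> dom g" "f \<in> borel_measurable borel" "\<And>r. 0 \<le> r \<Longrightarrow> \<bar>f r\<bar> \<le> \<bar>g r\<bar>"
  shows "x \<in> dom f"
  by (rule in_dom_bound[OF assms(1,2)]) (rule AE_I_nonneg, rule assms(3))

lemma in_dom_bounded_nonneg:
  assumes "f \<in> borel_measurable borel" "\<And>r. 0 \<le> r \<Longrightarrow> \<bar>f r\<bar> \<le> c"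
  shows "x \<in> dom f"
  by (rule in_dom_bounded[OF assms(1), where c = c]) (rule AE_I_nonneg, rule assms(2))

lemma fun_op_cong_nonneg:
  assumes "f \<in> borel_measurable borel" "g \<in> borel_measurable borel" "x \<in> dom g"
    and "\<And>r. 0 \<le> r \<Longrightarrow> f r = g r"
  shows "fun_op f x = fun_op g x"
  by (rule fun_op_cong_AE[OF assms(1-3)]) (rule AE_I_nonneg, rule assms(4))

lemma fun_op_tendsto_within:
  fixes F :: "real \<Rightarrow> real \<Rightarrow> real"
  assumes F: "\<And>s. s \<in> S \<Longrightarrow> F s \<in> borel_measurable borel" and f: "f \<in> borel_measurable borel"
    and h: "x \<in> dom h"
    and lim: "\<And>r. 0 \<le> r \<Longrightarrow> ((\<lambda>s. F s r) \<longlongrightarrow> f r) (at t within S)"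
    and bd: "\<And>s r. s \<in> S \<Longrightarrow> s \<noteq> t \<Longrightarrow> 0 \<le> r \<Longrightarrow> \<bar>F s r\<bar> \<le> \<bar>h r\<bar>"
  shows "((\<lambda>s. fun_op (F s) x) \<longlongrightarrow> fun_op f x) (at t within S)"
  unfolding tendsto_at_iff_sequentially o_def
proof (intro allI impI)
  fix X :: "nat \<Rightarrow> real"
  assume X: "\<forall>i. X i \<in> S - {t}" and lim_X: "X \<longlonglongrightarrow> t"
  show "(\<lambda>i. fun_op (F (X i)) x) \<longlonglongrightarrow> fun_op f x"
  proof (rule fun_op_tendsto[OF _ f h])
    show "AE r in \<mu> x. (\<lambda>n. F (X n) r) \<longlonglongrightarrow> f r"
    proof (rule AE_I_nonneg)
      fix r :: real assume "0 \<le> r"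
      from lim[OF this] X lim_X show "(\<lambda>n. F (X n) r) \<longlonglongrightarrow> f r"
        unfolding tendsto_at_iff_sequentially o_def by blast
    qed
    show "AE r in \<mu> x. \<bar>F (X n) r\<bar> \<le> \<bar>h r\<bar>" for n
      by (rule AE_I_nonneg) (use X bd in blast)
  qed (use X F in auto)
qed

text \<open>The Lipschitz bound dominates the difference quotients.\<close>

lemma fun_op_has_vector_derivative:
  fixes F :: "real \<Rightarrow> real \<Rightarrow> real"
  assumes F: "\<And>s. s \<in> S \<Longrightarrow> F s \<in> borel_measurable borel" and f: "f \<in> borel_measurable borel"
    and h: "h \<in> borel_measurable borel" "x \<in> dom h" and t: "t \<in> S" "x \<in> dom (F t)"
    and der: "\<And>r. 0 \<le> r \<Longrightarrow> ((\<lambda>s. F s r) has_real_derivative f r) (at t within S)"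
    and bd: "\<And>s r. s \<in> S \<Longrightarrow> 0 \<le> r \<Longrightarrow> \<bar>F s r - F t r\<bar> \<le> \<bar>s - t\<bar> * h r"
  shows "((\<lambda>s. fun_op (F s) x) has_vector_derivative fun_op f x) (at t within S)"
proof -
  have h_nn: "0 \<le> h r" if "s \<in> S" "s \<noteq> t" "0 \<le> r" for s r
    using order_trans[OF abs_ge_zero bd[OF that(1,3)]] that(2) by (simp add: zero_le_mult_iff)
  have dF: "x \<in> dom (F s)" if s: "s \<in> S" "s \<noteq> t" for s
  proof -
    have "x \<in> dom (\<lambda>r. 1 * \<bar>F t r\<bar> + \<bar>s - t\<bar> * \<bar>h r\<bar>)"
      using t h F[OF t(1)] by (intro in_dom_add) (auto simp: spectral_domain_def)
    then show ?thesis
    proof (rule in_dom_bound_nonneg)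
      fix r :: real assume r: "0 \<le> r"
      have "\<bar>F s r\<bar> \<le> \<bar>F t r\<bar> + \<bar>s - t\<bar> * \<bar>h r\<bar>"
        using bd[OF s(1) r] h_nn[OF s r] by simp
      then show "\<bar>F s r\<bar> \<le> \<bar>1 * \<bar>F t r\<bar> + \<bar>s - t\<bar> * \<bar>h r\<bar>\<bar>" by simp
    qed (rule F[OF s(1)])
  qed
  have quot: "(fun_op (F s) x - fun_op (F t) x) /\<^sub>R (s - t) = fun_op (\<lambda>r. (F s r - F t r) / (s - t)) x"
    if s: "s \<in> S" "s \<noteq> t" for s
  proof -
    have m: "(\<lambda>r. F s r - F t r) \<in> borel_measurable borel" using F s t by simp
    have d: "x \<in> dom (\<lambda>r. F s r - F t r)"
      using in_dom_add[OF F[OF s(1)] F[OF t(1)] dF[OF s] t(2), of 1 "-1"] by simp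
    show ?thesis
      using fun_op_scale[OF m d, of "inverse (s - t)"]
      by (simp add: fun_op_diff[OF F[OF s(1)] dF[OF s] F[OF t(1)] t(2)] divide_inverse mult.commute)
  qed
  have "((\<lambda>s. fun_op (\<lambda>r. (F s r - F t r) / (s - t)) x) \<longlongrightarrow> fun_op f x) (at t within S)"
  proof (rule fun_op_tendsto_within[OF _ f h(2)])
    show "(\<lambda>r. (F s r - F t r) / (s - t)) \<in> borel_measurable borel" if "s \<in> S" for s
      using F that t by simp
    show "((\<lambda>s. (F s r - F t r) / (s - t)) \<longlongrightarrow> f r) (at t within S)" if "0 \<le> r" for r
      using der[OF that] by (simp add: has_field_derivative_iff)
    show "\<bar>(F s r - F t r) / (s - t)\<bar> \<le> \<bar>h r\<bar>" if "s \<in> S" "s \<noteq> t" "0 \<le> r" for s r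
      using bd[OF that(1,3)] h_nn[OF that] that(2) by (simp add: abs_divide field_simps)
  qed
  then have "((\<lambda>s. (fun_op (F s) x - fun_op (F t) x) /\<^sub>R (s - t)) \<longlongrightarrow> fun_op f x) (at t within S)"
    by (rule Lim_transform_within[of _ _ _ _ 1]) (auto simp: quot)
  then show ?thesis by (simp only: has_vector_derivative_iff_quotient)
qed

end

lemma exp_minus_lipschitz:
  fixes a b :: real
  assumes "0 \<le> a" "0 \<le> b"
  shows "\<bar>exp (- a) - exp (- b)\<bar> \<le> \<bar>a - b\<bar>"
proof -
  have one_minus: "1 - exp (- c) \<le> c" for c :: real
    using exp_ge_add_one_self[of "- c"] by linarith
  have le: "exp (- a) - exp (- b) \<le> b - a" if "0 \<le> a" "a \<le> b" for a b :: real
  proof -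
    have "exp (- a) - exp (- b) = exp (- a) * (1 - exp (- (b - a)))"
      by (simp add: right_diff_distrib exp_add[symmetric])
    also have "\<dots> \<le> 1 * (1 - exp (- (b - a)))"
      using that by (intro mult_right_mono) auto
    also have "\<dots> \<le> b - a"
      using one_minus[of "b - a"] by (simp only: mult_1_left)
    finally show ?thesis .
  qed
  show ?thesis using le[of a b] le[of b a] assms by (cases "a \<le> b") (auto simp: abs_if)
qed

context nonneg_spectral_calculus
begin

definition heat :: "real \<Rightarrow> 'a \<Rightarrow> 'a" where
  "heat t = fun_op (\<lambda>r. exp (- (t * r)))"

lemma heat_in_dom: "t \<ge> 0 \<Longrightarrow> x \<in> dom (\<lambda>r. exp (- (t * r)))"
  by (rule in_dom_bounded_nonneg[where c = 1]) auto

lemma heat_0: "heat 0 x = x"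
  by (simp add: heat_def fun_op_1)

lemma heat_linear: "t \<ge> 0 \<Longrightarrow> heat t (a *\<^sub>R x + b *\<^sub>R y) = a *\<^sub>R heat t x + b *\<^sub>R heat t y"
  unfolding heat_def by (intro fun_op_linear heat_in_dom) auto

lemma heat_diff: "t \<ge> 0 \<Longrightarrow> heat t (x - y) = heat t x - heat t y"
  using heat_linear[of t 1 x "-1" y] by simp

lemma norm_heat_le: "t \<ge> 0 \<Longrightarrow> norm (heat t x) \<le> norm x"
proof -
  assume t: "t \<ge> 0"
  have "norm (fun_op (\<lambda>r. exp (- (t * r))) x) \<le> 1 * norm (fun_op (\<lambda>r. 1) x)"
    using t by (intro norm_fun_op_le const_in_dom AE_I_nonneg) auto
  then show ?thesis by (simp add: heat_def fun_op_1)
qed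

lemma heat_add: "s \<ge> 0 \<Longrightarrow> t \<ge> 0 \<Longrightarrow> heat (s + t) x = heat s (heat t x)"
proof -
  assume st: "s \<ge> 0" "t \<ge> 0"
  have eq: "(\<lambda>r. exp (- (s * r)) * exp (- (t * r))) = (\<lambda>r. exp (- ((s + t) * r)))"
    by (auto simp: exp_add[symmetric] algebra_simps)
  show ?thesis
    unfolding heat_def using st heat_in_dom[of "s + t" x]
    by (subst fun_op_fun_op) (auto simp: eq intro: heat_in_dom)
qed

lemma heat_tendsto: "t \<ge> 0 \<Longrightarrow> ((\<lambda>s. heat s x) \<longlongrightarrow> heat t x) (at t within {0..})"
  unfolding heat_def
  by (rule fun_op_tendsto_within[OF _ _ const_in_dom[of x 1]]) (auto intro!: tendsto_eq_intros)

lemma c0_semigroup_heat: "c0_semigroup UNIV norm heat"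
  unfolding c0_semigroup_def
proof (intro conjI allI impI ballI)
  fix t :: real assume t: "0 \<le> t"
  show "\<exists>M. \<forall>x\<in>UNIV. norm (heat t x) \<le> M * norm x"
    using norm_heat_le[OF t] by (intro exI[of _ 1]) simp
  show "((\<lambda>s. norm (heat s x - heat t x)) \<longlongrightarrow> 0) (at t within {0..})" for x
    using heat_tendsto[OF t] by (simp add: tendsto_norm_zero_iff LIM_zero_iff)
qed (simp_all add: heat_linear heat_0 heat_add)

lemma heat_in_dom_A:
  assumes x: "x \<in> dom (\<lambda>r. r)" and t: "t \<ge> 0"
  shows "x \<in> dom (\<lambda>r. r * exp (- (t * r)))" "heat t x \<in> dom (\<lambda>r. r)"
    "fun_op (\<lambda>r. r) (heat t x) = fun_op (\<lambda>r. r * exp (- (t * r))) x"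
proof -
  show d: "x \<in> dom (\<lambda>r. r * exp (- (t * r)))"
    using t by (intro in_dom_bound_nonneg[OF x]) (auto simp: abs_mult mult_left_le)
  show "heat t x \<in> dom (\<lambda>r. r)" "fun_op (\<lambda>r. r) (heat t x) = fun_op (\<lambda>r. r * exp (- (t * r))) x"
    unfolding heat_def using d t by (simp_all add: fun_op_in_dom_iff fun_op_fun_op heat_in_dom)
qed

lemma heat_has_vector_derivative:
  assumes x: "x \<in> dom (\<lambda>r. r)" and t: "t \<ge> 0"
  shows "((\<lambda>s. heat s x) has_vector_derivative - fun_op (\<lambda>r. r) (heat t x)) (at t within {0..})"
proof -
  have "((\<lambda>s. heat s x) has_vector_derivative fun_op (\<lambda>r. - 1 * (r * exp (- (t * r)))) x)
      (at t within {0..})"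
    unfolding heat_def
  proof (rule fun_op_has_vector_derivative[OF _ _ _ x])
    show "((\<lambda>s. exp (- (s * r))) has_real_derivative - 1 * (r * exp (- (t * r)))) (at t within {0..})" for r
      by (auto intro!: derivative_eq_intros)
    show "\<bar>exp (- (s * r)) - exp (- (t * r))\<bar> \<le> \<bar>s - t\<bar> * r" if "s \<in> {0..}" "0 \<le> r" for s r
    proof -
      have "s * r - t * r = (s - t) * r" by (simp add: algebra_simps)
      then show ?thesis
        using exp_minus_lipschitz[of "s * r" "t * r"] that t by (simp add: abs_mult)
    qed
  qed (use t heat_in_dom in auto)
  moreover have "fun_op (\<lambda>r. - 1 * (r * exp (- (t * r)))) x = - fun_op (\<lambda>r. r) (heat t x)"
    using fun_op_scale[of "\<lambda>r. r * exp (- (t * r))" x "-1"] heat_in_dom_A[OF x t] by simp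
  ultimately show ?thesis by simp
qed

lemma has_vector_derivative_0_generator:
  fixes T :: "real \<Rightarrow> 'b \<Rightarrow> 'b::real_normed_vector"
  assumes "\<And>x. T 0 x = x"
  shows "(x, y) \<in> generator UNIV norm T \<longleftrightarrow> ((\<lambda>s. T s x) has_vector_derivative y) (at 0 within {0..})"
  by (simp add: generator_def has_right_derivative_iff assms)

text \<open>The generator extends \<open>-A\<close> and is symmetric, because each \<open>e\<^sup>-\<^sup>t\<^sup>A\<close> is;
  a selfadjoint operator has no proper symmetric extension.\<close>

lemma generates_semigroup_heat:
  assumes sa: "selfadjoint A"
  shows "generates_semigroup UNIV norm (op_neg A) heat"
proof -
  have A_gen: "(x, - y) \<in> generator UNIV norm heat" if "(x, y) \<in> A" for x y
    using that heat_has_vector_derivative[of x 0]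
    by (simp add: A_iff has_vector_derivative_0_generator heat_0)
  have gen_A: "(x, - y) \<in> A" if xy: "(x, y) \<in> generator UNIV norm heat" for x y
  proof -
    have lim: "((\<lambda>h. (heat h x - x) /\<^sub>R h) \<longlongrightarrow> y) (at_right 0)" if "(x, y) \<in> generator UNIV norm heat" for x y
      using that by (simp add: generator_def tendsto_norm_zero_iff LIM_zero_iff)
    have "inner w x = inner p (- y)" if pw: "(p, w) \<in> A" for p w
    proof -
      have lim_p: "((\<lambda>h. inner ((heat h p - p) /\<^sub>R h) x) \<longlongrightarrow> inner (- w) x) (at_right 0)"
        by (intro tendsto_intros lim A_gen pw)
      have lim': "((\<lambda>h. inner p ((heat h x - x) /\<^sub>R h)) \<longlongrightarrow> inner p y) (at_right 0)"
        by (intro tendsto_intros lim xy)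
      have "\<forall>\<^sub>F h in at_right 0. inner ((heat h p - p) /\<^sub>R h) x = inner p ((heat h x - x) /\<^sub>R h)"
        using eventually_at_right_less[of "0::real"]
      proof eventually_elim
        case (elim h)
        then have "inner (heat h p) x = inner p (heat h x)"
          unfolding heat_def by (intro fun_op_symmetric heat_in_dom) auto
        then show ?case by (simp add: inner_diff_left inner_diff_right)
      qed
      from Lim_transform_eventually[OF lim_p this]
      have "((\<lambda>h. inner p ((heat h x - x) /\<^sub>R h)) \<longlongrightarrow> inner (- w) x) (at_right 0)" .
      from tendsto_unique[OF trivial_limit_at_right_real this lim']
      have "inner (- w) x = inner p y" .
      then show ?thesis by simp
    qed
    then have "(x, - y) \<in> op_adjoint A" by (auto simp: op_adjoint_def)
    then show ?thesis using sa by (simp add: selfadjoint_def)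
  qed
  have "generator UNIV norm heat = op_neg A"
    unfolding op_neg_def using A_gen gen_A by force
  then show ?thesis by (simp add: generates_semigroup_def c0_semigroup_heat)
qed

lemma E_Icc_tendsto: "(\<lambda>n. E {- real n..real n} x) \<longlonglongrightarrow> x"
proof (rule E_tendsto, simp, intro AE_I2)
  fix r :: real
  obtain N where "\<bar>r\<bar> \<le> real N" using real_arch_simple[of "\<bar>r\<bar>"] by (elim exE)
  then show "\<forall>\<^sub>F n in sequentially. r \<in> {- real n..real n}"
    by (intro eventually_sequentiallyI[of N]) auto
qed

lemma E_Icc_in_dom: "E {- real n..real n} x \<in> dom (\<lambda>r. r)"
  by (rule E_in_dom[where c = "real n"]) auto

lemma bounded_E_Icc_tendsto:
  fixes S :: "'a \<Rightarrow> 'a"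
  assumes "\<And>x y. S (x - y) = S x - S y" "\<And>x. norm (S x) \<le> M * norm x"
  shows "(\<lambda>n. S (E {- real n..real n} x)) \<longlonglongrightarrow> S x"
proof (rule Lim_null_comparison[THEN LIM_zero_cancel])
  let ?E = "\<lambda>n. E {- real n..real n} x"
  show "\<forall>\<^sub>F n in sequentially. norm (S (?E n) - S x) \<le> M * norm (?E n - x)"
    by (intro always_eventually allI) (simp only: assms(1)[symmetric] assms(2))
  show "(\<lambda>n. M * norm (?E n - x)) \<longlonglongrightarrow> 0"
    using tendsto_mult_right_zero[OF tendsto_norm_zero[OF LIM_zero[OF E_Icc_tendsto[of x]]]] .
qed

text \<open>On the domain of \<open>A\<close> the difference \<open>D\<close> of the two orbits satisfies \<open>D' = -AD\<close>, and
  \<open>(AD, D) \<ge> 0\<close>. By density and boundedness the semigroups agree everywhere.\<close>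

lemma generates_semigroup_heat_unique:
  assumes T: "generates_semigroup UNIV norm (op_neg A) T" and t: "t \<ge> 0"
  shows "T t x = heat t x"
proof -
  have c0: "c0_semigroup UNIV norm T" and gen: "generator UNIV norm T = op_neg A"
    using T by (simp_all add: generates_semigroup_def)
  have T_diff: "T t (x - y) = T t x - T t y" for x y
    using c0_semigroupD(2)[OF c0 t, of x y 1 "-1"] by simp
  let ?A = "fun_op (\<lambda>r. r)"
  have id: "(\<lambda>r::real. r) \<in> borel_measurable borel" by measurable
  have on_dom: "T t x = heat t x" if x: "x \<in> dom (\<lambda>r. r)" for x
  proof -
    have xy: "(x, - ?A x) \<in> generator UNIV norm T"
      unfolding gen op_neg_def using x A_iff by auto
    have T_A: "T t x \<in> dom (\<lambda>r. r)" "T t (- ?A x) = - ?A (T t x)" if t: "t \<ge> 0" for t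
    proof -
      have "(T t x, T t (- ?A x)) \<in> op_neg A"
        using generator_orbit[OF c0 subspace_UNIV norm_ge_zero xy t] unfolding gen .
      then show "T t x \<in> dom (\<lambda>r. r)" "T t (- ?A x) = - ?A (T t x)"
        by (auto simp: op_neg_def A_iff)
    qed
    note orbit = semigroup_orbit[OF c0 subspace_UNIV order_refl xy]
    define D where "D s = T s x - heat s x" for s
    have "D t = 0"
    proof (rule right_derivative_energy_zero[where D = D and c = 0])
      show "continuous_on {0..} D"
        unfolding D_def using heat_tendsto
        by (intro continuous_on_diff orbit(1)) (simp add: continuous_on_def)
      fix t :: real assume t: "t \<ge> 0"
      have "((\<lambda>s. heat s x) has_vector_derivative - ?A (heat t x)) (at t within {t..})"
        by (rule has_vector_derivative_within_subset[OF heat_has_vector_derivative[OF x t]]) (use t in auto)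
      from has_vector_derivative_diff[OF orbit(2)[OF t] this]
      show "(D has_vector_derivative (- ?A (T t x) - - ?A (heat t x))) (at t within {t..})"
        by (simp add: D_def[abs_def] T_A(2)[OF t])
      have "(D t, ?A (T t x) - ?A (heat t x)) \<in> A"
        unfolding A_iff D_def
        using fun_op_diff_arg[OF id T_A(1)[OF t] heat_in_dom_A(2)[OF x t]] by simp
      then have "0 \<le> inner (?A (T t x) - ?A (heat t x)) (D t)"
        using nonneg by (auto simp: nonneg_operator_def)
      then show "inner (D t) (- ?A (T t x) - - ?A (heat t x)) \<le> 0 * (norm (D t))\<^sup>2"
        by (simp add: inner_diff_right inner_diff_left inner_commute)
    next
      show "D 0 = 0" using c0_semigroupD(4)[OF c0, of x] by (simp add: D_def heat_0)
    qed (rule t)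
    then show ?thesis by (simp add: D_def)
  qed
  obtain M where M: "\<And>x. norm (T t x) \<le> M * norm x"
    using c0_semigroupD(3)[OF c0 t] by auto
  have "(\<lambda>n. heat t (E {- real n..real n} x)) \<longlonglongrightarrow> heat t x"
    by (rule bounded_E_Icc_tendsto[where M = 1]) (simp_all add: heat_diff[OF t] norm_heat_le[OF t])
  moreover have "(\<lambda>n. heat t (E {- real n..real n} x)) \<longlonglongrightarrow> T t x"
    using bounded_E_Icc_tendsto[of "T t" M x, OF T_diff M] by (simp only: on_dom[OF E_Icc_in_dom])
  ultimately show ?thesis by (rule LIMSEQ_unique[symmetric])
qed

lemma exp_semigroup_eq_heat:
  assumes "selfadjoint A" "t \<ge> 0"
  shows "exp_semigroup A t x = heat t x"
  unfolding exp_semigroup_def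
proof (rule the_equality)
  show "\<exists>T. generates_semigroup UNIV norm (op_neg A) T \<and> heat t x = T t x"
    using generates_semigroup_heat[OF assms(1)] by blast
  show "y = heat t x" if "\<exists>T. generates_semigroup UNIV norm (op_neg A) T \<and> y = T t x" for y
    using that generates_semigroup_heat_unique[OF _ assms(2)] by blast
qed

text \<open>Any two spectral measures of \<open>A\<close> give the same \<open>exp(-tA)\<close>, hence the same Laplace transforms of
  their scalar measures.\<close>

lemma op_fun_eq:
  assumes sa: "selfadjoint A" and f: "f \<in> borel_measurable borel"
  shows "op_fun A f = {(x, fun_op f x) | x. x \<in> dom f}"
proof -
  have unique: "scalar_measure E' x = \<mu> x" if E': "is_spectral_measure_of E' A" for E' x
  proof -
    interpret E': nonneg_spectral_calculus E' A
      using E' nonneg by unfold_locales (simp_all add: is_spectral_measure_of_def)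
    show ?thesis
    proof (rule finite_measure_eqI_laplace)
      fix t :: real assume t: "t \<ge> 0"
      have "(\<integral>r. exp (- (t * r)) \<partial>\<mu> x) = inner (heat t x) x"
        unfolding heat_def by (intro inner_fun_op_integral[symmetric] heat_in_dom t) simp
      also have "heat t x = E'.heat t x"
        by (rule E'.generates_semigroup_heat_unique[OF generates_semigroup_heat[OF sa] t])
      also have "inner (E'.heat t x) x = (\<integral>r. exp (- (t * r)) \<partial>scalar_measure E' x)"
        unfolding E'.heat_def by (intro E'.inner_fun_op_integral E'.heat_in_dom t) simp
      finally show "(\<integral>r. exp (- (t * r)) \<partial>scalar_measure E' x) = (\<integral>r. exp (- (t * r)) \<partial>\<mu> x)" ..
    qed (simp_all add: finite_measure_\<mu> E'.finite_measure_\<mu> AE_nonneg E'.AE_nonneg)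
  qed
  have "is_spectral_measure_of E A"
    by (simp add: is_spectral_measure_of_def spectral_measure A_eq)
  moreover have "spectral_integral E' f = spectral_integral E f" if "is_spectral_measure_of E' A" for E'
    by (rule fun_cong[OF spectral_integral_cong[OF unique[OF that]]])
  ultimately have "(\<exists>E'. is_spectral_measure_of E' A \<and> (x, y) \<in> spectral_integral E' f)
      \<longleftrightarrow> (x, y) \<in> spectral_integral E f" for x y
    by metis
  then have "op_fun A f = spectral_integral E f"
    by (simp only: op_fun_def) simp
  then show ?thesis by (simp add: spectral_integral_eq[OF f])
qed

lemma op_app_op_fun:
  assumes "selfadjoint A" "f \<in> borel_measurable borel" "x \<in> dom f"
  shows "op_app (op_fun A f) x = fun_op f x"
  using assms by (simp add: op_app_def op_fun_eq)

lemma Domain_op_fun: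
  assumes "selfadjoint A" "f \<in> borel_measurable borel"
  shows "Domain (op_fun A f) = dom f"
  using assms by (auto simp: op_fun_eq)

end

section \<open>The multipliers of the damped wave equation\<close>

text \<open>\<open>hyp_cos d\<close> and \<open>hyp_sin d\<close> are the solutions of \<open>w'' = d w\<close> with initial values \<open>(1, 0)\<close> and
  \<open>(0, 1)\<close>. The substitution \<open>w = e\<^sup>t\<^sup>/\<^sup>2 y\<close> turns \<open>y'' + y' + r y = 0\<close> into this equation with
  \<open>d = 1/4 - r\<close>; all signs of \<open>d\<close> occur.\<close>

definition hyp_cos :: "real \<Rightarrow> real \<Rightarrow> real" where
  "hyp_cos d t = (if d > 0 then cosh (t * sqrt d) else if d = 0 then 1 else cos (t * sqrt (- d)))"

definition hyp_sin :: "real \<Rightarrow> real \<Rightarrow> real" where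
  "hyp_sin d t = (if d > 0 then sinh (t * sqrt d) / sqrt d else if d = 0 then t
     else sin (t * sqrt (- d)) / sqrt (- d))"

lemma hyp_cos_0 [simp]: "hyp_cos d 0 = 1" and hyp_sin_0 [simp]: "hyp_sin d 0 = 0"
  by (simp_all add: hyp_cos_def hyp_sin_def)

lemma hyp_cos_has_derivative: "(hyp_cos d has_real_derivative d * hyp_sin d t) (at t)"
  and hyp_sin_has_derivative: "(hyp_sin d has_real_derivative hyp_cos d t) (at t)"
proof -

  consider "d > 0" | "d = 0" | "d < 0" by linarith
  then have "(hyp_cos d has_real_derivative d * hyp_sin d t) (at t) \<and>
      (hyp_sin d has_real_derivative hyp_cos d t) (at t)"
  proof cases
    case 1
    have f: "hyp_cos d = (\<lambda>t. cosh (t * sqrt d))" "hyp_sin d = (\<lambda>t. sinh (t * sqrt d) / sqrt d)"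
      using 1 by (auto simp: hyp_cos_def hyp_sin_def)
    have "d * (sinh (t * sqrt d) / sqrt d) = sqrt d * sinh (t * sqrt d)"
      using 1 by (simp add: field_simps)
    moreover have "((\<lambda>t. cosh (t * sqrt d)) has_real_derivative sqrt d * sinh (t * sqrt d)) (at t)"
      by (auto intro!: derivative_eq_intros)
    moreover have "((\<lambda>t. sinh (t * sqrt d) / sqrt d) has_real_derivative
        cosh (t * sqrt d) * sqrt d / sqrt d) (at t)"
      by (rule DERIV_cdivide) (auto intro!: derivative_eq_intros)
    ultimately show ?thesis
      unfolding f using 1 by simp
  next
    case 2
    have f: "hyp_cos d = (\<lambda>t. 1)" "hyp_sin d = (\<lambda>t. t)"
      using 2 by (auto simp: hyp_cos_def hyp_sin_def)
    show ?thesis unfolding f using 2 by (auto intro!: derivative_eq_intros)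
  next
    case 3
    have f: "hyp_cos d = (\<lambda>t. cos (t * sqrt (- d)))" "hyp_sin d = (\<lambda>t. sin (t * sqrt (- d)) / sqrt (- d))"
      using 3 by (auto simp: hyp_cos_def hyp_sin_def)
    have "d * (sin (t * sqrt (- d)) / sqrt (- d)) = - (sqrt (- d) * sin (t * sqrt (- d)))"
    proof -
      have "- (w * w) * (x / w) = - (w * x)" if "w > 0" for w x :: real
        using that by simp
      from this[of "sqrt (- d)"] show ?thesis using 3 by simp
    qed
    moreover have "((\<lambda>t. cos (t * sqrt (- d))) has_real_derivative - (sqrt (- d) * sin (t * sqrt (- d)))) (at t)"
      by (auto intro!: derivative_eq_intros)
    moreover have "((\<lambda>t. sin (t * sqrt (- d)) / sqrt (- d)) has_real_derivative
        cos (t * sqrt (- d)) * sqrt (- d) / sqrt (- d)) (at t)"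
      by (rule DERIV_cdivide) (auto intro!: derivative_eq_intros)
    ultimately show ?thesis
      unfolding f using 3 by simp
  qed
  then show "(hyp_cos d has_real_derivative d * hyp_sin d t) (at t)"
    "(hyp_sin d has_real_derivative hyp_cos d t) (at t)" by blast+
qed

lemma borel_measurable_hyp [measurable]:
  "(\<lambda>d. hyp_cos d t) \<in> borel_measurable borel" "(\<lambda>d. hyp_sin d t) \<in> borel_measurable borel"
proof -
  have [measurable]: "(cosh :: real \<Rightarrow> real) \<in> borel_measurable borel"
    "(sinh :: real \<Rightarrow> real) \<in> borel_measurable borel"
    by (auto intro!: borel_measurable_continuous_onI continuous_intros)
  show "(\<lambda>d. hyp_cos d t) \<in> borel_measurable borel" "(\<lambda>d. hyp_sin d t) \<in> borel_measurable borel"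
    unfolding hyp_cos_def hyp_sin_def by measurable
qed

text \<open>The solutions of \<open>y'' + y' + r y = 0\<close> with initial values \<open>(1, 0)\<close> and \<open>(0, 1)\<close> satisfy the
  system \<open>a' = -r b\<close>, \<open>b' = a - b\<close>, which is used instead of the explicit formulas until the final
  estimates.\<close>

definition mult_a :: "real \<Rightarrow> real \<Rightarrow> real" where
  "mult_a t r = exp (- t / 2) * (hyp_cos (1 / 4 - r) t + hyp_sin (1 / 4 - r) t / 2)"

definition mult_b :: "real \<Rightarrow> real \<Rightarrow> real" where
  "mult_b t r = exp (- t / 2) * hyp_sin (1 / 4 - r) t"

lemma mult_0 [simp]: "mult_a 0 r = 1" "mult_b 0 r = 0"
  by (simp_all add: mult_a_def mult_b_def)

lemma borel_measurable_mult_a [measurable]: "mult_a t \<in> borel_measurable borel"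
  and borel_measurable_mult_b [measurable]: "mult_b t \<in> borel_measurable borel"
  unfolding mult_a_def[abs_def] mult_b_def[abs_def] by measurable

lemma mult_a_has_derivative: "((\<lambda>t. mult_a t r) has_real_derivative - r * mult_b t r) (at t within S)"
  and mult_b_has_derivative: "((\<lambda>t. mult_b t r) has_real_derivative mult_a t r - mult_b t r) (at t within S)"
proof -
  note d = hyp_cos_has_derivative[THEN has_field_derivative_at_within]
    hyp_sin_has_derivative[THEN has_field_derivative_at_within]
  show "((\<lambda>t. mult_a t r) has_real_derivative - r * mult_b t r) (at t within S)"
    unfolding mult_a_def mult_b_def
    by (rule derivative_eq_intros d refl | simp)+ (simp add: algebra_simps)
  show "((\<lambda>t. mult_b t r) has_real_derivative mult_a t r - mult_b t r) (at t within S)"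
    unfolding mult_a_def mult_b_def
    by (rule derivative_eq_intros d refl | simp)+ (simp add: algebra_simps)
qed

text \<open>The energy \<open>a\<^sup>2 + r b\<^sup>2\<close> has the derivative \<open>-2 r b\<^sup>2\<close>.\<close>

lemma abs_mult_a_le:
  assumes "0 \<le> t" "0 \<le> r"
  shows "\<bar>mult_a t r\<bar> \<le> 1"
proof -
  have "(mult_a t r)\<^sup>2 + r * (mult_b t r)\<^sup>2 \<le> (mult_a 0 r)\<^sup>2 + r * (mult_b 0 r)\<^sup>2"
  proof (rule DERIV_nonpos_imp_nonincreasing[OF assms(1)])
    fix s assume "0 \<le> s" "s \<le> t"
    have "((\<lambda>t. (mult_a t r)\<^sup>2 + r * (mult_b t r)\<^sup>2) has_real_derivative - (2 * (r * (mult_b s r)\<^sup>2))) (at s)"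
      by (rule derivative_eq_intros mult_a_has_derivative mult_b_has_derivative refl | simp)+
        (simp add: algebra_simps power2_eq_square)
    then show "\<exists>y. ((\<lambda>t. (mult_a t r)\<^sup>2 + r * (mult_b t r)\<^sup>2) has_real_derivative y) (at s) \<and> y \<le> 0"
      using assms(2) by (intro exI conjI) auto
  qed
  moreover have "0 \<le> r * (mult_b t r)\<^sup>2" using assms by simp
  ultimately have "(mult_a t r)\<^sup>2 \<le> 1" by simp
  then show ?thesis using abs_le_square_iff[of "mult_a t r" 1] by simp
qed

text \<open>\<open>(e\<^sup>t b)' = e\<^sup>t a\<close>, and \<open>|a| \<le> 1\<close>.\<close>

lemma abs_mult_b_le:
  assumes "0 \<le> t" "0 \<le> r"
  shows "\<bar>mult_b t r\<bar> \<le> 1"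
proof -
  have "c * mult_b t r \<le> 1" if c: "\<bar>c\<bar> = 1" for c
  proof -
    have "exp 0 * (1 - c * mult_b 0 r) \<le> exp t * (1 - c * mult_b t r)"
    proof (rule DERIV_nonneg_imp_nondecreasing[OF assms(1)])
      fix s assume s: "0 \<le> s" "s \<le> t"
      have "((\<lambda>s. exp s * (1 - c * mult_b s r)) has_real_derivative exp s * (1 - c * mult_a s r)) (at s)"
        by (rule derivative_eq_intros mult_b_has_derivative refl | simp)+ (simp add: algebra_simps)
      moreover have "c * mult_a s r \<le> 1"
        using abs_mult_a_le[OF s(1) assms(2)] c by (auto simp: abs_if split: if_splits)
      ultimately show "\<exists>y. ((\<lambda>s. exp s * (1 - c * mult_b s r)) has_real_derivative y) (at s) \<and> 0 \<le> y"
        by (intro exI conjI) auto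
    qed
    then have "0 < exp t * (1 - c * mult_b t r)" by (simp add: less_le_trans[OF zero_less_one])
    then show ?thesis by (simp add: zero_less_mult_iff)
  qed
  from this[of 1] this[of "-1"] show ?thesis by simp
qed

section \<open>The damped wave semigroup\<close>

context nonneg_spectral_calculus
begin

abbreviation root_fun :: "real \<Rightarrow> real" where
  "root_fun \<equiv> \<lambda>r. r powr (1/2)"

lemma in_dom_1_plus:
  assumes "x \<in> dom (\<lambda>r. r)"
  shows "x \<in> dom (\<lambda>r. 1 + r)"
proof -
  have "x \<in> dom (\<lambda>r. 1 * 1 + 1 * r)"
    by (intro in_dom_add const_in_dom assms) auto
  then show ?thesis by simp
qed

lemma dom_root_fun: "x \<in> dom (\<lambda>r. r) \<Longrightarrow> x \<in> dom root_fun"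
proof (rule in_dom_bound_nonneg[OF in_dom_1_plus])
  fix r :: real assume r: "0 \<le> r"
  have "r \<le> (1 + r)\<^sup>2" using r by (simp add: power2_sum)
  then have "sqrt r \<le> 1 + r" using r by (simp add: real_le_lsqrt)
  then show "\<bar>root_fun r\<bar> \<le> \<bar>1 + r\<bar>" using r by (simp add: powr_half_sqrt)
qed auto

lemma mult_in_dom: "t \<ge> 0 \<Longrightarrow> x \<in> dom (mult_a t)" "t \<ge> 0 \<Longrightarrow> x \<in> dom (mult_b t)"
  by (auto intro!: in_dom_bounded_nonneg[where c = 1] abs_mult_a_le abs_mult_b_le)

lemma norm_mult_le:
  assumes "t \<ge> 0"
  shows "norm (fun_op (mult_a t) x) \<le> norm x" "norm (fun_op (mult_b t) x) \<le> norm x"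
proof -
  have "norm (fun_op f x) \<le> norm x" if "f \<in> borel_measurable borel" "\<And>r. 0 \<le> r \<Longrightarrow> \<bar>f r\<bar> \<le> 1" for f
  proof -
    have "norm (fun_op f x) \<le> 1 * norm (fun_op (\<lambda>r. 1) x)"
      by (rule norm_fun_op_le[OF that(1) _ const_in_dom]) (auto intro!: AE_I_nonneg that(2))
    then show ?thesis by (simp add: fun_op_1)
  qed
  then show "norm (fun_op (mult_a t) x) \<le> norm x" "norm (fun_op (mult_b t) x) \<le> norm x"
    using abs_mult_a_le[OF assms] abs_mult_b_le[OF assms] by simp_all
qed

text \<open>The multipliers of both components and their time derivatives are \<open>O(1 + r)\<close> uniformly in time,
  so for data in the domain of \<open>A\<close> the orbit can be differentiated under the integral.\<close>

lemma mult_bounds: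
  assumes "0 \<le> t" "0 \<le> r"
  shows "\<bar>- r * mult_b t r\<bar> \<le> 2 + 2 * r" "\<bar>mult_a t r - mult_b t r\<bar> \<le> 2 + 2 * r"
    "\<bar>- r * (mult_a t r - mult_b t r)\<bar> \<le> 2 + 2 * r"
    "\<bar>- r * mult_b t r - (mult_a t r - mult_b t r)\<bar> \<le> 2 + 2 * r"
    "\<bar>r * mult_a t r\<bar> \<le> r" "\<bar>r * mult_b t r\<bar> \<le> r"
proof -
  note b = abs_mult_a_le[OF assms] abs_mult_b_le[OF assms]
  show 1: "\<bar>r * mult_a t r\<bar> \<le> r" "\<bar>r * mult_b t r\<bar> \<le> r"
    using b assms(2) by (simp_all add: abs_mult mult_left_le)
  have 2: "\<bar>mult_a t r - mult_b t r\<bar> \<le> 2" using b by linarith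
  then show "\<bar>mult_a t r - mult_b t r\<bar> \<le> 2 + 2 * r" using assms by linarith
  show 3: "\<bar>- r * mult_b t r\<bar> \<le> 2 + 2 * r" using 1(2) assms(2) by simp
  show "\<bar>- r * (mult_a t r - mult_b t r)\<bar> \<le> 2 + 2 * r"
    using mult_left_mono[OF 2 assms(2)] assms(2) by (simp add: abs_mult mult.commute)
  show "\<bar>- r * mult_b t r - (mult_a t r - mult_b t r)\<bar> \<le> 2 + 2 * r" using 1(2) 2 assms(2) by simp
qed

lemma fun_op_mult_has_vector_derivative:
  fixes F F' :: "real \<Rightarrow> real \<Rightarrow> real"
  assumes x: "x \<in> dom (\<lambda>r. r)" and F: "\<And>s. F s \<in> borel_measurable borel" "F' t \<in> borel_measurable borel"
    and t: "t \<ge> 0" "x \<in> dom (F t)"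
    and der: "\<And>r s. 0 \<le> r \<Longrightarrow> 0 \<le> s \<Longrightarrow> ((\<lambda>s. F s r) has_real_derivative F' s r) (at s within {0..})"
    and bd: "\<And>s r. 0 \<le> s \<Longrightarrow> 0 \<le> r \<Longrightarrow> \<bar>F' s r\<bar> \<le> 2 + 2 * r"
  shows "((\<lambda>s. fun_op (F s) x) has_vector_derivative fun_op (F' t) x) (at t within {0..})"
proof (rule fun_op_has_vector_derivative[OF _ F(2)])
  have "x \<in> dom (\<lambda>r. 2 * (1 + r))" by (rule in_dom_scale[OF _ in_dom_1_plus[OF x]]) simp
  then show "x \<in> dom (\<lambda>r. 2 + 2 * r)" by (simp add: distrib_left)
  show "\<bar>F s r - F t r\<bar> \<le> \<bar>s - t\<bar> * (2 + 2 * r)" if "s \<in> {0..}" "0 \<le> r" for s r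
    using field_differentiable_bound[of "{0..}" "\<lambda>s. F s r" "\<lambda>s. F' s r" "2 + 2 * r" s t] der bd that t(1)
    by (simp add: mult.commute)
qed (use F t der in auto)

definition wave_fst :: "'a \<Rightarrow> 'a \<Rightarrow> real \<Rightarrow> 'a" where
  "wave_fst p q t = fun_op (mult_a t) p + fun_op (mult_b t) q"

definition wave_snd :: "'a \<Rightarrow> 'a \<Rightarrow> real \<Rightarrow> 'a" where
  "wave_snd p q t = fun_op (\<lambda>r. - r * mult_b t r) p + fun_op (\<lambda>r. mult_a t r - mult_b t r) q"

lemma wave_0: "wave_fst p q 0 = p" "wave_snd p q 0 = q"
proof -
  have "fun_op (\<lambda>r. 0) x = 0" for x
    using fun_op_scale[OF _ const_in_dom[of x 1], of 0] by simp
  then show "wave_fst p q 0 = p" "wave_snd p q 0 = q"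
    by (simp_all add: wave_fst_def wave_snd_def mult_0[abs_def] fun_op_1)
qed

lemma wave_equation:
  assumes p: "p \<in> dom (\<lambda>r. r)" and q: "q \<in> dom (\<lambda>r. r)" and t: "t \<ge> 0"
  shows "wave_fst p q t \<in> dom (\<lambda>r. r)"
    and "(wave_fst p q has_vector_derivative wave_snd p q t) (at t within {0..})"
    and "(wave_snd p q has_vector_derivative - fun_op (\<lambda>r. r) (wave_fst p q t) - wave_snd p q t)
      (at t within {0..})"
proof -
  have id: "(\<lambda>r::real. r) \<in> borel_measurable borel"
    and m: "(\<lambda>r. - r * mult_b s r) \<in> borel_measurable borel"
      "(\<lambda>r. mult_a s r - mult_b s r) \<in> borel_measurable borel"
      "(\<lambda>r. - r * (mult_a s r - mult_b s r)) \<in> borel_measurable borel"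
      "(\<lambda>r. - r * mult_b s r - (mult_a s r - mult_b s r)) \<in> borel_measurable borel" for s by measurable
  have d: "x \<in> dom (\<lambda>r. r * mult_a t r)" "x \<in> dom (\<lambda>r. r * mult_b t r)"
      "x \<in> dom (\<lambda>r. - r * mult_b t r)" "x \<in> dom (\<lambda>r. mult_a t r - mult_b t r)"
    if x: "x \<in> dom (\<lambda>r. r)" for x
  proof -
    show *: "x \<in> dom (\<lambda>r. r * mult_a t r)" "x \<in> dom (\<lambda>r. r * mult_b t r)"
      using mult_bounds(5,6)[OF t] by (auto intro!: in_dom_bound_nonneg[OF x])
    show "x \<in> dom (\<lambda>r. - r * mult_b t r)" using in_dom_scale[OF _ *(2), of "- 1"] by simp
    show "x \<in> dom (\<lambda>r. mult_a t r - mult_b t r)"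
      using in_dom_add[OF borel_measurable_mult_a borel_measurable_mult_b mult_in_dom[OF t],
          where a = 1 and b = "- 1"] by simp
  qed
  note der = fun_op_mult_has_vector_derivative
  note A = fun_op_compose[OF borel_measurable_mult_a mult_in_dom(1)[OF t] id d(1)[OF p]]
    fun_op_compose[OF borel_measurable_mult_b mult_in_dom(2)[OF t] id d(2)[OF q]]
  show "wave_fst p q t \<in> dom (\<lambda>r. r)"
    unfolding wave_fst_def by (rule fun_op_add_arg(1)[OF id A(1,3)])
  have A_fst: "fun_op (\<lambda>r. r) (wave_fst p q t) = fun_op (\<lambda>r. r * mult_a t r) p + fun_op (\<lambda>r. r * mult_b t r) q"
    unfolding wave_fst_def fun_op_add_arg(2)[OF id A(1,3)] A(2,4) ..
  show "(wave_fst p q has_vector_derivative wave_snd p q t) (at t within {0..})"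
    unfolding wave_fst_def[abs_def] wave_snd_def
    by (intro has_vector_derivative_add der p q t m mult_in_dom mult_bounds mult_a_has_derivative
        mult_b_has_derivative borel_measurable_mult_a borel_measurable_mult_b)
  have "((\<lambda>s. fun_op (\<lambda>r. - r * mult_b s r) p) has_vector_derivative
      fun_op (\<lambda>r. - r * (mult_a t r - mult_b t r)) p) (at t within {0..})"
    by (intro der p t d m mult_bounds DERIV_cmult mult_b_has_derivative)
  moreover have "((\<lambda>s. fun_op (\<lambda>r. mult_a s r - mult_b s r) q) has_vector_derivative
      fun_op (\<lambda>r. - r * mult_b t r - (mult_a t r - mult_b t r)) q) (at t within {0..})"
    by (intro der q t d m mult_bounds DERIV_diff mult_a_has_derivative mult_b_has_derivative)
  moreover have "fun_op (\<lambda>r. - r * (mult_a t r - mult_b t r)) p =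
      - fun_op (\<lambda>r. r * mult_a t r) p - fun_op (\<lambda>r. - r * mult_b t r) p"
  proof -
    have "fun_op (\<lambda>r. - 1 * (r * mult_a t r) + - 1 * (- r * mult_b t r)) p =
      - 1 *\<^sub>R fun_op (\<lambda>r. r * mult_a t r) p + - 1 *\<^sub>R fun_op (\<lambda>r. - r * mult_b t r) p"
      using d[OF p] by (intro fun_op_add) auto
    then show ?thesis by (simp add: right_diff_distrib)
  qed
  moreover have "fun_op (\<lambda>r. - r * mult_b t r - (mult_a t r - mult_b t r)) q =
      - fun_op (\<lambda>r. r * mult_b t r) q - fun_op (\<lambda>r. mult_a t r - mult_b t r) q"
    using fun_op_diff[OF m(1) d(3)[OF q] m(2) d(4)[OF q]] fun_op_scale[OF _ d(2)[OF q], of "- 1"] by simp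
  ultimately have "((\<lambda>s. fun_op (\<lambda>r. - r * mult_b s r) p + fun_op (\<lambda>r. mult_a s r - mult_b s r) q)
      has_vector_derivative (- fun_op (\<lambda>r. r * mult_a t r) p - fun_op (\<lambda>r. - r * mult_b t r) p)
        + (- fun_op (\<lambda>r. r * mult_b t r) q - fun_op (\<lambda>r. mult_a t r - mult_b t r) q)) (at t within {0..})"
    by (simp only: has_vector_derivative_add)
  moreover have "(- fun_op (\<lambda>r. r * mult_a t r) p - fun_op (\<lambda>r. - r * mult_b t r) p)
        + (- fun_op (\<lambda>r. r * mult_b t r) q - fun_op (\<lambda>r. mult_a t r - mult_b t r) q)
      = - fun_op (\<lambda>r. r) (wave_fst p q t) - wave_snd p q t"
    unfolding A_fst wave_snd_def by (simp only: diff_conv_add_uminus minus_add_distrib add_ac)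
  ultimately show "(wave_snd p q has_vector_derivative - fun_op (\<lambda>r. r) (wave_fst p q t) - wave_snd p q t)
      (at t within {0..})"
    by (simp only: wave_snd_def[abs_def])
qed

lemma op_power_half: "op_power A (1/2) = op_fun A root_fun"
  by (simp add: op_power_def)

lemma energy_space_eq: "selfadjoint A \<Longrightarrow> energy_space A = dom root_fun \<times> UNIV"
  by (simp add: energy_space_def op_power_half Domain_op_fun)

lemma subspace_energy_space: "selfadjoint A \<Longrightarrow> subspace (energy_space A)"
proof -
  have root: "root_fun \<in> borel_measurable borel" by measurable
  have "subspace (dom root_fun)"
  proof (rule subspaceI)
    show "0 \<in> dom root_fun" by (rule in_dom_0[OF root])
    show "x + y \<in> dom root_fun" if "x \<in> dom root_fun" "y \<in> dom root_fun" for x y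
      by (rule fun_op_add_arg(1)[OF root that])
    show "c *\<^sub>R x \<in> dom root_fun" if "x \<in> dom root_fun" for c x
      using in_dom_linear[OF root that that, of c 0] by simp
  qed
  then show "selfadjoint A \<Longrightarrow> subspace (energy_space A)"
    by (simp add: energy_space_eq subspace_Times)
qed

lemma norm_le_energy_norm: "norm z \<le> energy_norm A z"
  by (cases z) (simp add: energy_norm_def norm_Pair)

lemma E_Icc_fun_op_id:
  assumes w: "w \<in> dom (\<lambda>r. r)"
  shows "norm (E {- real n..real n} (fun_op (\<lambda>r. r) w)) \<le> real n * norm (E {- real n..real n} w)"
proof -
  let ?B = "{- real n..real n} :: real set"
  have B: "?B \<in> sets borel" by simp
  have "norm (fun_op (\<lambda>r. indicator ?B r * r) w) \<le> real n * norm (fun_op (indicator ?B) w)"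
    by (intro norm_fun_op_le in_dom_bounded[where c = 1] AE_I2) (auto simp: indicator_def)
  then show ?thesis using E_fun_op[OF B _ w] fun_op_indicator[OF B] by simp
qed

text \<open>For data in the domain of \<open>A\<close> the semigroup orbit and the explicit one both solve
  \<open>u' = v\<close>, \<open>v' = -Au - v\<close>. The spectral projection \<open>E[-n, n]\<close> commutes with \<open>A\<close> and makes it bounded by
  \<open>n\<close>. Therefore the norm of the projected difference in \<open>H \<times> H\<close> satisfies a Gronwall inequality and
  vanishes; the energy norm enters only through the fact that it dominates the norm of \<open>H \<times> H\<close>.\<close>

lemma wave_semigroup_eq_on_dom:
  assumes sa: "selfadjoint A"
    and T: "generates_semigroup (energy_space A) (energy_norm A) (op_neg (wave_operator A)) T"
    and p: "p \<in> dom (\<lambda>r. r)" and q: "q \<in> dom (\<lambda>r. r)" and t: "t \<ge> 0"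
  shows "fst (T t (p, q)) = wave_fst p q t"
proof -
  let ?X = "energy_space A" and ?A = "fun_op (\<lambda>r. r)" and ?U = "wave_fst p q" and ?V = "wave_snd p q"
  have c0: "c0_semigroup ?X (energy_norm A) T"
    and gen: "generator ?X (energy_norm A) T = op_neg (wave_operator A)"
    using T by (simp_all add: generates_semigroup_def)
  have root: "root_fun \<in> borel_measurable borel" and id: "(\<lambda>r::real. r) \<in> borel_measurable borel"
    by measurable
  note sub = subspace_energy_space[OF sa]
  have gen_iff: "((u, v), y) \<in> op_neg (wave_operator A) \<longleftrightarrow>
      u \<in> dom (\<lambda>r. r) \<and> v \<in> dom root_fun \<and> y = (v, - ?A u - v)" for u v y
    unfolding op_neg_def wave_operator_def
    by (auto simp: op_power_half Domain_op_fun[OF sa root] A_iff)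
  define y where "y = (q, - ?A p - q)"
  have xy: "((p, q), y) \<in> generator ?X (energy_norm A) T"
    unfolding gen gen_iff y_def using p dom_root_fun[OF q] by simp
  define u where "u s = fst (T s (p, q))" for s
  define v where "v s = snd (T s (p, q))" for s
  have uv: "u s \<in> dom (\<lambda>r. r)" "T s y = (v s, - ?A (u s) - v s)" if s: "s \<ge> 0" for s
  proof -
    have "(T s (p, q), T s y) \<in> generator ?X (energy_norm A) T"
      by (rule generator_orbit[OF c0 sub _ xy s]) (auto simp: energy_norm_def)
    then have "((u s, v s), T s y) \<in> op_neg (wave_operator A)" unfolding gen u_def v_def by simp
    then show "u s \<in> dom (\<lambda>r. r)" "T s y = (v s, - ?A (u s) - v s)" by (simp_all only: gen_iff)
  qed
  note orbit = semigroup_orbit[OF c0 sub norm_le_energy_norm xy]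
  note eq = wave_equation[OF p q]
  have "E {- real n..real n} (u t - ?U t) = 0" for n
  proof -
    let ?E = "E {- real n..real n}"
    let ?P = "\<lambda>z::'a \<times> 'a. (?E (fst z), ?E (snd z))"
    have E: "bounded_linear ?E" by (rule bounded_linear_E) simp
    have P: "bounded_linear ?P"
      by (intro bounded_linear_Pair bounded_linear_compose[OF E] bounded_linear_fst bounded_linear_snd)
    define D where "D s = ?P (T s (p, q) - (?U s, ?V s))" for s
    have "D t = 0"
    proof (rule right_derivative_energy_zero[where D = D and c = "1 + real n"])
      have "continuous_on {0..} ?U" "continuous_on {0..} ?V"
        using eq(2,3) by (auto intro!: continuous_on_vector_derivative)
      then show "continuous_on {0..} D"
        unfolding D_def by (intro bounded_linear.continuous_on[OF P] continuous_intros orbit(1))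
      fix t :: real assume t: "t \<ge> 0"
      let ?w = "u t - ?U t"
      have w: "?w \<in> dom (\<lambda>r. r)" "?A ?w = ?A (u t) - ?A (?U t)"
        by (rule fun_op_diff_arg[OF id uv(1)[OF t] eq(1)[OF t]])+
      have "(?U has_vector_derivative ?V t) (at t within {t..})"
        "(?V has_vector_derivative - ?A (?U t) - ?V t) (at t within {t..})"
        using t by (auto intro!: has_vector_derivative_within_subset[OF eq(2)[OF t]]
            has_vector_derivative_within_subset[OF eq(3)[OF t]])
      from bounded_linear.has_vector_derivative[OF P has_vector_derivative_diff[OF orbit(2)[OF t]
            has_vector_derivative_Pair[OF this]]]
      have "(D has_vector_derivative ?P (T t y - (?V t, - ?A (?U t) - ?V t))) (at t within {t..})"
        by (simp only: D_def[abs_def])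
      moreover have "?P (T t y - (?V t, - ?A (?U t) - ?V t))
          = (snd (D t), - ?E (?A ?w) - snd (D t))"
        unfolding uv(2)[OF t] w(2) D_def v_def by (simp add: E_linear_simps)
      ultimately show "(D has_vector_derivative (snd (D t), - ?E (?A ?w) - snd (D t))) (at t within {t..})"
        by simp
      have "norm (?E (?A ?w)) \<le> real n * norm (fst (D t))"
        using E_Icc_fun_op_id[OF w(1), of n] by (simp add: D_def u_def)
      then show "inner (D t) (snd (D t), - ?E (?A ?w) - snd (D t)) \<le> (1 + real n) * (norm (D t))\<^sup>2"
      proof (cases "D t")
        case (Pair a b)
        assume le: "norm (?E (?A ?w)) \<le> real n * norm (fst (D t))"
        have "inner a b \<le> norm a * norm b" by (rule norm_cauchy_schwarz)
        moreover have "- inner b (?E (?A ?w)) \<le> norm b * (real n * norm a)"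
          using norm_cauchy_schwarz[of "- b" "?E (?A ?w)"] mult_left_mono[OF le, of "norm b"] Pair by simp
        ultimately have "inner a b - inner b (?E (?A ?w)) \<le> (1 + real n) * (norm a * norm b)"
          by (simp add: algebra_simps)
        also have "\<dots> \<le> (1 + real n) * ((norm a)\<^sup>2 + (norm b)\<^sup>2)"
        proof (rule mult_left_mono)
          have "2 * (norm a * norm b) \<le> (norm a)\<^sup>2 + (norm b)\<^sup>2"
            using zero_le_power2[of "norm a - norm b"] by (simp add: power2_diff mult.assoc)
          moreover have "0 \<le> norm a * norm b" by (intro mult_nonneg_nonneg norm_ge_zero)
          ultimately show "norm a * norm b \<le> (norm a)\<^sup>2 + (norm b)\<^sup>2" by linarith
        qed simp
        finally have "inner a b - inner b (?E (?A ?w)) \<le> (1 + real n) * (norm (D t))\<^sup>2"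
          unfolding Pair by (simp add: norm_Pair)
        moreover have "inner (D t) (snd (D t), - ?E (?A ?w) - snd (D t))
            = inner a b - inner b (?E (?A ?w)) - inner b b"
          unfolding Pair by (simp add: inner_diff_right)
        ultimately show ?thesis using inner_ge_zero[of b] by linarith
      qed
    next
      have "(p, q) \<in> ?X" using xy by (simp add: generator_def)
      then show "D 0 = 0"
        using c0_semigroupD(4)[OF c0] by (simp add: D_def wave_0 E_linear_simps zero_prod_def)
    qed (rule t)
    then show ?thesis by (simp add: D_def u_def zero_prod_def)
  qed
  then have "u t - ?U t = 0"
    using E_Icc_tendsto[of "u t - ?U t"] by (simp add: LIMSEQ_const_iff)
  then show ?thesis by (simp add: u_def)
qed

text \<open>The spectrally truncated data are in the domain of \<open>A\<close> and converge to \<open>(u\<^sub>0, u\<^sub>1)\<close> in the energy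
  norm, since \<open>E[-n, n]\<close> commutes with \<open>A\<^sup>1\<^sup>/\<^sup>2\<close>.\<close>

theorem wave_solution_eq:
  assumes sa: "selfadjoint A" and sol: "wave_solution A u0 u1 u" and u0: "u0 \<in> dom root_fun" and t: "t \<ge> 0"
  shows "u t = fun_op (mult_a t) u0 + fun_op (mult_b t) u1"
proof -
  obtain T where T: "generates_semigroup (energy_space A) (energy_norm A) (op_neg (wave_operator A)) T"
    and u: "u t = fst (T t (u0, u1))"
    using sol t unfolding wave_solution_def by blast
  let ?X = "energy_space A" and ?K = "fun_op root_fun"
  have c0: "c0_semigroup ?X (energy_norm A) T"
    using T by (simp add: generates_semigroup_def)
  have sub: "subspace ?X" by (rule subspace_energy_space[OF sa])
  have root: "root_fun \<in> borel_measurable borel" by measurable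
  obtain M where M: "\<And>x. x \<in> ?X \<Longrightarrow> energy_norm A (T t x) \<le> M * energy_norm A x"
    using c0_semigroupD(3)[OF c0 t] by blast
  let ?E = "\<lambda>n. E {- real n..real n}"
  let ?x = "\<lambda>n. (?E n u0, ?E n u1)"
  have E_dom: "?E n u0 \<in> dom root_fun" for n
    by (rule dom_root_fun[OF E_Icc_in_dom])
  have X: "(u0, u1) \<in> ?X" "?x n \<in> ?X" for n
    using u0 E_dom by (simp_all add: energy_space_eq[OF sa])
  have KE: "?K (?E n u0 - u0) = ?E n (?K u0) - ?K u0" for n
  proof -
    have B: "{- real n..real n} \<in> sets borel" by simp
    have i: "indicator {- real n..real n} \<in> borel_measurable (borel :: real measure)"
      "u0 \<in> dom (indicator {- real n..real n})"
      by (auto intro!: in_dom_bounded[where c = 1] simp: indicator_def)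
    have d: "u0 \<in> dom (\<lambda>r. root_fun r * indicator {- real n..real n} r)"
      using iffD1[OF fun_op_in_dom_iff[OF i root]] E_dom by (simp add: fun_op_indicator)
    have "?K (?E n u0) = ?E n (?K u0)"
      using fun_op_fun_op[OF i root d] E_fun_op[OF B root u0] by (simp add: fun_op_indicator mult.commute)
    then show ?thesis by (simp only: fun_op_diff_arg(2)[OF root E_dom u0])
  qed
  have "op_app (op_power A (1/2)) (?E n u0 - u0) = ?K (?E n u0 - u0)" for n
    unfolding op_power_half by (rule op_app_op_fun[OF sa root fun_op_diff_arg(1)[OF root E_dom u0]])
  then have "energy_norm A (?x n - (u0, u1)) = sqrt ((norm (?E n u0 - u0))\<^sup>2
      + (norm (?E n (?K u0) - ?K u0))\<^sup>2 + (norm (?E n u1 - u1))\<^sup>2)" for n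
    by (simp only: energy_norm_def diff_Pair prod.case KE)
  moreover have "(\<lambda>n. sqrt ((norm (?E n u0 - u0))\<^sup>2 + (norm (?E n (?K u0) - ?K u0))\<^sup>2
      + (norm (?E n u1 - u1))\<^sup>2)) \<longlonglongrightarrow> sqrt (0\<^sup>2 + 0\<^sup>2 + 0\<^sup>2)"
    by (intro tendsto_intros tendsto_norm_zero LIM_zero E_Icc_tendsto)
  ultimately have lim: "(\<lambda>n. energy_norm A (?x n - (u0, u1))) \<longlonglongrightarrow> 0" by simp
  have norm_fst: "norm (fst z) \<le> norm z" for z :: "'a \<times> 'a"
    by (cases z) (simp add: norm_fst_le)
  have "(\<lambda>n. fst (T t (?x n))) \<longlonglongrightarrow> fst (T t (u0, u1))"
  proof (rule Lim_null_comparison[THEN LIM_zero_cancel])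
    have "norm (fst (T t (?x n)) - fst (T t (u0, u1))) \<le> M * energy_norm A (?x n - (u0, u1))" for n
    proof -
      have "T t (?x n - (u0, u1)) = T t (?x n) - T t (u0, u1)"
        using c0_semigroupD(2)[OF c0 t X(2,1), of 1 _ "-1"] by simp
      then have "norm (fst (T t (?x n)) - fst (T t (u0, u1))) \<le> norm (T t (?x n - (u0, u1)))"
        using norm_fst[of "T t (?x n) - T t (u0, u1)"] by simp
      also have "\<dots> \<le> energy_norm A (T t (?x n - (u0, u1)))" by (rule norm_le_energy_norm)
      also have "\<dots> \<le> M * energy_norm A (?x n - (u0, u1))"
        by (rule M[OF subspace_diff[OF sub X(2,1)]])
      finally show ?thesis .
    qed
    then show "\<forall>\<^sub>F n in sequentially. norm (fst (T t (?x n)) - fst (T t (u0, u1)))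
        \<le> M * energy_norm A (?x n - (u0, u1))"
      by (intro always_eventually allI)
    show "(\<lambda>n. M * energy_norm A (?x n - (u0, u1))) \<longlonglongrightarrow> 0"
      by (rule tendsto_mult_right_zero[OF lim])
  qed
  moreover have "fst (T t (?x n)) = fun_op (mult_a t) (?E n u0) + fun_op (mult_b t) (?E n u1)" for n
    using wave_semigroup_eq_on_dom[OF sa T E_Icc_in_dom E_Icc_in_dom t] by (simp only: wave_fst_def)
  moreover have "(\<lambda>n. fun_op (mult_a t) (?E n u0) + fun_op (mult_b t) (?E n u1)) \<longlonglongrightarrow>
      fun_op (mult_a t) u0 + fun_op (mult_b t) u1"
    using norm_mult_le[OF t]
    by (intro tendsto_add bounded_E_Icc_tendsto[where M = 1])
      (simp_all add: fun_op_diff_arg(2) mult_in_dom[OF t])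
  ultimately show ?thesis
    unfolding u using LIMSEQ_unique by simp
qed

end

section \<open>Low-frequency expansion\<close>

text \<open>The constant comes from the single term \<open>y\<^sup>N/N! \<le> e\<^sup>y\<close> of the exponential series, at
  \<open>y = d (1 + x)\<close>.\<close>

definition decay_const :: "nat \<Rightarrow> real \<Rightarrow> real" where
  "decay_const N d = fact N / d ^ N * exp d"

lemma decay_const_pos: "d > 0 \<Longrightarrow> decay_const N d > 0"
  by (simp add: decay_const_def)

lemma power_exp_le_decay_const:
  fixes d x :: real
  assumes "d > 0" and x: "0 \<le> x"
  shows "(1 + x) ^ N * exp (- (d * x)) \<le> decay_const N d"
proof -
  have "(d * (1 + x)) ^ N /\<^sub>R fact N \<le> exp (d * (1 + x))"
    using sum_le_suminf[of "\<lambda>n. (d * (1 + x)) ^ n /\<^sub>R fact n" "{N}"]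
      summable_exp_generic[of "d * (1 + x)"] x assms by (simp add: exp_def)
  then have "(1 + x) ^ N \<le> fact N / d ^ N * exp (d * (1 + x))"
    using assms by (simp add: power_mult_distrib divide_simps mult_ac)
  then have "(1 + x) ^ N * exp (- (d * x)) \<le> fact N / d ^ N * exp (d * (1 + x)) * exp (- (d * x))"
    by (intro mult_right_mono) auto
  also have "\<dots> = decay_const N d" by (simp add: decay_const_def mult.assoc exp_add[symmetric] distrib_left)
  finally show "(1 + x) ^ N * exp (- (d * x)) \<le> decay_const N d" .
qed

lemma exp_minus_taylor:
  fixes x :: real
  assumes "0 \<le> x"
  shows "\<bar>exp (- x) - (\<Sum>j<n. (- x) ^ j / fact j)\<bar> \<le> x ^ n / fact n"
proof (cases "x = 0 \<or> n = 0")
  case True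
  then show ?thesis using assms by (cases n) (auto simp: sum.lessThan_Suc_shift simp del: sum.lessThan_Suc)
next
  case False
  then have x: "x > 0" "n > 0" using assms by auto
  have "\<exists>t>0. t < x \<and> exp (- x) = (\<Sum>m<n. ((- 1) ^ m * exp (- 0)) / fact m * x ^ m)
      + ((- 1) ^ n * exp (- t)) / fact n * x ^ n"
  proof (rule Maclaurin[OF x])
    show "\<forall>m t. m < n \<and> 0 \<le> t \<and> t \<le> x \<longrightarrow>
        ((\<lambda>t. (- 1) ^ m * exp (- t)) has_real_derivative (- 1) ^ Suc m * exp (- t)) (at t)"
      by (auto intro!: derivative_eq_intros)
  qed simp
  then obtain t where t: "t > 0" and e: "exp (- x) = (\<Sum>m<n. ((- 1) ^ m * exp (- 0)) / fact m * x ^ m)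
      + ((- 1) ^ n * exp (- t)) / fact n * x ^ n" by blast
  have "(\<Sum>m<n. ((- 1) ^ m * exp (- 0)) / fact m * x ^ m) = (\<Sum>j<n. (- x) ^ j / fact j)"
    by (intro sum.cong refl) (simp add: power_minus[of x])
  then have "\<bar>exp (- x) - (\<Sum>j<n. (- x) ^ j / fact j)\<bar> = exp (- t) * (x ^ n / fact n)"
    using x e by (simp add: abs_mult power_abs)
  also have "\<dots> \<le> 1 * (x ^ n / fact n)" using t x by (intro mult_right_mono) auto
  finally show ?thesis by simp
qed

definition disc :: "real \<Rightarrow> real" where "disc r = sqrt (1 - 4 * r)"

text \<open>The generating function \<open>(1 - s)/(2r)\<close> of the Catalan numbers, \<open>s = disc r\<close>, in a form without
  the removable singularity at \<open>r = 0\<close>.\<close>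

definition catalan :: "real \<Rightarrow> real" where "catalan r = 2 / (1 + disc r)"

text \<open>\<open>c\<^sup>i\<^sup>-\<^sup>1/s\<close>, because \<open>1/c = (1 + s)/2\<close>. The shift of the exponent by one makes the index a natural
  number; \<open>i = 0\<close> is the coefficient of \<open>v\<^sub>0\<close> in the slow part of the solution.\<close>

definition catalan_gf :: "nat \<Rightarrow> real \<Rightarrow> real" where
  "catalan_gf i r = catalan r ^ i * ((1 + disc r) / (2 * disc r))"

text \<open>The coefficient of \<open>r\<^sup>n\<close> in \<open>c\<^sup>i\<^sup>-\<^sup>1/s\<close>. Truncated subtraction gives the correct value \<open>1\<close> for
  \<open>i = n = 0\<close>.\<close>

definition catalan_coef :: "nat \<Rightarrow> nat \<Rightarrow> real" where
  "catalan_coef i n = real ((2 * n + i - 1) choose n)"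

text \<open>The threshold \<open>3/16\<close> keeps \<open>r\<close> away from \<open>1/4\<close>, where \<open>s\<close> vanishes.\<close>

lemma disc_catalan_facts:
  assumes "0 \<le> r" "r \<le> 3 / 16"
  shows "1 / 2 \<le> disc r" "disc r \<le> 1" "1 \<le> catalan r" "catalan r \<le> 2"
    "r * catalan r = (1 - disc r) / 2" "catalan r = 1 + r * (catalan r)\<^sup>2"
    "0 \<le> (1 + disc r) / (2 * disc r)" "(1 + disc r) / (2 * disc r) \<le> 2"
proof -
  show s: "1 / 2 \<le> disc r" unfolding disc_def
    using assms by (intro real_le_rsqrt) (simp add: power2_eq_square)
  show s1: "disc r \<le> 1" unfolding disc_def using assms by simp
  show c: "1 \<le> catalan r" "catalan r \<le> 2" unfolding catalan_def using s s1 by (simp_all add: field_simps)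
  have sq: "disc r * disc r = 1 - 4 * r" unfolding disc_def using assms by simp
  have "r * 4 = (1 - disc r) * (1 + disc r)" using sq by (simp add: algebra_simps)
  then show rc: "r * catalan r = (1 - disc r) / 2"
    unfolding catalan_def using s by (simp add: field_simps)
  have "catalan r * (1 - (1 - disc r) / 2) = 1"
    unfolding catalan_def using s by (simp add: field_simps)
  then have "catalan r * (1 - r * catalan r) = 1" by (simp only: rc)
  then show "catalan r = 1 + r * (catalan r)\<^sup>2" by (simp add: power2_eq_square algebra_simps)
  show "0 \<le> (1 + disc r) / (2 * disc r)" "(1 + disc r) / (2 * disc r) \<le> 2"
    using s s1 by (simp_all add: field_simps)
qed

lemma catalan_gf_bounds:
  assumes "0 \<le> r" "r \<le> 3 / 16"
  shows "0 \<le> catalan_gf i r" "catalan_gf i r \<le> 2 ^ Suc i"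
proof -
  note b = disc_catalan_facts[OF assms]
  show "0 \<le> catalan_gf i r" unfolding catalan_gf_def using b by (intro mult_nonneg_nonneg) auto
  have "catalan_gf i r \<le> 2 ^ i * 2" unfolding catalan_gf_def using b by (intro mult_mono power_mono) auto
  then show "catalan_gf i r \<le> 2 ^ Suc i" by simp
qed

text \<open>Both follow from \<open>c = 1 + r c\<^sup>2\<close>. The coefficients obey the same recurrences by Pascal's rule,
  so the remainders of the expansion do too, and the expansion follows by induction without any theory
  of power series.\<close>

lemma catalan_gf_recurrences:
  assumes "0 \<le> r" "r \<le> 3 / 16"
  shows "catalan_gf (Suc i) r = catalan_gf i r + r * catalan_gf (i + 2) r" "catalan_gf 1 r = 1 + 2 * r * catalan_gf 2 r"
proof -
  note b = disc_catalan_facts[OF assms]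
  have "catalan_gf (Suc i) r = catalan r * catalan_gf i r" by (simp add: catalan_gf_def)
  also have "\<dots> = catalan_gf i r + r * catalan_gf (i + 2) r"
    by (subst b(6)) (simp add: catalan_gf_def power_add power2_eq_square algebra_simps add_divide_distrib)
  finally show "catalan_gf (Suc i) r = catalan_gf i r + r * catalan_gf (i + 2) r" .
  have "catalan r * ((1 + disc r) / (2 * disc r)) = 1 / disc r"
  proof -
    have "2 / (1 + s) * ((1 + s) / (2 * s)) = 1 / s" if "s > 0" for s :: real
      using that by (simp add: divide_simps)
    then show ?thesis unfolding catalan_def using b(1) by simp
  qed
  then have g1: "catalan_gf 1 r = 1 / disc r" "catalan_gf 2 r = catalan r / disc r"
    by (simp_all only: catalan_gf_def power2_eq_square power_one_right mult.assoc) simp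
  have "2 * r * catalan_gf 2 r = 2 * (r * catalan r) / disc r" by (simp add: g1)
  then show "catalan_gf 1 r = 1 + 2 * r * catalan_gf 2 r"
    unfolding b(5) g1 using b(1) by (simp add: field_simps)
qed

lemma catalan_coef_recurrences:
  "catalan_coef (Suc i) (Suc n) = catalan_coef i (Suc n) + catalan_coef (i + 2) n" "catalan_coef 1 (Suc n) = 2 * catalan_coef 2 n" "catalan_coef i 0 = 1"
proof -
  have "(2 * Suc n + Suc i - 1) choose Suc n = (2 * n + i + 1 choose Suc n) + (2 * n + i + 1 choose n)"
    by simp
  moreover have "2 * Suc n + i - 1 = 2 * n + i + 1" "2 * n + (i + 2) - 1 = 2 * n + i + 1" by simp_all
  ultimately show "catalan_coef (Suc i) (Suc n) = catalan_coef i (Suc n) + catalan_coef (i + 2) n"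
    unfolding catalan_coef_def by simp
  have "(2 * n + 1 choose Suc n) = (2 * n + 1 choose n)"
    using binomial_symmetric[of n "2 * n + 1"] by simp
  moreover have "2 * Suc n + 1 - 1 = Suc (2 * n + 1)" "2 * n + 2 - 1 = 2 * n + 1" by simp_all
  ultimately show "catalan_coef 1 (Suc n) = 2 * catalan_coef 2 n"
    unfolding catalan_coef_def by (simp only: binomial_Suc_Suc)
  show "catalan_coef i 0 = 1" by (simp add: catalan_coef_def)
qed

lemma catalan_gf_expansion:
  "\<exists>C\<ge>0. \<forall>r. 0 \<le> r \<longrightarrow> r \<le> 3 / 16 \<longrightarrow> \<bar>catalan_gf i r - (\<Sum>n<N. catalan_coef i n * r ^ n)\<bar> \<le> C * r ^ N"
proof (induction N arbitrary: i)
  case 0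
  show ?case using catalan_gf_bounds by (intro exI[of _ "2 ^ Suc i"]) auto
next
  case (Suc N)
  define D where "D i N r = catalan_gf i r - (\<Sum>n<N. catalan_coef i n * r ^ n)" for i N r
  have shift: "r * (\<Sum>n<N. catalan_coef j n * r ^ n) = (\<Sum>n<N. catalan_coef j n * r ^ Suc n)" for j and r :: real
    by (simp add: sum_distrib_left mult_ac)
  have D_Suc: "D (Suc i) (Suc N) r = D i (Suc N) r + r * D (i + 2) N r"
    if "0 \<le> r" "r \<le> 3 / 16" for i r
    using catalan_gf_recurrences(1)[OF that, of i]
    by (simp add: D_def sum.lessThan_Suc_shift catalan_coef_recurrences(1,3) right_diff_distrib shift
        distrib_right sum.distrib del: sum.lessThan_Suc power_Suc)
  have D_1: "D 1 (Suc N) r = 2 * r * D 2 N r" if "0 \<le> r" "r \<le> 3 / 16" for r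
    using catalan_gf_recurrences(2)[OF that]
    by (simp add: D_def sum.lessThan_Suc_shift catalan_coef_recurrences(2,3) right_diff_distrib shift
        mult.assoc sum_distrib_left[symmetric] del: sum.lessThan_Suc power_Suc One_nat_def)
  have IH: "\<exists>C\<ge>0. \<forall>r. 0 \<le> r \<longrightarrow> r \<le> 3 / 16 \<longrightarrow> \<bar>D j N r\<bar> \<le> C * r ^ N" for j
    using Suc.IH[of j] by (simp add: D_def)
  have step: "\<exists>C\<ge>0. \<forall>r. 0 \<le> r \<longrightarrow> r \<le> 3 / 16 \<longrightarrow> \<bar>X r\<bar> \<le> C * r ^ Suc N"
    if X: "\<And>r. 0 \<le> r \<Longrightarrow> r \<le> 3 / 16 \<Longrightarrow> X r = Y r + a * (r * D j N r)"
      and Y: "\<exists>C\<ge>0. \<forall>r. 0 \<le> r \<longrightarrow> r \<le> 3 / 16 \<longrightarrow> \<bar>Y r\<bar> \<le> C * r ^ Suc N"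
    for X Y :: "real \<Rightarrow> real" and a j
  proof -
    obtain C where C: "C \<ge> 0" "\<And>r. 0 \<le> r \<Longrightarrow> r \<le> 3 / 16 \<Longrightarrow> \<bar>D j N r\<bar> \<le> C * r ^ N"
      using IH[of j] by auto
    obtain B where B: "B \<ge> 0" "\<And>r. 0 \<le> r \<Longrightarrow> r \<le> 3 / 16 \<Longrightarrow> \<bar>Y r\<bar> \<le> B * r ^ Suc N"
      using Y by auto
    have "\<bar>X r\<bar> \<le> (B + \<bar>a\<bar> * C) * r ^ Suc N" if r: "0 \<le> r" "r \<le> 3 / 16" for r
    proof -
      have "\<bar>X r\<bar> \<le> \<bar>Y r\<bar> + \<bar>a\<bar> * (r * \<bar>D j N r\<bar>)"
        unfolding X[OF r] using r abs_triangle_ineq[of "Y r" "a * (r * D j N r)"] by (simp add: abs_mult)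
      also have "\<dots> \<le> B * r ^ Suc N + \<bar>a\<bar> * (r * (C * r ^ N))"
        using r by (intro add_mono B mult_left_mono C) auto
      finally show ?thesis by (simp add: algebra_simps)
    qed
    then show ?thesis using B(1) C(1) by (intro exI[of _ "B + \<bar>a\<bar> * C"]) auto
  qed
  have zero: "\<exists>C\<ge>0. \<forall>r. 0 \<le> r \<longrightarrow> r \<le> 3 / 16 \<longrightarrow> \<bar>0 :: real\<bar> \<le> C * r ^ Suc N" by auto
  have 1: "\<exists>C\<ge>0. \<forall>r. 0 \<le> r \<longrightarrow> r \<le> 3 / 16 \<longrightarrow> \<bar>D 1 (Suc N) r\<bar> \<le> C * r ^ Suc N"
    by (rule step[OF _ zero, where a = 2 and j = 2]) (simp add: D_1 del: One_nat_def)
  have 0: "\<exists>C\<ge>0. \<forall>r. 0 \<le> r \<longrightarrow> r \<le> 3 / 16 \<longrightarrow> \<bar>D 0 (Suc N) r\<bar> \<le> C * r ^ Suc N"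
    by (rule step[OF _ 1, where a = "-1" and j = 2]) (use D_Suc[of _ 0] in \<open>simp add: numeral_2_eq_2\<close>)
  have "\<exists>C\<ge>0. \<forall>r. 0 \<le> r \<longrightarrow> r \<le> 3 / 16 \<longrightarrow> \<bar>D i (Suc N) r\<bar> \<le> C * r ^ Suc N"
  proof (induction i)
    case (Suc i)
    show ?case
      by (rule step[OF _ Suc.IH, where a = 1 and j = "i + 2"]) (use D_Suc[of _ i] in simp)
  qed (rule 0)
  then show ?case by (simp add: D_def)
qed

text \<open>The multiplier of the \<open>l\<close>-th profile that acts on \<open>v\<^sub>0\<close> (\<open>e = 0\<close>) or on \<open>u\<^sub>1\<close> (\<open>e = 1\<close>), with
  the binomial coefficients in the form in which they arise from the expansion of \<open>c\<^sup>k/s\<close>. The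
  sum is empty for \<open>l = 0\<close>, \<open>e = 1\<close>.\<close>

definition profile_mult :: "nat \<Rightarrow> nat \<Rightarrow> real \<Rightarrow> real \<Rightarrow> real" where
  "profile_mult e l t r = r ^ l * (\<Sum>j<Suc l - e. catalan_coef (2 * j + 2 * e) (l - j - e) * ((- (t * r)) ^ j / fact j))
     * exp (- (t * r))"

text \<open>The sum of the profiles is taken by powers of \<open>r\<close>, the expansion of the solution by powers of
  \<open>-tr\<close>: the substitution is \<open>l = e + j + n\<close>.\<close>

lemma sum_profile_mult_eq:
  assumes e: "e \<le> 1"
  shows "(\<Sum>l=0..m. profile_mult e l t r) = (\<Sum>j<Suc m - e. \<Sum>n<Suc m - e - j.
    r ^ (e + j) * ((- (t * r)) ^ j / fact j) * exp (- (t * r)) * (catalan_coef (2 * j + 2 * e) n * r ^ n))"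
proof -
  let ?M = "Suc m - e"
  let ?f = "\<lambda>j n. r ^ (e + j) * ((- (t * r)) ^ j / fact j) * exp (- (t * r)) * (catalan_coef (2 * j + 2 * e) n * r ^ n)"
  have "(\<Sum>l=0..m. profile_mult e l t r) = (\<Sum>l<Suc m. profile_mult e l t r)"
    by (simp add: atLeast0AtMost lessThan_Suc_atMost)
  also have "\<dots> = (\<Sum>p<?M. profile_mult e (p + e) t r)"
  proof (cases "e = 0")
    case False
    then have "e = 1" using e by simp
    then show ?thesis by (simp add: sum.lessThan_Suc_shift[of _ m] profile_mult_def[of "Suc 0" 0] del: sum.lessThan_Suc)
  qed simp
  also have "\<dots> = (\<Sum>p<?M. \<Sum>j\<le>p. ?f j (p - j))"
  proof (intro sum.cong refl)
    fix p
    have "profile_mult e (p + e) t r = (\<Sum>j\<le>p. r ^ (p + e) * (catalan_coef (2 * j + 2 * e) (p - j) * ((- (t * r)) ^ j / fact j))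
        * exp (- (t * r)))"
      by (simp add: profile_mult_def sum_distrib_left sum_distrib_right lessThan_Suc_atMost)
    also have "\<dots> = (\<Sum>j\<le>p. ?f j (p - j))"
    proof (intro sum.cong refl)
      fix j assume "j \<in> {..p}"
      then have "r ^ (p + e) = r ^ (e + j) * r ^ (p - j)" by (simp add: power_add[symmetric] add.commute)
      then show "r ^ (p + e) * (catalan_coef (2 * j + 2 * e) (p - j) * ((- (t * r)) ^ j / fact j)) * exp (- (t * r))
          = ?f j (p - j)" by (simp only: mult_ac)
    qed
    finally show "profile_mult e (p + e) t r = (\<Sum>j\<le>p. ?f j (p - j))" .
  qed
  also have "\<dots> = (\<Sum>(j, n)\<in>{(j, n). j + n < ?M}. ?f j n)"
    by (rule sum.triangle_reindex[symmetric])
  also have "{(j, n). j + n < ?M} = (SIGMA j:{..<?M}. {..<?M - j})" by auto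
  also have "(\<Sum>(j, n)\<in>(SIGMA j:{..<?M}. {..<?M - j}). ?f j n) = (\<Sum>j<?M. \<Sum>n<?M - j. ?f j n)"
    by (rule sum.Sigma[symmetric]) auto
  finally show ?thesis .
qed

text \<open>The part of the solution with the slowly decaying exponential \<open>e\<^sup>-\<^sup>\<lambda>\<^sup>t\<close>; its coefficient is
  \<open>1/(c s)\<close> for \<open>v\<^sub>0\<close> and \<open>r c/s\<close> for \<open>u\<^sub>1\<close>.\<close>

definition slow_mult :: "nat \<Rightarrow> real \<Rightarrow> real \<Rightarrow> real" where
  "slow_mult e t r = r ^ e * catalan_gf (2 * e) r * exp (- (t * (r * catalan r)))"

text \<open>Two truncations are made, at total degree \<open>m\<close> in the powers of \<open>r\<close> not attached to \<open>t\<close>: the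
  exponential series of \<open>e\<^sup>-\<^sup>x\<close>, \<open>x = t\<lambda>\<^sup>2\<close>, after \<open>M\<close> terms and the power series of \<open>c\<^sup>k/s\<close>
  after \<open>M - j\<close> terms. Each error contains the factor \<open>r\<^sup>m\<^sup>+\<^sup>1\<close> and a power of \<open>tr\<close>.\<close>

lemma slow_mult_expansion:
  assumes e: "e \<le> 1"
  shows "\<exists>C\<ge>0. \<forall>t\<ge>0. \<forall>r. 0 \<le> r \<longrightarrow> r \<le> 3 / 16 \<longrightarrow>
    \<bar>slow_mult e t r - (\<Sum>l=0..m. profile_mult e l t r)\<bar> \<le> C * (r ^ Suc m * (1 + t * r) ^ Suc m * exp (- (t * r)))"
proof -
  define M where "M = Suc m - e"
  have M: "e + M = Suc m" "M \<le> Suc m" using e by (simp_all add: M_def)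
  have "\<forall>j. \<exists>C\<ge>0. \<forall>r. 0 \<le> r \<longrightarrow> r \<le> 3 / 16 \<longrightarrow>
      \<bar>catalan_gf (2 * j + 2 * e) r - (\<Sum>n<M - j. catalan_coef (2 * j + 2 * e) n * r ^ n)\<bar> \<le> C * r ^ (M - j)"
    using catalan_gf_expansion by blast
  from choice[OF this] obtain C where "\<forall>j. C j \<ge> 0 \<and> (\<forall>r. 0 \<le> r \<longrightarrow> r \<le> 3 / 16 \<longrightarrow>
      \<bar>catalan_gf (2 * j + 2 * e) r - (\<Sum>n<M - j. catalan_coef (2 * j + 2 * e) n * r ^ n)\<bar> \<le> C j * r ^ (M - j))"
    by (elim exE)
  then have C: "\<And>j. C j \<ge> 0" "\<And>j r. 0 \<le> r \<Longrightarrow> r \<le> 3 / 16 \<Longrightarrow>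
      \<bar>catalan_gf (2 * j + 2 * e) r - (\<Sum>n<M - j. catalan_coef (2 * j + 2 * e) n * r ^ n)\<bar> \<le> C j * r ^ (M - j)"
    by blast+
  define K where "K = 2 ^ Suc (2 * e) * 4 ^ M + (\<Sum>j<M. C j)"
  have K: "K \<ge> 0" unfolding K_def using C(1) by (intro add_nonneg_nonneg sum_nonneg) auto
  have "\<bar>slow_mult e t r - (\<Sum>l=0..m. profile_mult e l t r)\<bar> \<le> K * (r ^ Suc m * (1 + t * r) ^ Suc m * exp (- (t * r)))"
    if t: "t \<ge> 0" and r: "0 \<le> r" "r \<le> 3 / 16" for t r
  proof -
    define W where "W = (1 + t * r) ^ Suc m"
    define z where "z j = (- (t * r)) ^ j / fact j" for j :: nat
    define ex where "ex = exp (- (t * r))"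
    define x where "x = t * (r * catalan r)\<^sup>2"
    note b = disc_catalan_facts[OF r]
    have tr: "0 \<le> t * r" using t r by simp
    have x: "0 \<le> x" unfolding x_def using t by simp
    have W: "(t * r) ^ j \<le> W" if "j \<le> M" for j
    proof -
      have "(t * r) ^ j \<le> (1 + t * r) ^ j" using tr by (intro power_mono) auto
      also have "\<dots> \<le> W" unfolding W_def using that M tr by (intro power_increasing) auto
      finally show ?thesis .
    qed
    have W0: "0 \<le> W" unfolding W_def using tr by simp
    have "r * catalan r = r * (1 + r * (catalan r)\<^sup>2)"
      by (rule arg_cong[OF b(6)])
    then have "t * (r * catalan r) = t * (r * (1 + r * (catalan r)\<^sup>2))" by (rule arg_cong)
    also have "\<dots> = t * r + x" by (simp add: x_def power2_eq_square algebra_simps)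
    finally have "t * (r * catalan r) = t * r + x" .
    then have ex: "exp (- (t * (r * catalan r))) = ex * exp (- x)"
      by (simp add: ex_def exp_add[symmetric])
    define S where "S = (\<Sum>j<M. (- x) ^ j / fact j)"
    have shift: "r ^ e * catalan_gf (2 * e) r * ((- x) ^ j / fact j) = r ^ (e + j) * z j * catalan_gf (2 * j + 2 * e) r" for j
    proof -
      have "- x = - (t * r) * (r * (catalan r)\<^sup>2)" by (simp add: x_def power2_eq_square)
      then have "(- x) ^ j = (- (t * r)) ^ j * (r ^ j * catalan r ^ (2 * j))"
        by (simp only: power_mult_distrib power_mult)
      then show ?thesis by (simp add: z_def catalan_gf_def power_add mult_ac)
    qed
    let ?Q = "\<lambda>j. (\<Sum>n<M - j. catalan_coef (2 * j + 2 * e) n * r ^ n)"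
    have main: "slow_mult e t r = r ^ e * catalan_gf (2 * e) r * ex * (exp (- x) - S)
        + (\<Sum>j<M. r ^ (e + j) * z j * ex * catalan_gf (2 * j + 2 * e) r)"
    proof -
      have "(\<Sum>j<M. r ^ (e + j) * z j * ex * catalan_gf (2 * j + 2 * e) r)
          = (\<Sum>j<M. ex * (r ^ e * catalan_gf (2 * e) r * ((- x) ^ j / fact j)))"
        unfolding shift by (simp add: mult_ac)
      also have "\<dots> = r ^ e * catalan_gf (2 * e) r * ex * S"
        by (simp add: S_def sum_distrib_left mult_ac)
      finally have sum_eq: "(\<Sum>j<M. r ^ (e + j) * z j * ex * catalan_gf (2 * j + 2 * e) r)
          = r ^ e * catalan_gf (2 * e) r * ex * S" .
      show ?thesis
        unfolding slow_mult_def ex sum_eq by (simp only: right_diff_distrib mult.assoc diff_add_cancel)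
    qed
    have profile_mult: "(\<Sum>l=0..m. profile_mult e l t r) = (\<Sum>j<M. r ^ (e + j) * z j * ex *
        ?Q j)"
      unfolding sum_profile_mult_eq[OF e] M_def[symmetric] z_def ex_def by (simp only: sum_distrib_left)
    have ex0: "0 \<le> ex" by (simp add: ex_def)
    have T1: "\<bar>r ^ e * catalan_gf (2 * e) r * ex * (exp (- x) - S)\<bar> \<le> 2 ^ Suc (2 * e) * 4 ^ M * (r ^ Suc m * W * ex)"
    proof -
      have "x ^ M = (t * r) ^ M * (r ^ M * (catalan r ^ 2) ^ M)"
        by (simp add: x_def power_mult_distrib power2_eq_square)
      also have "\<dots> \<le> W * (r ^ M * 4 ^ M)"
        using W[of M] W0 r b(3,4) power_mono[of "catalan r" 2 2]
        by (intro mult_mono power_mono mult_left_mono) auto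
      finally have xM: "x ^ M \<le> W * (r ^ M * 4 ^ M)" .
      have "\<bar>exp (- x) - S\<bar> \<le> x ^ M / fact M" unfolding S_def by (rule exp_minus_taylor[OF x])
      also have "\<dots> \<le> x ^ M / 1" using x by (intro divide_left_mono) auto
      finally have d: "\<bar>exp (- x) - S\<bar> \<le> W * (r ^ M * 4 ^ M)" using xM by simp
      have "\<bar>r ^ e * catalan_gf (2 * e) r * ex * (exp (- x) - S)\<bar> = r ^ e * catalan_gf (2 * e) r * ex * \<bar>exp (- x) - S\<bar>"
        using r ex0 catalan_gf_bounds(1)[OF r] by (simp add: abs_mult)
      also have "\<dots> \<le> r ^ e * 2 ^ Suc (2 * e) * ex * (W * (r ^ M * 4 ^ M))"
        using r ex0 catalan_gf_bounds[OF r] d by (intro mult_mono mult_nonneg_nonneg) auto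
      also have "\<dots> = 2 ^ Suc (2 * e) * 4 ^ M * (r ^ (e + M) * W * ex)"
        by (simp only: power_add mult_ac)
      finally show ?thesis by (simp only: M(1))
    qed
    have T2: "\<bar>r ^ (e + j) * z j * ex * (catalan_gf (2 * j + 2 * e) r - ?Q j)\<bar>
        \<le> C j * (r ^ Suc m * W * ex)" if j: "j < M" for j
    proof -
      have "\<bar>z j\<bar> = (t * r) ^ j / fact j" using tr by (simp add: z_def power_abs)
      also have "\<dots> \<le> (t * r) ^ j / 1" using tr by (intro divide_left_mono) auto
      also have "\<dots> \<le> W" using W[of j] j by simp
      finally have z: "\<bar>z j\<bar> \<le> W" .
      have "\<bar>r ^ (e + j) * z j * ex * (catalan_gf (2 * j + 2 * e) r - ?Q j)\<bar>
        = r ^ (e + j) * \<bar>z j\<bar> * ex * \<bar>catalan_gf (2 * j + 2 * e) r - ?Q j\<bar>"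
        using r ex0 by (simp add: abs_mult)
      also have "\<dots> \<le> r ^ (e + j) * W * ex * (C j * r ^ (M - j))"
        using r ex0 z C(2)[OF r, of j] W0 by (intro mult_mono mult_nonneg_nonneg) auto
      also have "\<dots> = C j * (r ^ (e + j + (M - j)) * W * ex)" by (simp only: power_add mult_ac)
      also have "e + j + (M - j) = Suc m" using M j by simp
      finally show ?thesis .
    qed
    have bound: "\<bar>a + (\<Sum>j<M. f j)\<bar> \<le> A + (\<Sum>j<M. g j)"
      if "\<bar>a\<bar> \<le> A" "\<And>j. j < M \<Longrightarrow> \<bar>f j\<bar> \<le> g j" for a A :: real and f g
    proof -
      have "\<bar>\<Sum>j<M. f j\<bar> \<le> (\<Sum>j<M. \<bar>f j\<bar>)" by (rule sum_abs)
      also have "\<dots> \<le> (\<Sum>j<M. g j)" by (rule sum_mono) (simp add: that(2))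
      finally show ?thesis using that(1) by linarith
    qed
    have diff: "slow_mult e t r - (\<Sum>l=0..m. profile_mult e l t r) = r ^ e * catalan_gf (2 * e) r * ex * (exp (- x) - S)
        + (\<Sum>j<M. r ^ (e + j) * z j * ex * (catalan_gf (2 * j + 2 * e) r - ?Q j))"
      unfolding main profile_mult by (simp add: right_diff_distrib sum_subtractf)
    have "\<bar>slow_mult e t r - (\<Sum>l=0..m. profile_mult e l t r)\<bar>
        \<le> 2 ^ Suc (2 * e) * 4 ^ M * (r ^ Suc m * W * ex) + (\<Sum>j<M. C j * (r ^ Suc m * W * ex))"
      unfolding diff by (rule bound[OF T1 T2])
    also have "\<dots> = K * (r ^ Suc m * W * ex)"
      by (simp only: K_def distrib_right sum_distrib_right)
    finally show ?thesis by (simp only: W_def ex_def)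
  qed
  then show ?thesis using K by (intro exI[of _ K] conjI allI impI)
qed

text \<open>In terms of \<open>v\<^sub>0\<close> and \<open>u\<^sub>1\<close> the solution \<open>a(A) u\<^sub>0 + b(A) u\<^sub>1\<close> is
  \<open>a(A) v\<^sub>0 + (b - a)(A) u\<^sub>1\<close>.\<close>

definition solution_mult :: "nat \<Rightarrow> real \<Rightarrow> real \<Rightarrow> real" where
  "solution_mult e t r = (if e = 0 then mult_a t r else mult_b t r - mult_a t r)"

lemma solution_mult_low_frequency:
  assumes r: "0 \<le> r" "r \<le> 3 / 16" and t: "t \<ge> 0" and e: "e \<le> 1"
  shows "\<bar>solution_mult e t r - slow_mult e t r\<bar> \<le> 2 * exp (- (t / 2))"
proof -
  note b = disc_catalan_facts[OF r]
  define s where "s = disc r"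
  have s: "1 / 2 \<le> s" "s \<le> 1" using b by (simp_all add: s_def)
  have d: "1 / 4 - r > 0" "sqrt (1 / 4 - r) = s / 2"
  proof -
    show "1 / 4 - r > 0" using r by simp
    have "1 / 4 - r = (1 - 4 * r) / 4" by simp
    then show "sqrt (1 / 4 - r) = s / 2" unfolding s_def disc_def by (simp only: real_sqrt_divide real_sqrt_four)
  qed
  define p where "p = exp (- (t * ((1 - s) / 2)))"
  define q where "q = exp (- (t * ((1 + s) / 2)))"
  have pq: "exp (- t / 2) * exp (t * (s / 2)) = p" "exp (- t / 2) * exp (- (t * (s / 2))) = q"
    unfolding p_def q_def exp_add[symmetric] by (simp_all add: field_simps)
  have hyp: "hyp_cos (1 / 4 - r) t = cosh (t * (s / 2))" "hyp_sin (1 / 4 - r) t = sinh (t * (s / 2)) / (s / 2)"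
    using d(1) unfolding hyp_cos_def hyp_sin_def d(2) by simp_all
  have "c * cosh y = (c * exp y + c * exp (- y)) / 2" "c * (sinh y / (s / 2)) = (c * exp y - c * exp (- y)) / s"
    for c y :: real
    using s by (simp_all add: cosh_def sinh_def field_simps)
  then have C: "exp (- t / 2) * hyp_cos (1 / 4 - r) t = (p + q) / 2"
    and S: "exp (- t / 2) * hyp_sin (1 / 4 - r) t = (p - q) / s"
    by (simp_all only: hyp pq)
  have ab: "mult_a t r = (p + q) / 2 + (p - q) / s / 2" "mult_b t r = (p - q) / s"
    unfolding mult_a_def mult_b_def using C S by (simp_all add: distrib_left)
  have main: "slow_mult 0 t r = p * ((1 + s) / (2 * s))" "slow_mult 1 t r = p * ((1 - s) / (2 * s))"
  proof -
    show "slow_mult 0 t r = p * ((1 + s) / (2 * s))"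
      unfolding slow_mult_def catalan_gf_def b(5) p_def s_def by simp
    have "slow_mult 1 t r = (r * catalan r) * (catalan r * ((1 + s) / (2 * s))) * p"
      unfolding slow_mult_def catalan_gf_def p_def s_def b(5)[symmetric] by (simp add: power2_eq_square)
    also have "catalan r * ((1 + s) / (2 * s)) = 1 / s"
    proof -
      have "2 / (1 + s) * ((1 + s) / (2 * s)) = 1 / s" using s by (simp add: divide_simps)
      then show ?thesis unfolding catalan_def s_def[symmetric] .
    qed
    also have "(r * catalan r) * (1 / s) * p = p * ((1 - s) / (2 * s))"
      unfolding b(5) s_def[symmetric] by simp
    finally show "slow_mult 1 t r = p * ((1 - s) / (2 * s))" .
  qed
  have q: "0 \<le> q" "q \<le> exp (- (t / 2))"
    unfolding q_def using t s by (simp_all add: field_simps mult_left_mono)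
  have B: "(1 + s) / (2 * s) \<le> 2" "0 \<le> (1 + s) / (2 * s)" "0 \<le> (1 - s) / (2 * s)" "(1 - s) / (2 * s) \<le> 2"
    using s by (simp_all add: field_simps)
  have key: "\<bar>q * y\<bar> \<le> 2 * exp (- (t / 2))" if "0 \<le> y" "y \<le> 2" for y
  proof -
    have "q * y \<le> exp (- (t / 2)) * 2" using q that by (intro mult_mono) auto
    then show ?thesis using q that by (simp add: mult.commute)
  qed
  consider "e = 0" | "e = 1" using e by linarith
  then show ?thesis
  proof cases
    case 1
    have "solution_mult e t r - slow_mult e t r = - (q * ((1 - s) / (2 * s)))"
      unfolding 1 solution_mult_def main ab using s by (simp add: field_simps)
    then show ?thesis by (simp only: abs_minus_cancel key[OF B(3,4)])
  next
    case 2
    have "solution_mult e t r - slow_mult e t r = - (q * ((1 + s) / (2 * s)))"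
      unfolding 2 solution_mult_def main ab using s by (simp add: field_simps)
    then show ?thesis by (simp only: abs_minus_cancel key[OF B(2,1)])
  qed
qed

text \<open>\<open>d = 1/4 - r \<le> 1/16\<close>, so the growth of the hyperbolic functions is at most \<open>e\<^sup>t\<^sup>/\<^sup>4\<close>, which loses
  against \<open>e\<^sup>-\<^sup>t\<^sup>/\<^sup>2\<close>. The bound for \<open>hyp_sin\<close> comes from its derivative and is uniform near \<open>d = 0\<close>.\<close>

lemma solution_mult_high_frequency:
  assumes r: "3 / 16 \<le> r" and t: "t \<ge> 0"
  shows "\<bar>solution_mult e t r\<bar> \<le> (1 + t) * exp (- (t / 4))"
proof -
  define d where "d = 1 / 4 - r"
  have d: "d \<le> 1 / 16" using r by (simp add: d_def)
  have C: "\<bar>hyp_cos d s\<bar> \<le> exp (t / 4)" if s: "0 \<le> s" "s \<le> t" for s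
  proof (cases "d > 0")
    case True
    have "sqrt d \<le> 1 / 4" using d by (intro real_le_lsqrt) (auto simp: power2_eq_square)
    then have le: "s * sqrt d \<le> t * (1 / 4)" using s True by (intro mult_mono) auto
    have "0 \<le> s * sqrt d" using s True by simp
    then have "cosh (s * sqrt d) \<le> exp (s * sqrt d)" by (simp add: cosh_def)
    also have "\<dots> \<le> exp (t / 4)" using le by simp
    finally show ?thesis using True by (simp add: hyp_cos_def)
  next
    case False
    then have "\<bar>hyp_cos d s\<bar> \<le> 1" by (simp add: hyp_cos_def)
    also have "1 \<le> exp (t / 4)" using t by simp
    finally show ?thesis .
  qed
  have S: "\<bar>hyp_sin d t\<bar> \<le> exp (t / 4) * t"
    using field_differentiable_bound[of "{0..t}" "hyp_sin d" "hyp_cos d" "exp (t / 4)" t 0] C t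
      hyp_sin_has_derivative[THEN has_field_derivative_at_within] by simp
  have "\<bar>solution_mult e t r\<bar> \<le> exp (- t / 2) * (\<bar>hyp_cos d t\<bar> + \<bar>hyp_sin d t\<bar>)"
  proof -
    have "solution_mult e t r = exp (- t / 2) * (if e = 0 then hyp_cos d t + hyp_sin d t / 2
        else hyp_sin d t / 2 - hyp_cos d t)"
      by (simp add: solution_mult_def mult_a_def mult_b_def d_def algebra_simps)
    moreover have "\<bar>if e = 0 then x + y / 2 else y / 2 - x\<bar> \<le> \<bar>x\<bar> + \<bar>y\<bar>" for x y :: real
    proof -
      have "\<bar>x + y / 2\<bar> \<le> \<bar>x\<bar> + \<bar>y\<bar>" "\<bar>y / 2 - x\<bar> \<le> \<bar>x\<bar> + \<bar>y\<bar>" by linarith+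
      then show ?thesis by simp
    qed
    ultimately show ?thesis by (simp add: abs_mult)
  qed
  also have "\<dots> \<le> exp (- t / 2) * (exp (t / 4) + exp (t / 4) * t)"
    using C[of t] S t by (intro mult_left_mono add_mono) auto
  also have "\<dots> = (1 + t) * (exp (- t / 2) * exp (t / 4))" by (simp add: algebra_simps)
  also have "exp (- t / 2) * exp (t / 4) = exp (- (t / 4))" by (simp add: exp_add[symmetric])
  finally show ?thesis .
qed

section \<open>The pointwise estimate\<close>

lemma profile_mult_bound:
  "\<exists>K\<ge>0. \<forall>t\<ge>0. \<forall>r\<ge>0. \<bar>profile_mult e l t r\<bar> \<le> K * (r ^ l * (1 + t * r) ^ l * exp (- (t * r)))"
proof -
  define K where "K = (\<Sum>j<Suc l - e. catalan_coef (2 * j + 2 * e) (l - j - e))"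
  have K: "K \<ge> 0" unfolding K_def catalan_coef_def by (intro sum_nonneg) simp
  have "\<bar>profile_mult e l t r\<bar> \<le> K * (r ^ l * (1 + t * r) ^ l * exp (- (t * r)))" if t: "t \<ge> 0" and r: "r \<ge> 0" for t r
  proof -
    have tr: "0 \<le> t * r" using t r by simp
    have z: "\<bar>catalan_coef (2 * j + 2 * e) (l - j - e) * ((- (t * r)) ^ j / fact j)\<bar>
        \<le> catalan_coef (2 * j + 2 * e) (l - j - e) * (1 + t * r) ^ l" if "j < Suc l - e" for j
    proof -
      have "\<bar>(- (t * r)) ^ j / fact j\<bar> = (t * r) ^ j / fact j" using tr by (simp add: power_abs)
      also have "\<dots> \<le> (t * r) ^ j / 1" using tr by (intro divide_left_mono) auto
      also have "\<dots> \<le> (1 + t * r) ^ j / 1" using tr by (intro divide_right_mono power_mono) auto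
      also have "\<dots> \<le> (1 + t * r) ^ l" using that tr by (simp add: power_increasing)
      finally show ?thesis unfolding abs_mult by (intro mult_mono) (auto simp: catalan_coef_def)
    qed
    have "\<bar>\<Sum>j<Suc l - e. catalan_coef (2 * j + 2 * e) (l - j - e) * ((- (t * r)) ^ j / fact j)\<bar>
        \<le> (\<Sum>j<Suc l - e. \<bar>catalan_coef (2 * j + 2 * e) (l - j - e) * ((- (t * r)) ^ j / fact j)\<bar>)"
      by (rule sum_abs)
    also have "\<dots> \<le> (\<Sum>j<Suc l - e. catalan_coef (2 * j + 2 * e) (l - j - e) * (1 + t * r) ^ l)"
      by (rule sum_mono, rule z) simp
    also have "\<dots> = K * (1 + t * r) ^ l" by (simp only: K_def sum_distrib_right)
    finally have "\<bar>profile_mult e l t r\<bar> \<le> r ^ l * (K * (1 + t * r) ^ l) * exp (- (t * r))"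
      unfolding profile_mult_def abs_mult using r tr K by (intro mult_mono mult_nonneg_nonneg) auto
    then show ?thesis by (simp only: mult_ac)
  qed
  then show ?thesis using K by (intro exI[of _ K] conjI allI impI)
qed

definition sobolev_weight :: "nat \<Rightarrow> real \<Rightarrow> real" where
  "sobolev_weight m r = 1 + r powr (real m + 1 / 2)"

lemma sobolev_weight_ge_1: "1 \<le> sobolev_weight m r"
  by (simp add: sobolev_weight_def)

lemma power_le_sobolev_weight:
  assumes "0 \<le> r" "l \<le> m"
  shows "r ^ l \<le> sobolev_weight m r"
proof (cases "r \<le> 1")
  case True
  then have "r ^ l \<le> 1" using assms by (simp add: power_le_one)
  then show ?thesis using sobolev_weight_ge_1[of m r] by linarith
next
  case False
  then have "r ^ l = r powr real l" by (simp add: powr_realpow)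
  also have "\<dots> \<le> r powr (real m + 1 / 2)" using False assms by (intro powr_mono) auto
  finally show ?thesis by (simp add: sobolev_weight_def)
qed

definition remainder_mult :: "nat \<Rightarrow> nat \<Rightarrow> real \<Rightarrow> real \<Rightarrow> real" where
  "remainder_mult e m t r = solution_mult e t r - (\<Sum>l=0..m. profile_mult e l t r)"

text \<open>At low frequency \<open>(1 + t)\<^sup>m\<^sup>+\<^sup>1 r\<^sup>m\<^sup>+\<^sup>1 \<le> (1 + tr)\<^sup>m\<^sup>+\<^sup>1\<close> trades powers of \<open>r\<close> for decay. At high
  frequency \<open>e\<^sup>-\<^sup>t\<^sup>r\<close> is split into two halves: one controls the powers of \<open>tr\<close>, the other one is at most
  \<open>e\<^sup>-\<^sup>3\<^sup>t\<^sup>/\<^sup>3\<^sup>2\<close>.\<close>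

lemma solution_mult_asymptotics:
  assumes e: "e \<le> 1"
  shows "\<exists>C>0. \<forall>t\<ge>0. \<forall>r\<ge>0. (1 + t) ^ Suc m * \<bar>remainder_mult e m t r\<bar>
    \<le> C * sobolev_weight m r"
proof -
  obtain C1 where C1: "C1 \<ge> 0" "\<And>t r. t \<ge> 0 \<Longrightarrow> 0 \<le> r \<Longrightarrow> r \<le> 3 / 16 \<Longrightarrow>
    \<bar>slow_mult e t r - (\<Sum>l=0..m. profile_mult e l t r)\<bar> \<le> C1 * (r ^ Suc m * (1 + t * r) ^ Suc m * exp (- (t * r)))"
    using slow_mult_expansion[OF e, of m] by auto
  have "\<forall>l. \<exists>K\<ge>0. \<forall>t\<ge>0. \<forall>r\<ge>0. \<bar>profile_mult e l t r\<bar> \<le> K * (r ^ l * (1 + t * r) ^ l * exp (- (t * r)))"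
    using profile_mult_bound by (intro allI)
  from choice[OF this] obtain K where "\<forall>l. K l \<ge> 0 \<and> (\<forall>t\<ge>0. \<forall>r\<ge>0.
      \<bar>profile_mult e l t r\<bar> \<le> K l * (r ^ l * (1 + t * r) ^ l * exp (- (t * r))))"
    by (elim exE)
  then have K: "\<And>l. K l \<ge> 0" "\<And>l t r. t \<ge> 0 \<Longrightarrow> r \<ge> 0 \<Longrightarrow>
      \<bar>profile_mult e l t r\<bar> \<le> K l * (r ^ l * (1 + t * r) ^ l * exp (- (t * r)))" by simp_all
  define B1 where "B1 = decay_const (Suc m) (1 / 2)"
  have B1: "B1 > 0" "\<And>x. 0 \<le> x \<Longrightarrow> (1 + x) ^ (Suc m) * exp (- (1 / 2 * x)) \<le> B1"
    unfolding B1_def by (rule decay_const_pos power_exp_le_decay_const, simp)+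
  define B2 where "B2 = decay_const (Suc m + Suc m) (1)"
  have B2: "B2 > 0" "\<And>x. 0 \<le> x \<Longrightarrow> (1 + x) ^ (Suc m + Suc m) * exp (- (1 * x)) \<le> B2"
    unfolding B2_def by (rule decay_const_pos power_exp_le_decay_const, simp)+
  define B3 where "B3 = decay_const (Suc (Suc m)) (1 / 4)"
  have B3: "B3 > 0" "\<And>x. 0 \<le> x \<Longrightarrow> (1 + x) ^ (Suc (Suc m)) * exp (- (1 / 4 * x)) \<le> B3"
    unfolding B3_def by (rule decay_const_pos power_exp_le_decay_const, simp)+
  define B4 where "B4 = decay_const (m) (1 / 2)"
  have B4: "B4 > 0" "\<And>x. 0 \<le> x \<Longrightarrow> (1 + x) ^ (m) * exp (- (1 / 2 * x)) \<le> B4"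
    unfolding B4_def by (rule decay_const_pos power_exp_le_decay_const, simp)+
  define B5 where "B5 = decay_const (Suc m) (3 / 32)"
  have B5: "B5 > 0" "\<And>x. 0 \<le> x \<Longrightarrow> (1 + x) ^ (Suc m) * exp (- (3 / 32 * x)) \<le> B5"
    unfolding B5_def by (rule decay_const_pos power_exp_le_decay_const, simp)+
  define low where "low = 2 * B1 + C1 * B2"
  define high where "high = B3 + (\<Sum>l=0..m. K l * (B4 * B5))"
  have low0: "low > 0" unfolding low_def using B1(1) B2(1) C1(1) by (intro add_pos_nonneg mult_nonneg_nonneg) auto
  have high0: "high > 0" unfolding high_def
    using B3(1) B4(1) B5(1) K(1) by (intro add_pos_nonneg sum_nonneg mult_nonneg_nonneg) auto
  have low: "(1 + t) ^ Suc m * \<bar>remainder_mult e m t r\<bar> \<le> low"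
    if t: "t \<ge> 0" and r: "0 \<le> r" "r \<le> 3 / 16" for t r
  proof -
    have tr: "0 \<le> t * r" using t r by simp
    have 1: "(1 + t) ^ Suc m * (2 * exp (- (t / 2))) \<le> 2 * B1" using B1(2)[OF t] by simp
    have "((1 + t) * r) ^ Suc m \<le> (1 + t * r) ^ Suc m"
      using t r by (intro power_mono) (auto simp: algebra_simps)
    then have "((1 + t) * r) ^ Suc m * ((1 + t * r) ^ Suc m * exp (- (t * r)))
        \<le> (1 + t * r) ^ Suc m * ((1 + t * r) ^ Suc m * exp (- (t * r)))"
      using tr by (intro mult_right_mono) auto
    also have "\<dots> = (1 + t * r) ^ (Suc m + Suc m) * exp (- (1 * (t * r)))"
      by (simp only: power_add mult.assoc mult_1_left)
    also have "\<dots> \<le> B2" by (rule B2(2)[OF tr])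
    finally have 2: "C1 * (((1 + t) * r) ^ Suc m * ((1 + t * r) ^ Suc m * exp (- (t * r)))) \<le> C1 * B2"
      using C1(1) by (rule mult_left_mono)
    have "\<bar>remainder_mult e m t r\<bar>
        \<le> 2 * exp (- (t / 2)) + C1 * (r ^ Suc m * (1 + t * r) ^ Suc m * exp (- (t * r)))"
      using solution_mult_low_frequency[OF r t e] C1(2)[OF t r] unfolding remainder_mult_def by linarith
    then have "(1 + t) ^ Suc m * \<bar>remainder_mult e m t r\<bar>
        \<le> (1 + t) ^ Suc m * (2 * exp (- (t / 2)) + C1 * (r ^ Suc m * (1 + t * r) ^ Suc m * exp (- (t * r))))"
      using t by (intro mult_left_mono) auto
    also have "\<dots> = (1 + t) ^ Suc m * (2 * exp (- (t / 2)))
        + C1 * (((1 + t) * r) ^ Suc m * ((1 + t * r) ^ Suc m * exp (- (t * r))))"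
      by (simp only: distrib_left[of "(1 + t) ^ Suc m"] power_mult_distrib mult_ac)
    finally show ?thesis using 1 2 unfolding low_def by linarith
  qed
  have high: "(1 + t) ^ Suc m * \<bar>remainder_mult e m t r\<bar> \<le> high * sobolev_weight m r"
    if t: "t \<ge> 0" and r: "3 / 16 \<le> r" for t r
  proof -
    let ?w = "sobolev_weight m r"
    have r0: "0 \<le> r" and tr: "0 \<le> t * r" using t r by auto
    have 1: "(1 + t) ^ Suc m * \<bar>solution_mult e t r\<bar> \<le> B3 * ?w"
    proof -
      have "(1 + t) ^ Suc m * \<bar>solution_mult e t r\<bar> \<le> (1 + t) ^ Suc m * ((1 + t) * exp (- (t / 4)))"
        using solution_mult_high_frequency[OF r t] t by (intro mult_left_mono) auto
      also have "\<dots> \<le> B3" using B3(2)[OF t] by (simp add: mult_ac)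
      also have "\<dots> \<le> B3 * ?w" using B3(1) sobolev_weight_ge_1[of m r] by simp
      finally show ?thesis .
    qed
    have 2: "(1 + t) ^ Suc m * \<bar>profile_mult e l t r\<bar> \<le> K l * (B4 * B5) * ?w" if l: "l \<in> {0..m}" for l
    proof -
      have "exp (- (t * r)) = exp (- (1 / 2 * (t * r))) * exp (- (1 / 2 * (t * r)))"
        by (simp add: exp_add[symmetric])
      also have "\<dots> \<le> exp (- (1 / 2 * (t * r))) * exp (- (3 / 32 * t))"
        using t r mult_left_mono[OF r t] by (intro mult_left_mono) auto
      finally have "(1 + t) ^ Suc m * ((1 + t * r) ^ l * exp (- (t * r)))
          \<le> (1 + t) ^ Suc m * ((1 + t * r) ^ m * (exp (- (1 / 2 * (t * r))) * exp (- (3 / 32 * t))))"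
        using t tr l by (intro mult_mono mult_left_mono power_increasing) auto
      also have "\<dots> = ((1 + t * r) ^ m * exp (- (1 / 2 * (t * r)))) * ((1 + t) ^ Suc m * exp (- (3 / 32 * t)))"
        by (simp only: mult_ac)
      also have "\<dots> \<le> B4 * B5"
        using B4 B5(2)[OF t] B4(2)[OF tr] t by (intro mult_mono) auto
      finally have b: "(1 + t) ^ Suc m * ((1 + t * r) ^ l * exp (- (t * r))) \<le> B4 * B5" .
      have "(1 + t) ^ Suc m * \<bar>profile_mult e l t r\<bar> \<le> (1 + t) ^ Suc m * (K l * (r ^ l * (1 + t * r) ^ l * exp (- (t * r))))"
        using K(2)[OF t r0] t by (intro mult_left_mono) auto
      also have "\<dots> = K l * (((1 + t) ^ Suc m * ((1 + t * r) ^ l * exp (- (t * r)))) * r ^ l)"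
        by (simp only: mult_ac)
      also have "\<dots> \<le> K l * (B4 * B5 * ?w)"
      proof (rule mult_left_mono[OF mult_mono[OF b] K(1)])
        show "r ^ l \<le> ?w" using power_le_sobolev_weight[OF r0] l by simp
        show "0 \<le> B4 * B5" using B4(1) B5(1) by simp
      qed (use r0 in simp)
      finally show ?thesis by (simp only: mult.assoc)
    qed
    have "\<bar>remainder_mult e m t r\<bar> \<le> \<bar>solution_mult e t r\<bar> + (\<Sum>l=0..m. \<bar>profile_mult e l t r\<bar>)"
      using abs_triangle_ineq4[of "solution_mult e t r" "\<Sum>l=0..m. profile_mult e l t r"]
        sum_abs[of "\<lambda>l. profile_mult e l t r" "{0..m}"] unfolding remainder_mult_def by linarith
    then have "(1 + t) ^ Suc m * \<bar>remainder_mult e m t r\<bar>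
        \<le> (1 + t) ^ Suc m * (\<bar>solution_mult e t r\<bar> + (\<Sum>l=0..m. \<bar>profile_mult e l t r\<bar>))"
      using t by (intro mult_left_mono) auto
    also have "\<dots> = (1 + t) ^ Suc m * \<bar>solution_mult e t r\<bar> + (\<Sum>l=0..m. (1 + t) ^ Suc m * \<bar>profile_mult e l t r\<bar>)"
      by (simp only: distrib_left sum_distrib_left)
    also have "\<dots> \<le> B3 * ?w + (\<Sum>l=0..m. K l * (B4 * B5) * ?w)"
      by (rule add_mono[OF 1 sum_mono[OF 2]])
    also have "\<dots> = high * ?w" by (simp only: high_def distrib_right sum_distrib_right)
    finally show ?thesis .
  qed
  have "(1 + t) ^ Suc m * \<bar>remainder_mult e m t r\<bar> \<le> (low + high) * sobolev_weight m r"
    if "t \<ge> 0" "r \<ge> 0" for t r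
  proof (cases "r \<le> 3 / 16")
    case True
    have "low \<le> low * sobolev_weight m r" using low0 sobolev_weight_ge_1[of m r] by simp
    moreover have "0 \<le> high * sobolev_weight m r" using high0 sobolev_weight_ge_1[of m r] by simp
    ultimately show ?thesis using low[OF that True] by (simp only: distrib_right)
  next
    case False
    have "0 \<le> low * sobolev_weight m r" using low0 sobolev_weight_ge_1[of m r] by simp
    moreover have "(1 + t) ^ Suc m * \<bar>remainder_mult e m t r\<bar> \<le> high * sobolev_weight m r"
      using False by (intro high that(1)) simp
    ultimately show ?thesis unfolding distrib_right by linarith
  qed
  then show ?thesis using low0 high0 by (intro exI[of _ "low + high"] conjI allI impI) auto
qed

section \<open>The asymptotic expansion of the solution\<close>

lemma borel_measurable_profile_mult [measurable]: "profile_mult e l t \<in> borel_measurable borel"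
  unfolding profile_mult_def[abs_def] by measurable

lemma borel_measurable_solution_mult [measurable]: "solution_mult e t \<in> borel_measurable borel"
  unfolding solution_mult_def[abs_def] by (cases "e = 0") simp_all

lemma borel_measurable_sobolev_weight [measurable]: "sobolev_weight m \<in> borel_measurable borel"
  unfolding sobolev_weight_def[abs_def] by measurable

lemma catalan_coef_eq_binomial:
  assumes "1 \<le> l" "j + e \<le> l"
  shows "catalan_coef (2 * j + 2 * e) (l - j - e) = real ((2 * l - 1) choose (l + j + e - 1))"
proof -
  have "2 * (l - j - e) + (2 * j + 2 * e) - 1 = 2 * l - 1" using assms by simp
  moreover have "(2 * l - 1) choose (l - j - e) = (2 * l - 1) choose (2 * l - 1 - (l - j - e))"
    by (rule binomial_symmetric) (use assms in simp)
  moreover have "2 * l - 1 - (l - j - e) = l + j + e - 1" using assms by simp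
  ultimately show ?thesis by (simp add: catalan_coef_def)
qed

context nonneg_spectral_calculus
begin

lemma sobolev_weight_in_dom:
  assumes "x \<in> dom (\<lambda>r. r powr (real m + 1 / 2))"
  shows "x \<in> dom (sobolev_weight m)"
proof -
  have "x \<in> dom (\<lambda>r. 1 * 1 + 1 * r powr (real m + 1 / 2))"
    by (intro in_dom_add const_in_dom assms) auto
  then show ?thesis by (simp add: sobolev_weight_def[abs_def])
qed

lemma profile_mult_in_dom:
  assumes x: "x \<in> dom (sobolev_weight m)" and l: "l \<le> m" and t: "t \<ge> 0"
  shows "x \<in> dom (profile_mult e l t)"
proof -
  obtain K where K: "K \<ge> 0" "\<And>r. 0 \<le> r \<Longrightarrow> \<bar>profile_mult e l t r\<bar> \<le> K * (r ^ l * (1 + t * r) ^ l * exp (- (t * r)))"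
    using profile_mult_bound[of e l] t by auto
  define B where "B = decay_const l 1"
  have B: "0 < B" "\<And>y. 0 \<le> y \<Longrightarrow> (1 + y) ^ l * exp (- (1 * y)) \<le> B"
    unfolding B_def by (rule decay_const_pos power_exp_le_decay_const, simp)+
  have "x \<in> dom (\<lambda>r. (K * B) * sobolev_weight m r)"
    by (rule in_dom_scale[OF borel_measurable_sobolev_weight x])
  then show ?thesis
  proof (rule in_dom_bound_nonneg[OF _ borel_measurable_profile_mult])
    fix r :: real assume r: "0 \<le> r"
    have "\<bar>profile_mult e l t r\<bar> \<le> K * (r ^ l * ((1 + t * r) ^ l * exp (- (1 * (t * r)))))"
      using K(2)[OF r] by (simp add: mult.assoc)
    also have "\<dots> \<le> K * (sobolev_weight m r * B)"
      using power_le_sobolev_weight[OF r l] B(2)[of "t * r"] r t K(1) sobolev_weight_ge_1[of m r]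
      by (intro mult_left_mono mult_mono) auto
    also have "\<dots> = \<bar>K * B * sobolev_weight m r\<bar>"
      using K(1) B(1) sobolev_weight_ge_1[of m r] by (simp add: abs_mult)
    finally show "\<bar>profile_mult e l t r\<bar> \<le> \<bar>K * B * sobolev_weight m r\<bar>" .
  qed
qed

lemma power_exp_in_dom:
  assumes t: "t \<ge> 0"
  shows "x \<in> dom (\<lambda>r. (- (t * r)) ^ j * exp (- (t * r)))"
proof (rule in_dom_bounded_nonneg)
  fix r :: real assume r: "0 \<le> r"
  then have tr: "0 \<le> t * r" using t by simp
  have "\<bar>(- (t * r)) ^ j * exp (- (t * r))\<bar> = (t * r) ^ j * exp (- (1 * (t * r)))"
    using t r by (simp add: abs_mult power_abs)
  also have "\<dots> \<le> (1 + t * r) ^ j * exp (- (1 * (t * r)))"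
    using tr by (intro mult_right_mono power_mono) auto
  also have "\<dots> \<le> decay_const j 1" by (rule power_exp_le_decay_const[OF _ tr]) simp
  finally show "\<bar>(- (t * r)) ^ j * exp (- (t * r))\<bar> \<le> decay_const j 1" .
qed simp

text \<open>A profile is \<open>A\<^sup>l\<close> applied to a bounded function of \<open>A\<close>; by the product rule it is a single
  function of \<open>A\<close>. At \<open>t = 0\<close> nothing is gained from the exponential, and the regularity of \<open>x\<close> puts the
  vector \<open>y\<close> into the domain of \<open>A\<^sup>l\<close>.\<close>

lemma fun_op_profile_mult:
  assumes sa: "selfadjoint A" and x: "x \<in> dom (sobolev_weight m)" and l: "1 \<le> l" "l \<le> m" and t: "t \<ge> 0"
    and e: "e \<le> 1"
  defines "y \<equiv> (\<Sum>j<Suc l - e. (real ((2 * l - 1) choose (l + j + e - 1)) / fact j) *\<^sub>R power_exp A j t x)"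
  shows "y \<in> dom (\<lambda>r. r powr real l)" "fun_op (\<lambda>r. r powr real l) y = fun_op (profile_mult e l t) x"
proof -
  define c where "c j = real ((2 * l - 1) choose (l + j + e - 1)) / fact j" for j
  define g where "g j r = (- (t * r)) ^ j * exp (- (t * r))" for j r
  define p where "p r = (\<Sum>j<Suc l - e. c j * g j r)" for r
  have g: "g j \<in> borel_measurable borel" "x \<in> dom (g j)" for j
    unfolding g_def[abs_def] using power_exp_in_dom[OF t] by simp_all
  have cg: "(\<lambda>r. c j * g j r) \<in> borel_measurable borel" "x \<in> dom (\<lambda>r. c j * g j r)" for j
    using g by (simp_all add: in_dom_scale)
  have "power_exp A j t x = fun_op (g j) x" for j
    using op_app_op_fun[OF sa g, of j] unfolding power_exp_def g_def[abs_def] .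
  then have y: "y = fun_op p x"
    unfolding y_def p_def[abs_def] c_def[symmetric] using fun_op_scale[OF g]
    by (subst fun_op_sum) (auto simp: cg)
  have p: "p \<in> borel_measurable borel" "x \<in> dom p"
    unfolding p_def[abs_def] using cg by (auto intro!: in_dom_sum)
  have eq: "r powr real l * p r = profile_mult e l t r" if r: "0 \<le> r" for r
  proof -
    have "r powr real l = r ^ l" using r l by (cases "r = 0") (auto simp: powr_realpow)
    moreover have "p r = (\<Sum>j<Suc l - e. catalan_coef (2 * j + 2 * e) (l - j - e) * ((- (t * r)) ^ j / fact j)) * exp (- (t * r))"
      unfolding p_def sum_distrib_right
    proof (intro sum.cong refl)
      fix j assume j: "j \<in> {..<Suc l - e}"
      have "catalan_coef (2 * j + 2 * e) (l - j - e) = real ((2 * l - 1) choose (l + j + e - 1))"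
        by (rule catalan_coef_eq_binomial[OF l(1)]) (use j in auto)
      then show "c j * g j r = catalan_coef (2 * j + 2 * e) (l - j - e) * ((- (t * r)) ^ j / fact j) * exp (- (t * r))"
        by (simp only: c_def g_def times_divide_eq_left times_divide_eq_right mult.assoc)
    qed
    ultimately show ?thesis by (simp add: profile_mult_def mult.assoc)
  qed
  have d: "x \<in> dom (\<lambda>r. r powr real l * p r)"
    by (rule in_dom_bound_nonneg[OF profile_mult_in_dom[OF x l(2) t, of e]]) (use p eq in auto)
  have pw: "(\<lambda>r::real. r powr real l) \<in> borel_measurable borel" by measurable
  show "y \<in> dom (\<lambda>r. r powr real l)"
    unfolding y by (rule fun_op_compose(1)[OF p pw d])
  have "fun_op (\<lambda>r. r powr real l) y = fun_op (\<lambda>r. r powr real l * p r) x"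
    unfolding y by (rule fun_op_compose(2)[OF p pw d])
  also have "\<dots> = fun_op (profile_mult e l t) x"
    by (rule fun_op_cong_nonneg[OF _ borel_measurable_profile_mult profile_mult_in_dom[OF x l(2) t] eq])
      (use p pw in simp_all)
  finally show "fun_op (\<lambda>r. r powr real l) y = fun_op (profile_mult e l t) x" .
qed

lemma profile_eq:
  assumes sa: "selfadjoint A" and x: "u0 + u1 \<in> dom (sobolev_weight m)" "u1 \<in> dom (sobolev_weight m)"
    and l: "l \<le> m" and t: "t \<ge> 0"
  shows "profile A u0 u1 l t = fun_op (profile_mult 0 l t) (u0 + u1) + fun_op (profile_mult 1 l t) u1"
proof (cases "l = 0")
  case True
  have "profile_mult 0 0 t = (\<lambda>r. exp (- (t * r)))" "profile_mult 1 0 t = (\<lambda>r. 0 * 1)"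
    by (auto simp: profile_mult_def catalan_coef_def)
  moreover have "fun_op (\<lambda>r. 0 * 1) u1 = 0"
    using fun_op_scale[OF _ const_in_dom[of u1 1], of 0] by simp
  ultimately show ?thesis
    using exp_semigroup_eq_heat[OF sa t] by (simp add: profile_def True heat_def)
next
  case False
  then have l1: "1 \<le> l" by simp
  let ?y0 = "\<Sum>j=0..l. (real ((2 * l - 1) choose (l + j - 1)) / fact j) *\<^sub>R power_exp A j t (u0 + u1)"
  let ?y1 = "\<Sum>k=0..l - 1. (real ((2 * l - 1) choose (l + k)) / fact k) *\<^sub>R power_exp A k t u1"
  have i: "{0..l} = {..<Suc l - 0}" "{0..l - 1} = {..<Suc l - 1}" using l1 by auto
  have y0: "?y0 \<in> dom (\<lambda>r. r powr real l)" "fun_op (\<lambda>r. r powr real l) ?y0 = fun_op (profile_mult 0 l t) (u0 + u1)"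
    using fun_op_profile_mult[OF sa x(1) l1 l t, of 0] unfolding i by simp_all
  have y1: "?y1 \<in> dom (\<lambda>r. r powr real l)" "fun_op (\<lambda>r. r powr real l) ?y1 = fun_op (profile_mult 1 l t) u1"
    using fun_op_profile_mult[OF sa x(2) l1 l t, of 1] unfolding i by simp_all
  have pw: "(\<lambda>r::real. r powr real l) \<in> borel_measurable borel" by measurable
  have "profile A u0 u1 l t = op_app (op_fun A (\<lambda>r. r powr real l)) (?y0 + ?y1)"
    using False by (simp add: profile_def op_power_def)
  also have "\<dots> = fun_op (\<lambda>r. r powr real l) (?y0 + ?y1)"
    by (rule op_app_op_fun[OF sa pw fun_op_add_arg(1)[OF pw y0(1) y1(1)]])
  also have "\<dots> = fun_op (profile_mult 0 l t) (u0 + u1) + fun_op (profile_mult 1 l t) u1"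
    unfolding fun_op_add_arg(2)[OF pw y0(1) y1(1)] y0(2) y1(2) ..
  finally show ?thesis .
qed

lemma solution_mult_in_dom: "t \<ge> 0 \<Longrightarrow> x \<in> dom (solution_mult e t)"
  using abs_mult_a_le abs_mult_b_le
  by (intro in_dom_bounded_nonneg[where c = 2]) (fastforce simp: solution_mult_def abs_le_iff)+

text \<open>The pointwise bound becomes a bound in \<open>H\<close> by monotonicity of \<open>f \<mapsto> |f(A) x|\<close>.\<close>

lemma solution_mult_remainder:
  assumes x: "x \<in> dom (sobolev_weight m)" and e: "e \<le> 1"
  shows "\<exists>C>0. \<forall>t\<ge>0. norm (fun_op (solution_mult e t) x - (\<Sum>l=0..m. fun_op (profile_mult e l t) x)) \<le> C / (1 + t) ^ Suc m"
proof -
  obtain C where C: "C > 0" "\<And>t r. t \<ge> 0 \<Longrightarrow> r \<ge> 0 \<Longrightarrow>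
      (1 + t) ^ Suc m * \<bar>solution_mult e t r - (\<Sum>l=0..m. profile_mult e l t r)\<bar> \<le> C * sobolev_weight m r"
    using solution_mult_asymptotics[OF e, of m] by (auto simp: remainder_mult_def simp del: power_Suc)
  let ?N = "norm (fun_op (sobolev_weight m) x)"
  have "norm (fun_op (solution_mult e t) x - (\<Sum>l=0..m. fun_op (profile_mult e l t) x)) \<le> (C * ?N + 1) / (1 + t) ^ Suc m"
    if t: "t \<ge> 0" for t
  proof -
    let ?P = "\<lambda>r. \<Sum>l=0..m. profile_mult e l t r"
    have P: "?P \<in> borel_measurable borel" "x \<in> dom ?P" "fun_op ?P x = (\<Sum>l=0..m. fun_op (profile_mult e l t) x)"
      using profile_mult_in_dom[OF x _ t] by (auto intro!: in_dom_sum fun_op_sum)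
    have pos: "0 < (1 + t) ^ Suc m" using t by (intro zero_less_power) simp
    have "norm (fun_op (\<lambda>r. solution_mult e t r - ?P r) x) \<le> C / (1 + t) ^ Suc m * ?N"
    proof (rule norm_fun_op_le[OF _ borel_measurable_sobolev_weight x])
      show "0 \<le> C / (1 + t) ^ Suc m" using C(1) pos by simp
      show "AE r in \<mu> x. \<bar>solution_mult e t r - ?P r\<bar> \<le> C / (1 + t) ^ Suc m * \<bar>sobolev_weight m r\<bar>"
      proof (rule AE_I_nonneg)
        fix r :: real assume r: "0 \<le> r"
        have "\<bar>sobolev_weight m r\<bar> = sobolev_weight m r" using sobolev_weight_ge_1[of m r] by simp
        then show "\<bar>solution_mult e t r - ?P r\<bar> \<le> C / (1 + t) ^ Suc m * \<bar>sobolev_weight m r\<bar>"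
          using C(2)[OF t r] pos by (simp add: pos_le_divide_eq mult.commute del: power_Suc)
      qed
    qed (use P in simp)
    also have "\<dots> \<le> (C * ?N + 1) / (1 + t) ^ Suc m"
      using divide_right_mono[of "C * ?N" "C * ?N + 1" "(1 + t) ^ Suc m"] pos by (simp del: power_Suc)
    finally show ?thesis
      unfolding fun_op_diff[OF borel_measurable_solution_mult solution_mult_in_dom[OF t] P(1,2)] P(3) .
  qed
  moreover have "C * ?N + 1 > 0" using C(1) by (intro add_nonneg_pos mult_nonneg_nonneg) auto
  ultimately show ?thesis by (intro exI[of _ "C * ?N + 1"] conjI allI impI)
qed

lemma wave_asymptotics:
  assumes sa: "selfadjoint A"
    and u0: "u0 \<in> dom (\<lambda>r. r powr (real m + 1 / 2))" and u1: "u1 \<in> dom (\<lambda>r. r powr (real m + 1 / 2))"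
    and sol: "wave_solution A u0 u1 u"
  shows "\<exists>C>0. \<forall>t\<ge>0. norm (u t - (\<Sum>l=0..m. profile A u0 u1 l t)) \<le> C / (1 + t) ^ Suc m"
proof -
  let ?v0 = "u0 + u1"
  have w: "u0 \<in> dom (sobolev_weight m)" "u1 \<in> dom (sobolev_weight m)"
    using u0 u1 sobolev_weight_in_dom by blast+
  have w0: "?v0 \<in> dom (sobolev_weight m)"
    by (rule fun_op_add_arg(1)[OF borel_measurable_sobolev_weight w])
  obtain C0 where C0: "C0 > 0" "\<And>t. t \<ge> 0 \<Longrightarrow>
      norm (fun_op (solution_mult 0 t) ?v0 - (\<Sum>l=0..m. fun_op (profile_mult 0 l t) ?v0)) \<le> C0 / (1 + t) ^ Suc m"
    using solution_mult_remainder[OF w0, of 0] by (auto simp del: power_Suc)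
  obtain C1 where C1: "C1 > 0" "\<And>t. t \<ge> 0 \<Longrightarrow>
      norm (fun_op (solution_mult 1 t) u1 - (\<Sum>l=0..m. fun_op (profile_mult 1 l t) u1)) \<le> C1 / (1 + t) ^ Suc m"
    using solution_mult_remainder[OF w(2), of 1] by (auto simp del: power_Suc One_nat_def)
  have root: "u0 \<in> dom root_fun"
  proof (rule in_dom_bound_nonneg[OF w(1)])
    fix r :: real assume r: "0 \<le> r"
    have "r powr (1 / 2) \<le> sobolev_weight m r"
    proof (cases "r \<le> 1")
      case True
      then have "r powr (1 / 2) \<le> 1" using r powr_mono2[of "1 / 2" r 1] by simp
      then show ?thesis using sobolev_weight_ge_1[of m r] by linarith
    next
      case False
      then have "r powr (1 / 2) \<le> r powr (real m + 1 / 2)" by (intro powr_mono) auto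
      then show ?thesis by (simp add: sobolev_weight_def)
    qed
    then show "\<bar>root_fun r\<bar> \<le> \<bar>sobolev_weight m r\<bar>" by simp
  qed simp
  have "norm (u t - (\<Sum>l=0..m. profile A u0 u1 l t)) \<le> (C0 + C1) / (1 + t) ^ Suc m" if t: "t \<ge> 0" for t
  proof -
    have m0: "solution_mult 0 t = mult_a t" "solution_mult 1 t = (\<lambda>r. mult_b t r - mult_a t r)"
      by (auto simp: solution_mult_def)
    have "u t = fun_op (mult_a t) u0 + fun_op (mult_b t) u1"
      by (rule wave_solution_eq[OF sa sol root t])
    also have "\<dots> = fun_op (solution_mult 0 t) ?v0 + fun_op (solution_mult 1 t) u1"
      unfolding m0 by (simp add: fun_op_add_arg(2) fun_op_diff mult_in_dom[OF t])
    finally have u: "u t = fun_op (solution_mult 0 t) ?v0 + fun_op (solution_mult 1 t) u1" .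
    have "(\<Sum>l=0..m. profile A u0 u1 l t) = (\<Sum>l=0..m. fun_op (profile_mult 0 l t) ?v0 + fun_op (profile_mult 1 l t) u1)"
      by (intro sum.cong refl profile_eq[OF sa w0 w(2) _ t]) simp
    then have "u t - (\<Sum>l=0..m. profile A u0 u1 l t) =
        (fun_op (solution_mult 0 t) ?v0 - (\<Sum>l=0..m. fun_op (profile_mult 0 l t) ?v0))
        + (fun_op (solution_mult 1 t) u1 - (\<Sum>l=0..m. fun_op (profile_mult 1 l t) u1))"
      unfolding u by (simp add: sum.distrib)
    also have "norm \<dots> \<le> C0 / (1 + t) ^ Suc m + C1 / (1 + t) ^ Suc m"
      by (rule order_trans[OF norm_triangle_ineq add_mono[OF C0(2)[OF t] C1(2)[OF t]]])
    finally show ?thesis by (simp only: add_divide_distrib)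
  qed
  then show ?thesis using C0(1) C1(1) by (intro exI[of _ "C0 + C1"] conjI allI impI) auto
qed

end

theorem theorem1p2:
  fixes A :: "'a::{real_inner, complete_space} operator"
    and m :: nat
    and u0 u1 :: 'a
    and u :: "real \<Rightarrow> 'a"
  assumes "selfadjoint A"
    and "nonneg_operator A"
    and "u0 \<in> Domain (op_power A (real m + 1/2))"
    and "u1 \<in> Domain (op_power A (real m + 1/2))"
    and "wave_solution A u0 u1 u"
  shows "\<exists>C>0. \<forall>t\<ge>0.
    norm (u t - (\<Sum>l=0..m. profile A u0 u1 l t)) \<le> C * (1 + t) powr (- real m - 1/2)"
proof -
  have power: "op_power A (real m + 1/2) = op_fun A (\<lambda>r. r powr (real m + 1 / 2))"
    by (simp add: op_power_def)
  obtain E where E: "is_spectral_measure_of E A"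
    using assms(3) unfolding power by (auto simp: op_fun_def)
  interpret nonneg_spectral_calculus E A
    using E assms(2) by unfold_locales (simp_all add: is_spectral_measure_of_def)
  have meas: "(\<lambda>r::real. r powr (real m + 1 / 2)) \<in> borel_measurable borel" by measurable
  have "u0 \<in> dom (\<lambda>r. r powr (real m + 1 / 2))" "u1 \<in> dom (\<lambda>r. r powr (real m + 1 / 2))"
    using assms(3,4) unfolding power Domain_op_fun[OF assms(1) meas] .
  from wave_asymptotics[OF assms(1) this assms(5)]
  obtain C where C: "C > 0" "\<And>t. t \<ge> 0 \<Longrightarrow>
      norm (u t - (\<Sum>l=0..m. profile A u0 u1 l t)) \<le> C / (1 + t) ^ Suc m" by auto
  have "norm (u t - (\<Sum>l=0..m. profile A u0 u1 l t)) \<le> C * (1 + t) powr (- real m - 1/2)"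
    if t: "t \<ge> 0" for t
  proof -
    have "1 / (1 + t) ^ Suc m = (1 + t) powr (- real (Suc m))"
      using t by (simp add: powr_minus_divide powr_realpow del: power_Suc of_nat_Suc)
    also have "\<dots> \<le> (1 + t) powr (- real m - 1/2)" using t by (intro powr_mono) auto
    finally have "C * (1 / (1 + t) ^ Suc m) \<le> C * (1 + t) powr (- real m - 1/2)"
      using C(1) by (intro mult_left_mono) auto
    then show ?thesis using C(2)[OF t] by simp
  qed
  then show ?thesis using C(1) by (intro exI[of _ C] conjI allI impI)
qed

end
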